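(* Let $p$ be a polynomial non-vanishing on $\Delta$, let $h=1/p$ on $\Delta$, and let $\{\pi_n\}$, $\pi_n=p_n/q_n$, be the sequence of diagonal Padé approximants to $$f_{1/p}(z)=\frac{1}{\pi i}\int_\Delta\frac{1}{p(t)}\frac{1}{t-z}\frac{dt}{w^+(t)},\quad z\in D.$$ Let $S_n$ be the function on $\mathfrak{R}\setminus L$ associated with $h=1/p$ as described in the context and $S_n(z)=S_n(z^{(1)})$, $S_n^*(z)=S_n(z^{(2)})$, $z\in D$, its conjugate functions. Then for all $n$ with $2n>\deg(p)+2$, $$f_{1/p}-\pi_n=\frac{2}{w}\,\frac{S_n^*}{S_n+pS_n^*}\qquad\text{and}\qquad q_n=S_n+pS_n^*\qquad\text{in } D.$$
   Context: **Contour.** $a_1,a_2,a_3\in\mathbb{C}$ are non-collinear. $\Delta$ is the Chebotarëv continuum of $a_1,a_2,a_3$: the unique connected compact set of minimal logarithmic capacity among all continua containing these points. It consists of three analytic arcs $\Delta_1,\Delta_2,\Delta_3$ emanating from a common endpoint $a_0$, $\Delta_k$ ending at $a_k$; labels are such that the arcs are ordered clockwise around $a_0$. Each $\Delta_k$ is oriented from $a_0$ to $a_k$ (integrals over $\Delta$ use this orientation); left side $+$, right side $-$. $D:=\overline{\mathbb{C}}\setminus\Delta$. $\partial D$ is the two-sided boundary of $D$: two copies of each open arc of $\Delta_k$, three copies of $a_0$, one copy of each $a_k$, $k=1,2,3$; continuity of traces on $\partial D$ is understood in this sense. **Function $w$.** $w(z):=\sqrt{\prod_{k=0}^3(z-a_k)}$,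 holomorphic in $D\setminus\{\infty\}$, $w(z)/z^2\to1$ as $z\to\infty$; $w^+$ is its trace on the left side of each $\Delta_k$ ($w^+=-w^-$). **Riemann surface.** $\mathfrak{R}$ is the (genus 1) compact Riemann surface of $w$: two copies $\mathfrak{R}^{(1)},\mathfrak{R}^{(2)}$ of $\overline{\mathbb{C}}$ cut along $\Delta$ and glued crosswise along each $\Delta_k$. $\pi:\mathfrak{R}\to\overline{\mathbb{C}}$ (no subscript) is the canonical projection; $D^{(k)}:=\pi^{-1}(D)\cap\mathfrak{R}^{(k)}$, and for $z\in D$, $z^{(k)}$ is the point of $D^{(k)}$ over $z$. $L:=\pi^{-1}(\Delta)$, oriented so that $D^{(1)}$ lies to the left; superscript $+$ (resp. $-$) on $L$ denotes the trace from $D^{(1)}$ (resp. $D^{(2)}$), with continuity understood via the identification of $L^\pm$ with $\partial D$. **Principal divisor.** For $r$ meromorphic in $\mathfrak{R}\setminus L$ with continuous traces on $L$ satisfying $r^-=r^+\cdot(h\circ\pi)$, put $r(z):=r(z^{(1)})$, $r^*(z):=r(z^{(2)})$, $z\in D$; then $rr^*$ is rational on $\overline{\mathbb{C}}$. $(r)=\sum_l m_l\mathbf{z}_l-\sum_jk_j\mathbf{w}_j$ (formal sum, equal points combined) means: $r$ has a zero of multiplicity $m_l$ (pole of multiplicity $k_j$) at each $\mathbf{z}_l$ ($\mathbf{w}_j$) in $D^{(1)}\cup D^{(2)}$; $rr^*$ has a zero of multiplicity $m_l$ (pole of multiplicity $k_j$) at the projection of $\mathbf{z}_l$ ($\mathbf{w}_j$)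 if that point is in $L$; and $r$ has finite non-zero values at all other points, including two-sided boundary values on $L$. **$S_n$ and $\mathbf{z}_n$.** For $h$ Dini-continuous and non-vanishing on $\Delta$ (in particular $h=1/p$) there is a unique pair $(\mathbf{z}_n,S_n)$ such that $S_n$ is meromorphic in $\mathfrak{R}\setminus L$, has continuous traces on $L$ with $S_n^-=S_n^+\cdot(h\circ\pi)$, has principal divisor $\mathbf{z}_n+(n-1)\infty^{(2)}-n\infty^{(1)}$, and satisfies $S_n(\mathbf{z})z^{-k_n}\to1$ as $\mathbf{z}\to\infty^{(1)}$, where $k_n=n-1$ if $\mathbf{z}_n=\infty^{(1)}$ and $k_n=n$ otherwise. **Padé approximants.** For $f$ holomorphic and vanishing at infinity, the diagonal Padé approximant of order $n$ is $\pi_n=p_n/q_n$, where $p_n,q_n$ are polynomials of degree at most $n$, $q_n\not\equiv0$, with $q_n(z)f(z)-p_n(z)=\mathcal{O}(1/z^{n+1})$ as $z\to\infty$; $(p_n,q_n)$ is always taken to be the solution of minimal degree with $q_n$ monic (it is unique). *)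

theory Defs
  imports "HOL-Complex_Analysis.Complex_Analysis" "HOL-Probability.Probability"
begin

section \<open>Logarithmic capacity and the contour\<close>

text \<open>
  The energy is the double integral of \<open>log (1 / \<bar>z - t\<bar>)\<close>, split into its positive and
  negative parts. The kernel is \<open>\<infinity>\<close> on the diagonal. For a measure carried by a bounded set the
  subtracted part is finite, so the difference is never \<open>\<infinity> - \<infinity>\<close>.
\<close>

definition log_energy :: "complex measure \<Rightarrow> ereal" where
  "log_energy \<mu> =
     enn2ereal (\<integral>\<^sup>+ z. (\<integral>\<^sup>+ t. (if z = t then \<top> else ennreal (- ln (dist z t))) \<partial>\<mu>) \<partial>\<mu>)
     - enn2ereal (\<integral>\<^sup>+ z. (\<integral>\<^sup>+ t. (if z = t then 0 else ennreal (ln (dist z t))) \<partial>\<mu>) \<partial>\<mu>)"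

definition prob_measures_on :: "complex set \<Rightarrow> complex measure set" where
  "prob_measures_on K = {\<mu>. prob_space \<mu> \<and> sets \<mu> = sets borel \<and> emeasure \<mu> K = 1}"

definition log_capacity :: "complex set \<Rightarrow> real" where
  "log_capacity K =
     (let V = (INF \<mu>\<in>prob_measures_on K. log_energy \<mu>)
      in if V = \<infinity> then 0 else exp (- real_of_ereal V))"

definition chebotarev_continuum :: "complex set \<Rightarrow> complex set \<Rightarrow> bool" where
  "chebotarev_continuum E \<Delta> \<longleftrightarrow>
     compact \<Delta> \<and> connected \<Delta> \<and> E \<subseteq> \<Delta> \<and>
     (\<forall>K. compact K \<and> connected K \<and> E \<subseteq> K \<longrightarrow> log_capacity \<Delta> \<le> log_capacity K)"

definition analytic_arc :: "(real \<Rightarrow> complex) \<Rightarrow> bool" where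
  "analytic_arc \<gamma> \<longleftrightarrow>
     arc \<gamma> \<and>
     (\<exists>g. g analytic_on (of_real ` {0..1}) \<and>
          (\<forall>t\<in>{0..1}. g (of_real t) = \<gamma> t \<and> deriv g (of_real t) \<noteq> 0))"

definition tangent :: "(real \<Rightarrow> complex) \<Rightarrow> real \<Rightarrow> complex" where
  "tangent \<gamma> t = vector_derivative \<gamma> (at t within {0..1})"

text \<open>
  The last conjunct says that the arcs leave \<open>a 0\<close> in clockwise order: turning counterclockwise
  from the first arc, one meets the third arc before the second.
\<close>

definition tripod :: "(nat \<Rightarrow> complex) \<Rightarrow> (nat \<Rightarrow> real \<Rightarrow> complex) \<Rightarrow> complex set \<Rightarrow> bool" where
  "tripod a \<gamma> \<Delta> \<longleftrightarrow>
     \<Delta> = (\<Union>k\<in>{1..3}. path_image (\<gamma> k)) \<and>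
     (\<forall>k\<in>{1..3}. analytic_arc (\<gamma> k) \<and> pathstart (\<gamma> k) = a 0 \<and> pathfinish (\<gamma> k) = a k) \<and>
     (\<forall>j\<in>{1..3}. \<forall>k\<in>{1..3}. j \<noteq> k \<longrightarrow> path_image (\<gamma> j) \<inter> path_image (\<gamma> k) = {a 0}) \<and>
     0 < Arg2pi (tangent (\<gamma> 3) 0 / tangent (\<gamma> 1) 0) \<and>
     Arg2pi (tangent (\<gamma> 3) 0 / tangent (\<gamma> 1) 0) < Arg2pi (tangent (\<gamma> 2) 0 / tangent (\<gamma> 1) 0)"


section \<open>The function \<open>w\<close>, its left trace, and the Cauchy-type integral\<close>

text \<open>The domain \<open>D\<close> is \<open>- \<Delta>\<close>; its point at infinity is treated through limits.\<close>

definition branch_poly :: "(nat \<Rightarrow> complex) \<Rightarrow> complex \<Rightarrow> complex" where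
  "branch_poly a z = (\<Prod>k\<le>3. z - a k)"

definition branch_root :: "(nat \<Rightarrow> complex) \<Rightarrow> complex set \<Rightarrow> (complex \<Rightarrow> complex) \<Rightarrow> bool" where
  "branch_root a \<Delta> w \<longleftrightarrow>
     w holomorphic_on (- \<Delta>) \<and>
     (\<forall>z\<in>- \<Delta>. (w z)\<^sup>2 = branch_poly a z) \<and>
     ((\<lambda>z. w z / z\<^sup>2) \<longlongrightarrow> 1) at_infinity"

text \<open>
  The trace at an interior point \<open>\<zeta>\<close> of the arc, taken along the left normal \<open>\<i> * \<gamma>' t\<close>.
\<close>

definition left_trace :: "(real \<Rightarrow> complex) \<Rightarrow> (complex \<Rightarrow> complex) \<Rightarrow> complex \<Rightarrow> complex" where
  "left_trace \<gamma> F \<zeta> =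
     Lim (at_right 0)
       (\<lambda>\<epsilon>. F (\<zeta> + \<i> * of_real \<epsilon> * tangent \<gamma> (inv_into {0..1} \<gamma> \<zeta>)))"

definition cauchy_transform ::
  "(nat \<Rightarrow> real \<Rightarrow> complex) \<Rightarrow> (complex \<Rightarrow> complex) \<Rightarrow> (complex \<Rightarrow> complex) \<Rightarrow> complex \<Rightarrow> complex"
where
  "cauchy_transform \<gamma> w h z =
     1 / (of_real pi * \<i>) *
     (\<Sum>k\<in>{1..3}. contour_integral (\<gamma> k) (\<lambda>t. h t * (1 / (t - z)) * (1 / left_trace (\<gamma> k) w t)))"


section \<open>The two-sided boundary\<close>

text \<open>
  A copy of \<open>\<zeta> \<in> \<Delta>\<close> on the two-sided boundary of \<open>- \<Delta>\<close> is a coherent choice, for all radii, of a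
  component of the slit disc that has \<open>\<zeta>\<close> in its closure. For a tripod this gives two copies of
  each point of the open arcs, three copies of \<open>a 0\<close>, and one copy of each of the tips. The filter
  \<open>copy_nhds U\<close> consists of the traces on \<open>- \<Delta>\<close> of the neighbourhoods of that boundary point.
\<close>

definition boundary_copy :: "complex set \<Rightarrow> complex \<Rightarrow> (real \<Rightarrow> complex set) \<Rightarrow> bool" where
  "boundary_copy \<Delta> \<zeta> U \<longleftrightarrow>
     \<zeta> \<in> \<Delta> \<and>
     (\<forall>r>0. U r \<in> components (ball \<zeta> r - \<Delta>) \<and> \<zeta> \<in> closure (U r)) \<and>
     (\<forall>r>0. \<forall>s\<ge>r. U r \<subseteq> U s)"

definition copy_nhds :: "(real \<Rightarrow> complex set) \<Rightarrow> complex filter" where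
  "copy_nhds U = (INF r\<in>{0<..}. principal (U r))"

text \<open>
  Existence of all these limits already makes the boundary values continuous on the two-sided
  boundary, because the limits are taken over full neighbourhoods.
\<close>

definition continuous_traces :: "complex set \<Rightarrow> (complex \<Rightarrow> complex) \<Rightarrow> bool" where
  "continuous_traces \<Delta> F \<longleftrightarrow>
     (\<forall>\<zeta> U. boundary_copy \<Delta> \<zeta> U \<longrightarrow> (\<exists>l. (F \<longlongrightarrow> l) (copy_nhds U)))"


section \<open>The Riemann surface of \<open>w\<close>\<close>

text \<open>
  The finite points are the pairs \<open>(z, y)\<close> with \<open>y\<^sup>2 = branch_poly a z\<close>. The sheets are the graphs of
  \<open>w\<close> and \<open>- w\<close> over \<open>- \<Delta>\<close>, each with its point at infinity. Since the traces of \<open>w\<close> on the two sides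
  of an arc differ by the sign, a side of a cut on one sheet is attached to the opposite side
  of the same cut on the other sheet.
\<close>

datatype surface_point = Affine complex complex | Infty1 | Infty2

definition riemann_surface :: "(nat \<Rightarrow> complex) \<Rightarrow> surface_point set" where
  "riemann_surface a = {Affine z y | z y. y\<^sup>2 = branch_poly a z} \<union> {Infty1, Infty2}"

definition sheet1 :: "(complex \<Rightarrow> complex) \<Rightarrow> complex \<Rightarrow> surface_point" where
  "sheet1 w z = Affine z (w z)"

definition sheet2 :: "(complex \<Rightarrow> complex) \<Rightarrow> complex \<Rightarrow> surface_point" where
  "sheet2 w z = Affine z (- w z)"

text \<open>
  For \<open>Affine t y\<close> over \<open>\<Delta>\<close>: \<open>plus_copy\<close> (\<open>minus_copy\<close>) says that, as \<open>z\<close> tends to the boundary copy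
  \<open>U\<close> of \<open>t\<close>, the point over \<open>z\<close> on the first (second) sheet tends to \<open>Affine t y\<close>. These are the
  identifications of the two-sided boundary with the two sides of the cut of the surface.
\<close>

definition plus_copy ::
  "complex set \<Rightarrow> (complex \<Rightarrow> complex) \<Rightarrow> complex \<Rightarrow> complex \<Rightarrow> (real \<Rightarrow> complex set) \<Rightarrow> bool" where
  "plus_copy \<Delta> w t y U \<longleftrightarrow> boundary_copy \<Delta> t U \<and> (w \<longlongrightarrow> y) (copy_nhds U)"

definition minus_copy ::
  "complex set \<Rightarrow> (complex \<Rightarrow> complex) \<Rightarrow> complex \<Rightarrow> complex \<Rightarrow> (real \<Rightarrow> complex set) \<Rightarrow> bool" where
  "minus_copy \<Delta> w t y U \<longleftrightarrow> boundary_copy \<Delta> t U \<and> ((\<lambda>z. - w z) \<longlongrightarrow> y) (copy_nhds U)"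

text \<open>
  The function \<open>r\<close> lives on the surface minus the preimage of \<open>\<Delta>\<close>; its values elsewhere, and at the
  two points at infinity, play no role. \<open>nicely_meromorphic_on\<close> is needed because \<open>meromorphic_on\<close>
  alone leaves the values at isolated points arbitrary.
\<close>

definition meromorphic_off_cut ::
  "complex set \<Rightarrow> (complex \<Rightarrow> complex) \<Rightarrow> (surface_point \<Rightarrow> complex) \<Rightarrow> bool" where
  "meromorphic_off_cut \<Delta> w r \<longleftrightarrow>
     (\<lambda>z. r (sheet1 w z)) nicely_meromorphic_on (- \<Delta>) \<and>
     (\<lambda>z. r (sheet2 w z)) nicely_meromorphic_on (- \<Delta>) \<and>
     (\<lambda>z. r (sheet1 w (inverse z))) meromorphic_on {0} \<and>
     (\<lambda>z. r (sheet2 w (inverse z))) meromorphic_on {0}"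

text \<open>
  The jump relation \<open>r\<^sup>- = r\<^sup>+ * h\<close> at the points of the cut not over \<open>a 0\<close>. At \<open>a 0\<close>, where each side
  carries three boundary values, the relation between adjacent ones follows by continuity along
  the arcs.
\<close>

definition jump_relation ::
  "(nat \<Rightarrow> complex) \<Rightarrow> complex set \<Rightarrow> (complex \<Rightarrow> complex) \<Rightarrow> (complex \<Rightarrow> complex) \<Rightarrow>
   (surface_point \<Rightarrow> complex) \<Rightarrow> bool"
where
  "jump_relation a \<Delta> w h r \<longleftrightarrow>
     (\<forall>t y U V l m. t \<in> \<Delta> - {a 0} \<and> Affine t y \<in> riemann_surface a \<and>
        plus_copy \<Delta> w t y U \<and> ((\<lambda>z. r (sheet1 w z)) \<longlongrightarrow> l) (copy_nhds U) \<and>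
        minus_copy \<Delta> w t y V \<and> ((\<lambda>z. r (sheet2 w z)) \<longlongrightarrow> m) (copy_nhds V) \<longrightarrow>
        m = l * h t)"


section \<open>Principal divisors\<close>

text \<open>\<open>zorder\<close> is meaningful only for functions that do not vanish identically near the point.\<close>

definition has_order :: "(complex \<Rightarrow> complex) \<Rightarrow> complex \<Rightarrow> int \<Rightarrow> bool" where
  "has_order F z m \<longleftrightarrow> (\<exists>\<^sub>F u in at z. F u \<noteq> 0) \<and> zorder F z = m"

text \<open>
  A divisor is given by its multiplicities (positive for zeros, negative for poles). At points
  of \<open>\<Delta>\<close> the order is that of the product of the two conjugate functions, which extends
  meromorphically across \<open>\<Delta>\<close>; the sum is over the points of the surface above \<open>t\<close>. The last two
  conjuncts concern the boundary values at the points of the cut outside the divisor.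
\<close>

definition has_principal_divisor ::
  "(nat \<Rightarrow> complex) \<Rightarrow> complex set \<Rightarrow> (complex \<Rightarrow> complex) \<Rightarrow> (surface_point \<Rightarrow> complex) \<Rightarrow>
   (surface_point \<Rightarrow> int) \<Rightarrow> bool"
where
  "has_principal_divisor a \<Delta> w r d \<longleftrightarrow>
     (\<forall>z\<in>- \<Delta>. has_order (\<lambda>u. r (sheet1 w u)) z (d (sheet1 w z))) \<and>
     (\<forall>z\<in>- \<Delta>. has_order (\<lambda>u. r (sheet2 w u)) z (d (sheet2 w z))) \<and>
     has_order (\<lambda>u. r (sheet1 w (inverse u))) 0 (d Infty1) \<and>
     has_order (\<lambda>u. r (sheet2 w (inverse u))) 0 (d Infty2) \<and>
     (\<forall>t\<in>\<Delta>. \<exists>g. g meromorphic_on {t} \<and>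
        (\<forall>\<^sub>F z in at t within - \<Delta>. g z = r (sheet1 w z) * r (sheet2 w z)) \<and>
        has_order g t (\<Sum>y | y\<^sup>2 = branch_poly a t. d (Affine t y))) \<and>
     (\<forall>t y U. t \<in> \<Delta> \<and> Affine t y \<in> riemann_surface a \<and> d (Affine t y) = 0 \<and>
        plus_copy \<Delta> w t y U \<longrightarrow> (\<exists>l. l \<noteq> 0 \<and> ((\<lambda>z. r (sheet1 w z)) \<longlongrightarrow> l) (copy_nhds U))) \<and>
     (\<forall>t y U. t \<in> \<Delta> \<and> Affine t y \<in> riemann_surface a \<and> d (Affine t y) = 0 \<and>
        minus_copy \<Delta> w t y U \<longrightarrow> (\<exists>l. l \<noteq> 0 \<and> ((\<lambda>z. r (sheet2 w z)) \<longlongrightarrow> l) (copy_nhds U)))"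

text \<open>The divisor \<open>zn + (n - 1) Infty2 - n Infty1\<close>, with equal points combined.\<close>

definition Sn_divisor :: "nat \<Rightarrow> surface_point \<Rightarrow> surface_point \<Rightarrow> int" where
  "Sn_divisor n zn x =
     of_bool (x = zn) + (int n - 1) * of_bool (x = Infty2) - int n * of_bool (x = Infty1)"

definition Sn_pair ::
  "(nat \<Rightarrow> complex) \<Rightarrow> complex set \<Rightarrow> (complex \<Rightarrow> complex) \<Rightarrow> (complex \<Rightarrow> complex) \<Rightarrow> nat \<Rightarrow>
   surface_point \<Rightarrow> (surface_point \<Rightarrow> complex) \<Rightarrow> bool"
where
  "Sn_pair a \<Delta> w h n zn Sn \<longleftrightarrow>
     zn \<in> riemann_surface a \<and>
     meromorphic_off_cut \<Delta> w Sn \<and>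
     continuous_traces \<Delta> (\<lambda>z. Sn (sheet1 w z)) \<and>
     continuous_traces \<Delta> (\<lambda>z. Sn (sheet2 w z)) \<and>
     jump_relation a \<Delta> w h Sn \<and>
     has_principal_divisor a \<Delta> w Sn (Sn_divisor n zn) \<and>
     ((\<lambda>z. Sn (sheet1 w z) * z powi (- (if zn = Infty1 then int n - 1 else int n)))
        \<longlongrightarrow> 1) at_infinity"


section \<open>Diagonal Pade approximants\<close>

definition pade_solution ::
  "(complex \<Rightarrow> complex) \<Rightarrow> nat \<Rightarrow> complex poly \<Rightarrow> complex poly \<Rightarrow> bool" where
  "pade_solution f n P Q \<longleftrightarrow>
     degree P \<le> n \<and> degree Q \<le> n \<and> Q \<noteq> 0 \<and>
     (\<lambda>z. poly Q z * f z - poly P z) \<in> O[at_infinity](\<lambda>z. 1 / z ^ (n + 1))"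

definition pade_pair ::
  "(complex \<Rightarrow> complex) \<Rightarrow> nat \<Rightarrow> complex poly \<Rightarrow> complex poly \<Rightarrow> bool" where
  "pade_pair f n P Q \<longleftrightarrow>
     pade_solution f n P Q \<and> lead_coeff Q = 1 \<and>
     (\<forall>P' Q'. pade_solution f n P' Q' \<longrightarrow> degree Q \<le> degree Q')"

end

theory Submission
  imports Defs "HOL-Computational_Algebra.Fundamental_Theorem_Algebra"
begin

text \<open>
  Each arc is straightened by a univalent chart that carries \<open>[0, 1]\<close> to it. In the chart, \<open>w\<close> is the
  restriction of a single function \<open>W\<close> above the arc and of \<open>- W\<close> below it. Consequently
  \<open>S + p S\<^sup>*\<close>, \<open>S S\<^sup>*\<close>, \<open>(S + p S\<^sup>*) f - 2 S\<^sup>* / w\<close> and \<open>p f - 1 / w\<close> have the same limit from both sides at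
  every interior point of an arc, and at \<open>a 0, \<dots>, a 3\<close> they are too small to have a pole; they are
  therefore entire, and by their growth they are polynomials \<open>Q\<close>, \<open>R\<close>, \<open>P\<close>, \<open>A\<close>. The orders at infinity
  make \<open>(P, Q)\<close> a Pade solution with \<open>Q\<close> monic. A common root of \<open>P\<close> and \<open>Q\<close> would be a double root
  of \<open>R\<close>, which has degree at most one; so \<open>P\<close> and \<open>Q\<close> are coprime and the solution is the minimal one.

  The jump of \<open>f\<close> and its growth at the ends of the arcs come from comparing, in the chart, the
  kernel \<open>1 / (g u - g \<zeta>)\<close> with \<open>1 / (g' \<zeta> (u - \<zeta>))\<close>: the difference is bounded, and the integrals
  that remain are explicit logarithms.
\<close>

section \<open>Charts of the arcs\<close>

text \<open>The boundary values of \<open>Sn\<close> are given along boundary copies, that is, along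
  nested components of slit discs, whereas gluing across an arc needs a line to paste along.
  Straightening serves both: near an interior arc point the copies become two half-planes. Why
  \<open>S + p S*\<close> is the right combination: \<open>w\<close> changes sign across an arc, so
  the surface point reached on the second sheet from one side is the one reached on the first sheet
  from the other side. If \<open>S\<close> has the traces \<open>l 1\<close> and
  \<open>l (- 1)\<close>, then \<open>S*\<close> has the traces \<open>l (- 1) / p\<close> and
  \<open>l 1 / p\<close>, and multiplying by \<open>p\<close> gives a sum that does not see the
  side. At the ends of the arcs \<open>f\<close> need not be bounded, but its density grows only
  like an inverse square root. This leaves \<open>o(1 / |z - a j|)\<close>, exactly what the removal
  of an isolated singularity asks for. The bound on \<open>n\<close> comes from the normalisation:
  \<open>S\<close> grows like \<open>z ^ k\<close> with \<open>k\<close> at least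
  \<open>n - 1\<close>, while \<open>p S*\<close> has growth exponent at most
  \<open>deg p + 1 - n\<close>; the second is negligible for every such \<open>k\<close> once
  \<open>deg p + 2 < 2 n\<close>.\<close>

lemma univalent_neighbourhood:
  assumes an: "g analytic_on K" and K: "compact K" and inj: "inj_on g K"
    and dz: "\<And>x. x \<in> K \<Longrightarrow> deriv g x \<noteq> 0"
  obtains N where "open N" "K \<subseteq> N" "g holomorphic_on N" "inj_on g N"
proof -
  obtain S where S: "open S" "K \<subseteq> S" "g holomorphic_on S"
    using an analytic_on_holomorphic by blast
  define B where "B m = (\<Union>x\<in>K. ball x (1 / real (Suc m))) \<inter> S" for m
  \<comment> \<open>Compactness: pairs of distinct points with equal values, taken ever closer to
    \<open>K\<close>, accumulate at two points of \<open>K\<close> with equal values. Injectivity on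
    \<open>K\<close> makes these coincide, and there the nonzero derivative provides a ball on which
    \<open>g\<close> is injective, a contradiction.\<close>
  have "\<exists>m. inj_on g (B m)"
  proof (rule ccontr)
    assume "\<not> ?thesis"
    have "\<forall>m. \<exists>x y k l. x \<in> S \<and> y \<in> S \<and> k \<in> K \<and> l \<in> K \<and> dist k x < 1 / real (Suc m)
        \<and> dist l y < 1 / real (Suc m) \<and> x \<noteq> y \<and> g x = g y"
    proof (intro allI)
      fix m
      obtain x y where xy: "x \<in> B m" "y \<in> B m" "g x = g y" "x \<noteq> y"
        using \<open>\<nexists>m. inj_on g (B m)\<close> unfolding inj_on_def by blast
      then obtain k l where "k \<in> K" "l \<in> K" "x \<in> ball k (1 / real (Suc m))" "y \<in> ball l (1 / real (Suc m))"
        "x \<in> S" "y \<in> S"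
        unfolding B_def by blast
      then show "\<exists>x y k l. x \<in> S \<and> y \<in> S \<and> k \<in> K \<and> l \<in> K \<and> dist k x < 1 / real (Suc m)
        \<and> dist l y < 1 / real (Suc m) \<and> x \<noteq> y \<and> g x = g y"
        using xy unfolding mem_ball by blast
    qed
    \<comment> \<open>The four sequences are packed into one sequence of nested pairs, so that a
      single application of \<open>choice\<close> yields them all.\<close>
    then have "\<forall>m. \<exists>t. fst t \<in> S \<and> fst (snd t) \<in> S \<and> fst (snd (snd t)) \<in> K \<and> snd (snd (snd t)) \<in> K
        \<and> dist (fst (snd (snd t))) (fst t) < 1 / real (Suc m)
        \<and> dist (snd (snd (snd t))) (fst (snd t)) < 1 / real (Suc m) \<and> fst t \<noteq> fst (snd t) \<and> g (fst t) = g (fst (snd t))"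
      by (simp only: split_paired_Ex fst_conv snd_conv simp_thms)
    then obtain T where T: "\<forall>m. fst (T m) \<in> S \<and> fst (snd (T m)) \<in> S \<and> fst (snd (snd (T m))) \<in> K \<and> snd (snd (snd (T m))) \<in> K
        \<and> dist (fst (snd (snd (T m)))) (fst (T m)) < 1 / real (Suc m)
        \<and> dist (snd (snd (snd (T m)))) (fst (snd (T m))) < 1 / real (Suc m) \<and> fst (T m) \<noteq> fst (snd (T m))
        \<and> g (fst (T m)) = g (fst (snd (T m)))"
      by (rule exE[OF choice])
    define X where "X m = fst (T m)" for m
    define Y where "Y m = fst (snd (T m))" for m
    define k where "k m = fst (snd (snd (T m)))" for m
    define l where "l m = snd (snd (snd (T m)))" for m
    have XY: "X m \<in> S" "Y m \<in> S" "k m \<in> K" "l m \<in> K"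
       "dist (k m) (X m) < 1 / real (Suc m)" "dist (l m) (Y m) < 1 / real (Suc m)"
       "X m \<noteq> Y m" "g (X m) = g (Y m)" for m
      using T[rule_format, of m] unfolding X_def Y_def k_def l_def by (simp_all del: of_nat_Suc)
    have "compact (K \<times> K)" using K by (simp add: compact_Times)
    then have "\<exists>kl\<in>K \<times> K. \<exists>r. strict_mono r \<and> ((\<lambda>m. (k m, l m)) \<circ> r) \<longlonglongrightarrow> kl"
      unfolding compact_def using XY(3,4) by simp
    then obtain kl r where kl: "kl \<in> K \<times> K" "strict_mono r" "((\<lambda>m. (k m, l m)) \<circ> r) \<longlonglongrightarrow> kl"
      by (elim bexE exE conjE)
    define k0 where "k0 = fst kl"
    define l0 where "l0 = snd kl"
    have k0: "k0 \<in> K" "l0 \<in> K" using kl by (auto simp: k0_def l0_def)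
    have lk: "(\<lambda>m. k (r m)) \<longlonglongrightarrow> k0" "(\<lambda>m. l (r m)) \<longlonglongrightarrow> l0"
      using tendsto_fst[OF kl(3)] tendsto_snd[OF kl(3)] by (auto simp: k0_def l0_def o_def)
    have inv0: "(\<lambda>m. 1 / real (Suc (r m))) \<longlonglongrightarrow> 0"
      using LIMSEQ_subseq_LIMSEQ[OF LIMSEQ_Suc[OF lim_1_over_n] kl(2)] by (simp add: o_def)
    have "(\<lambda>m. X (r m) - k (r m)) \<longlonglongrightarrow> 0"
    proof (rule Lim_null_comparison[OF always_eventually inv0], rule allI)
      show "norm (X (r m) - k (r m)) \<le> 1 / real (Suc (r m))" for m
        using less_imp_le[OF XY(5)[of "r m"]] by (simp only: dist_norm norm_minus_commute)
    qed
    from tendsto_add[OF this lk(1)] have lX: "(\<lambda>m. X (r m)) \<longlonglongrightarrow> k0" by simp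
    have "(\<lambda>m. Y (r m) - l (r m)) \<longlonglongrightarrow> 0"
    proof (rule Lim_null_comparison[OF always_eventually inv0], rule allI)
      show "norm (Y (r m) - l (r m)) \<le> 1 / real (Suc (r m))" for m
        using less_imp_le[OF XY(6)[of "r m"]] by (simp only: dist_norm norm_minus_commute)
    qed
    from tendsto_add[OF this lk(2)] have lY: "(\<lambda>m. Y (r m)) \<longlonglongrightarrow> l0" by simp
    have cont: "isCont g x" if "x \<in> S" for x
      using S that by (meson continuous_on_eq_continuous_at holomorphic_on_imp_continuous_on)
    have "(\<lambda>m. g (X (r m))) \<longlonglongrightarrow> g k0" "(\<lambda>m. g (Y (r m))) \<longlonglongrightarrow> g l0"
      using isCont_tendsto_compose[OF cont lX] isCont_tendsto_compose[OF cont lY] k0 S(2) by auto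
    then have "g k0 = g l0"
      using XY(8) LIMSEQ_unique by auto
    then have eq: "k0 = l0" using inj k0 by (auto dest: inj_onD)
    obtain \<rho> where \<rho>: "\<rho> > 0" "ball k0 \<rho> \<subseteq> S" "inj_on g (ball k0 \<rho>)"
      using has_complex_derivative_locally_injective[OF S(3) _ S(1) dz[OF k0(1)]] k0 S(2) by blast
    have m: "k0 \<in> ball k0 \<rho>" "l0 \<in> ball k0 \<rho>" using \<rho>(1) eq by auto
    have "\<forall>\<^sub>F m in sequentially. X (r m) \<in> ball k0 \<rho> \<and> Y (r m) \<in> ball k0 \<rho>"
      by (rule eventually_conj[OF topological_tendstoD[OF lX open_ball m(1)] topological_tendstoD[OF lY open_ball m(2)]])
    then obtain M where M: "\<forall>m\<ge>M. X (r m) \<in> ball k0 \<rho> \<and> Y (r m) \<in> ball k0 \<rho>"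
      unfolding eventually_sequentially by (rule exE)
    have "X (r M) = Y (r M)"
      by (rule inj_onD[OF \<rho>(3) XY(8)]) (use M in \<open>simp_all del: mem_ball\<close>)
    then show False using XY(7)[of "r M"] by contradiction
  qed
  then obtain m where m: "inj_on g (B m)" ..
  show ?thesis
  proof
    show "open (B m)" using S by (auto simp: B_def)
    show "K \<subseteq> B m" using S by (auto simp: B_def)
    show "g holomorphic_on B m" using S by (auto simp: B_def intro: holomorphic_on_subset)
    show "inj_on g (B m)" by fact
  qed
qed

text \<open>
  A convex neighbourhood of \<open>(0, 1]\<close>. It narrows towards \<open>0\<close>, because in the chart of one arc the two
  other arcs start at \<open>0\<close> too, in directions other than the positive real one.
\<close>

definition sector :: "real \<Rightarrow> complex set" where
  "sector \<kappa> = {\<zeta>. 0 < Re \<zeta> \<and> Re \<zeta> < 1 + \<kappa> \<and> \<bar>Im \<zeta>\<bar> < \<kappa> * Re \<zeta>}"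

lemma sector_mono:
  assumes "\<kappa> \<le> \<kappa>'" shows "sector \<kappa> \<subseteq> sector \<kappa>'"
proof
  fix z assume z: "z \<in> sector \<kappa>"
  then have "\<kappa> * Re z \<le> \<kappa>' * Re z" using assms by (auto simp: sector_def intro!: mult_right_mono)
  then show "z \<in> sector \<kappa>'" using z assms unfolding sector_def mem_Collect_eq by linarith
qed

lemma sector_eq:
  "sector \<kappa> = {\<zeta>. Re \<zeta> > 0} \<inter> {\<zeta>. Re \<zeta> < 1 + \<kappa>} \<inter> {\<zeta>. inner (Complex \<kappa> (-1)) \<zeta> > 0} \<inter> {\<zeta>. inner (Complex \<kappa> 1) \<zeta> > 0}"
  by (auto simp: sector_def inner_complex_def)

lemma convex_sector: "convex (sector \<kappa>)"
  unfolding sector_eq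
  by (intro convex_Int convex_halfspace_Re_gt convex_halfspace_Re_lt convex_halfspace_gt)

lemma open_sector: "open (sector \<kappa>)"
  unfolding sector_eq
  by (intro open_Int open_halfspace_Re_gt open_halfspace_Re_lt open_halfspace_gt)

text \<open>If every thin sector contained a bad point, these points would accumulate at a point of
  \<open>[0, 1]\<close> whose image lies on both arcs, hence at \<open>0\<close>. Pulled back by the
  inverse of \<open>g2\<close>, the bad points become nonnegative reals, while they are themselves
  asymptotically positive real. The limit of the quotient is the ratio of the derivatives at
  \<open>0\<close>, which would then be a positive real: the two arcs would leave in the same
  direction.\<close>

lemma sector_avoids_arc:
  fixes g1 g2 :: "complex \<Rightarrow> complex"
  assumes N1: "open N1" "complex_of_real ` {0..1} \<subseteq> N1" "g1 holomorphic_on N1" "inj_on g1 N1"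
    and N2: "open N2" "complex_of_real ` {0..1} \<subseteq> N2" "g2 holomorphic_on N2" "inj_on g2 N2"
    and 0: "g1 0 = g2 0"
    and meet: "g1 ` complex_of_real ` {0..1} \<inter> g2 ` complex_of_real ` {0..1} \<subseteq> {g1 0}"
    and dir: "\<And>c. 0 < c \<Longrightarrow> deriv g1 0 / deriv g2 0 \<noteq> complex_of_real c"
  obtains \<kappa> where "\<kappa> > 0" "sector \<kappa> \<subseteq> N1" "\<And>\<zeta>. \<zeta> \<in> sector \<kappa> \<Longrightarrow> g1 \<zeta> \<notin> g2 ` complex_of_real ` {0..1}"
proof -
  let ?I = "complex_of_real ` {0..1}"
  have "\<exists>m. \<forall>\<zeta>\<in>sector (1 / real (Suc m)). \<zeta> \<in> N1 \<and> g1 \<zeta> \<notin> g2 ` ?I"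
  proof (rule ccontr)
    assume "\<not> ?thesis"
    then have "\<forall>m. \<exists>\<zeta>. \<zeta> \<in> sector (1 / real (Suc m)) \<and> (\<zeta> \<in> N1 \<longrightarrow> g1 \<zeta> \<in> g2 ` ?I)" by blast
    then obtain X where X: "\<And>m. X m \<in> sector (1 / real (Suc m))" "\<And>m. X m \<in> N1 \<Longrightarrow> g1 (X m) \<in> g2 ` ?I"
      by metis
    have X1: "0 < Re (X m)" "Re (X m) < 1 + 1 / real (Suc m)" "\<bar>Im (X m)\<bar> < (1 / real (Suc m)) * Re (X m)" for m
      using X(1)[of m] unfolding sector_def mem_Collect_eq by blast+
    have s1: "1 / real (Suc m) \<le> 1" for m by simp
    have "X m \<in> cbox (Complex 0 (-2)) (Complex 2 2)" for m
    proof -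
      have "(1 / real (Suc m)) * Re (X m) \<le> 1 * 2"
        using X1[of m] s1[of m] by (intro mult_mono) linarith+
      then show ?thesis using X1[of m] s1[of m] unfolding in_cbox_complex_iff complex.sel atLeastAtMost_iff by linarith
    qed
    then have "\<exists>x\<in>cbox (Complex 0 (-2)) (Complex 2 2). \<exists>r. strict_mono r \<and> (X \<circ> r) \<longlonglongrightarrow> x"
      using compact_cbox[of "Complex 0 (-2)" "Complex 2 2"] unfolding compact_def by simp
    then obtain x r where x: "strict_mono r" "(X \<circ> r) \<longlonglongrightarrow> x"
      by (elim bexE exE conjE)
    then have lX: "(\<lambda>m. X (r m)) \<longlonglongrightarrow> x" by (simp add: o_def)
    have inv0: "(\<lambda>m. 1 / real (Suc (r m))) \<longlonglongrightarrow> 0"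
      using LIMSEQ_subseq_LIMSEQ[OF LIMSEQ_Suc[OF lim_1_over_n] x(1)] by (simp add: o_def)
    have lRe: "(\<lambda>m. Re (X (r m))) \<longlonglongrightarrow> Re x" using lX by (rule tendsto_Re)
    have lIm: "(\<lambda>m. \<bar>Im (X (r m))\<bar>) \<longlonglongrightarrow> \<bar>Im x\<bar>" using lX by (intro tendsto_rabs tendsto_Im)
    have "Re x \<ge> 0" by (rule LIMSEQ_le_const[OF lRe]) (use X1 in \<open>auto intro: less_imp_le\<close>)
    moreover have "Re x \<le> 1 + 0"
      by (rule LIMSEQ_le[OF lRe tendsto_add[OF tendsto_const inv0]]) (use X1 in \<open>auto intro: less_imp_le\<close>)
    moreover have "\<bar>Im x\<bar> \<le> 0 * Re x"
      by (rule LIMSEQ_le[OF lIm tendsto_mult[OF inv0 lRe]]) (use less_imp_le[OF X1(3)] in blast)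
    ultimately have xI: "x \<in> ?I"
      by (auto simp: image_iff complex_eq_iff intro!: bexI[of _ "Re x"])
    then have xN: "x \<in> N1" using N1 by blast
    have ev: "\<forall>\<^sub>F m in sequentially. X (r m) \<in> N1"
      using topological_tendstoD[OF lX N1(1) xN] .
    have contg1: "isCont g1 x"
      using N1 xN by (meson continuous_on_eq_continuous_at holomorphic_on_imp_continuous_on)
    have lg: "(\<lambda>m. g1 (X (r m))) \<longlonglongrightarrow> g1 x" by (rule isCont_tendsto_compose[OF contg1 lX])
    have "compact (g2 ` ?I)"
      by (intro compact_continuous_image continuous_on_subset[OF holomorphic_on_imp_continuous_on[OF N2(3)] N2(2)]
          continuous_intros) auto
    then have "closed (g2 ` ?I)" by (rule compact_imp_closed)
    then have "g1 x \<in> g2 ` ?I"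
      by (rule Lim_in_closed_set[OF _ eventually_mono[OF ev X(2)] trivial_limit_sequentially lg])
    then have "g1 x = g1 0" using meet xI by blast
    then have x0: "x = 0"
      using N1(4) xN N1(2) by (auto dest!: inj_onD)
    obtain h where h: "h holomorphic_on g2 ` N2" "\<And>z. z \<in> N2 \<Longrightarrow> deriv g2 z * deriv h (g2 z) = 1"
      "\<And>z. z \<in> N2 \<Longrightarrow> h (g2 z) = z"
      using holomorphic_has_inverse[OF N2(3,1,4)] by metis
    have op: "open (g2 ` N2)" using open_mapping_thm3 N2 by blast
    have z2: "0 \<in> N2" using N2(2) by auto
    have z1: "0 \<in> N1" using N1(2) by auto
    have d1: "(g1 has_field_derivative deriv g1 0) (at 0)"
      using N1 z1 holomorphic_derivI by blast
    have d2: "(h has_field_derivative deriv h (g1 0)) (at (g1 0))"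
      using h(1) op z2 0 holomorphic_derivI by (metis image_eqI)
    have d3: "((\<lambda>z. h (g1 z)) has_field_derivative deriv h (g1 0) * deriv g1 0) (at 0)"
      using DERIV_chain2[OF d2 d1] .
    have "deriv g2 0 * deriv h (g1 0) = 1" using h(2)[OF z2] 0 by simp
    then have "deriv h (g1 0) = 1 / deriv g2 0" by (metis eq_divide_imp mult.commute mult_zero_left zero_neq_one)
    then have q: "deriv h (g1 0) * deriv g1 0 = deriv g1 0 / deriv g2 0" by simp
    have h0: "h (g1 0) = 0" using h(3)[OF z2] 0 by simp
    have lq: "((\<lambda>z. h (g1 z) / z) \<longlongrightarrow> deriv g1 0 / deriv g2 0) (at 0)"
      using d3 unfolding has_field_derivative_iff q h0 by simp
    have Xne: "X (r m) \<noteq> 0" for m using X1(1)[of "r m"] by auto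
    have l1: "(\<lambda>m. h (g1 (X (r m))) / X (r m)) \<longlonglongrightarrow> deriv g1 0 / deriv g2 0"
      by (rule filterlim_compose[OF lq]) (use lX Xne x0 in \<open>auto simp: filterlim_at\<close>)
    \<comment> \<open>In the thin sector the slope is at most its opening, so dividing by the real
      part instead of by the point itself leaves the limit unchanged and makes the quotients
      real.\<close>
    have "(\<lambda>m. X (r m) / of_real (Re (X (r m))) - 1) \<longlonglongrightarrow> 0"
    proof (rule Lim_null_comparison[OF _ inv0], rule always_eventually, rule allI)
      fix m
      have "X (r m) / of_real (Re (X (r m))) - 1 = \<i> * of_real (Im (X (r m)) / Re (X (r m)))"
        using X1(1)[of "r m"] by (simp add: complex_eq_iff field_simps)
      then have "norm (X (r m) / of_real (Re (X (r m))) - 1) = \<bar>Im (X (r m))\<bar> / Re (X (r m))"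
        using X1(1)[of "r m"] by (simp add: norm_mult norm_divide)
      also have "\<dots> \<le> 1 / real (Suc (r m))"
        using X1(1,3)[of "r m"] by (simp add: field_simps)
      finally show "norm (X (r m) / of_real (Re (X (r m))) - 1) \<le> 1 / real (Suc (r m))" .
    qed
    then have l2: "(\<lambda>m. X (r m) / of_real (Re (X (r m)))) \<longlonglongrightarrow> 1"
      using LIM_zero_iff by blast
    have l3: "(\<lambda>m. h (g1 (X (r m))) / of_real (Re (X (r m)))) \<longlonglongrightarrow> deriv g1 0 / deriv g2 0"
      using tendsto_mult[OF l1 l2] Xne by simp
    have mem: "h (g1 (X (r m))) / of_real (Re (X (r m))) \<in> {z. Im z = 0} \<inter> {z. Re z \<ge> 0}" if mN: "X (r m) \<in> N1" for m
    proof -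
      obtain u where "u \<in> {0..1}" "g1 (X (r m)) = g2 (of_real u)" using X(2)[OF mN] by auto
      moreover have "of_real u \<in> N2" using N2(2) \<open>u \<in> {0..1}\<close> by blast
      ultimately have "h (g1 (X (r m))) = of_real u" "u \<ge> 0" using h(3)[of "of_real u"] by simp_all
      then show ?thesis using X1(1)[of "r m"] by simp
    qed
    have "closed ({z. Im z = 0} \<inter> {z. Re z \<ge> 0})"
      by (intro closed_Int closed_Collect_eq closed_Collect_le continuous_intros)
    then have "deriv g1 0 / deriv g2 0 \<in> {z. Im z = 0} \<inter> {z. Re z \<ge> 0}"
      by (rule Lim_in_closed_set[OF _ eventually_mono[OF ev mem] trivial_limit_sequentially l3])
    then have "deriv g1 0 / deriv g2 0 = of_real (Re (deriv g1 0 / deriv g2 0))" "Re (deriv g1 0 / deriv g2 0) \<ge> 0"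
      by (auto simp: complex_eq_iff)
    moreover have "deriv g1 0 / deriv g2 0 \<noteq> 0"
      using holomorphic_injective_imp_regular[OF N1(3,1,4) z1] holomorphic_injective_imp_regular[OF N2(3,1,4) z2] by simp
    ultimately show False
      using dir[of "Re (deriv g1 0 / deriv g2 0)"] by (metis less_eq_real_def of_real_0)
  qed
  then obtain m where "\<forall>\<zeta>\<in>sector (1 / real (Suc m)). \<zeta> \<in> N1 \<and> g1 \<zeta> \<notin> g2 ` ?I" ..
  then show ?thesis
    using that[of "1 / real (Suc m)"] by auto
qed

section \<open>Branches of square roots off a slit\<close>

text \<open>Two continuous square roots of the same nonvanishing function have a quotient with
  values \<open>1\<close> and \<open>-1\<close>; on a connected set it is a constant sign. All
  identifications of branches below go through this.\<close>

lemma connected_sq_const: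
  fixes q :: "'a::topological_space \<Rightarrow> complex"
  assumes "connected X" "continuous_on X q" "\<And>z. z \<in> X \<Longrightarrow> (q z)\<^sup>2 = 1"
  obtains \<sigma> where "\<sigma>\<^sup>2 = 1" "\<And>z. z \<in> X \<Longrightarrow> q z = \<sigma>"
proof -
  have "q ` X \<subseteq> {1, -1}" using assms(3) by (auto simp: power2_eq_1_iff)
  then have "finite (q ` X)" using finite_subset by blast
  then have "q constant_on X"
    using continuous_finite_range_constant assms(1,2) by blast
  then obtain c where c: "\<And>z. z \<in> X \<Longrightarrow> q z = c" by (auto simp: constant_on_def)
  show ?thesis
  proof (cases "X = {}")
    case True then show ?thesis using that[of 1] by auto
  next
    case False then show ?thesis using that[of c] c assms(3) by fastforce
  qed
qed

text \<open>The set is star-shaped about \<open>1 + \<kappa>/2\<close>, a point of the real axis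
  beyond the tip: a segment from there that meets the real axis elsewhere than at its start runs
  inside it, and its far end then lies beyond the tip too.\<close>

lemma connected_slit_sector:
  assumes "\<kappa> > 0" shows "connected (sector \<kappa> - complex_of_real ` {0<..1})"
proof (rule starlike_imp_connected)
  let ?c = "complex_of_real (1 + \<kappa>/2)"
  have c: "?c \<in> sector \<kappa>" using assms by (auto simp: sector_def)
  show "starlike (sector \<kappa> - complex_of_real ` {0<..1})"
    unfolding starlike_def
  proof (intro bexI ballI subsetI DiffI)
    show "?c \<in> sector \<kappa>" by (rule c)
    show "?c \<notin> complex_of_real ` {0<..1}"
    proof
      assume "?c \<in> complex_of_real ` {0<..1}"
      then obtain u where "?c = complex_of_real u" "u \<le> 1" by (elim imageE) simp
      then show False using assms by (simp only: of_real_eq_iff)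
    qed
    fix z x assume z: "z \<in> sector \<kappa> - complex_of_real ` {0<..1}" and x: "x \<in> closed_segment ?c z"
    then show "x \<in> sector \<kappa>" using convex_sector c convex_contains_segment by blast
    obtain u where u: "0 \<le> u" "u \<le> 1" "x = (1 - u) *\<^sub>R ?c + u *\<^sub>R z"
      using x by (auto simp: closed_segment_def)
    have cR: "Re ?c = 1 + \<kappa>/2" "Im ?c = 0" by simp_all
    have xR: "Im x = u * Im z" "Re x = (1 - u) * (1 + \<kappa>/2) + u * Re z"
      unfolding u(3) plus_complex.sel scaleR_complex.sel cR by simp_all
    show "x \<notin> complex_of_real ` {0<..1}"
    proof
      assume "x \<in> complex_of_real ` {0<..1}"
      then have x1: "Im x = 0" "Re x \<le> 1" by auto
      show False
      proof (cases "u = 0")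
        case True then show False using x1 xR assms by simp
      next
        case False
        then have "Im z = 0" using xR x1 by simp
        moreover have "z \<in> sector \<kappa>" using z by blast
        ultimately have "Re z > 1"
          using z by (force simp: sector_def image_iff complex_eq_iff)
        then have "(1 - u) * 1 + u * 1 < (1 - u) * (1 + \<kappa>/2) + u * Re z"
          using False u assms by (intro add_le_less_mono mult_left_mono mult_strict_left_mono) auto
        then show False using xR x1 by simp
      qed
    qed
  qed
qed

lemma branch_poly_eq_0_iff: "branch_poly a z = 0 \<longleftrightarrow> (\<exists>j\<le>3. z = a j)"
  by (auto simp: branch_poly_def)

lemma branch_poly_split:
  assumes "k \<le> 3" shows "branch_poly a z = (z - a k) * (\<Prod>j\<in>{..3}-{k}. z - a j)"
  unfolding branch_poly_def using assms by (subst prod.remove[of _ k]) auto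

text \<open>
  In the chart the tip sits at \<open>1\<close>, and \<open>csqrt (\<zeta> - 1)\<close> is cut exactly along the arc; its two
  boundary values are opposite, and so are those of \<open>w\<close>.
\<close>

lemma branch_root_in_chart:
  assumes w: "continuous_on (- \<Delta>) w" "\<And>z. z \<in> - \<Delta> \<Longrightarrow> (w z)\<^sup>2 = branch_poly a z"
    and N: "open N" "g holomorphic_on N" "inj_on g N" "1 \<in> N"
    and \<kappa>: "\<kappa> > 0" "sector \<kappa> \<subseteq> N" "\<And>\<zeta>. \<zeta> \<in> sector \<kappa> \<Longrightarrow> g \<zeta> \<in> \<Delta> \<longleftrightarrow> \<zeta> \<in> complex_of_real ` {0<..1}"
    and tip: "k \<le> 3" "g 1 = a k" "\<And>j \<zeta>. j \<le> 3 \<Longrightarrow> \<zeta> \<in> sector \<kappa> \<Longrightarrow> g \<zeta> = a j \<Longrightarrow> j = k"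
  obtains W where "W holomorphic_on (sector \<kappa> \<inter> {\<zeta>. Re \<zeta> < 1})"
    "\<And>\<zeta>. \<zeta> \<in> sector \<kappa> \<Longrightarrow> Re \<zeta> < 1 \<Longrightarrow> (W \<zeta>)\<^sup>2 = branch_poly a (g \<zeta>)"
    "\<And>\<zeta>. \<zeta> \<in> sector \<kappa> \<Longrightarrow> Re \<zeta> < 1 \<Longrightarrow> 0 < Im \<zeta> \<Longrightarrow> w (g \<zeta>) = W \<zeta>"
    "\<And>\<zeta>. \<zeta> \<in> sector \<kappa> \<Longrightarrow> Re \<zeta> < 1 \<Longrightarrow> Im \<zeta> < 0 \<Longrightarrow> w (g \<zeta>) = - W \<zeta>"
proof -
  let ?C = "sector \<kappa>" and ?J = "complex_of_real ` {0<..1}"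
  have 1: "1 \<in> ?C" using \<kappa>(1) by (auto simp: sector_def)
  have holg: "g holomorphic_on ?C" using N(2) \<kappa>(2) holomorphic_on_subset by blast
  define G where "G \<zeta> = (if \<zeta> = 1 then deriv g 1 else (g \<zeta> - g 1) / (\<zeta> - 1))" for \<zeta>
  have G: "G holomorphic_on ?C"
    unfolding G_def by (rule pole_lemma[OF holg]) (use 1 open_sector interior_open in blast)
  \<comment> \<open>\<open>G\<close> is the difference quotient of \<open>g\<close> at the tip, so
    the simple zero of \<open>branch_poly a (g \<zeta>)\<close> at \<open>1\<close> is split off and
    \<open>B\<close> has no zero in the sector. A convex domain then admits a holomorphic root
    \<open>R\<close> of \<open>B\<close>.\<close>
  define B where "B \<zeta> = G \<zeta> * (\<Prod>j\<in>{..3}-{k}. g \<zeta> - a j)" for \<zeta>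
  have B: "B holomorphic_on ?C" unfolding B_def by (intro holomorphic_intros G holg)
  have Beq: "branch_poly a (g \<zeta>) = (\<zeta> - 1) * B \<zeta>" for \<zeta>
    unfolding branch_poly_split[OF tip(1)] B_def G_def using tip(2) by auto
  have "G \<zeta> \<noteq> 0" if "\<zeta> \<in> ?C" for \<zeta>
  proof (cases "\<zeta> = 1")
    case True then show ?thesis using holomorphic_injective_imp_regular[OF N(2,1,3,4)] by (simp add: G_def)
  next
    case False then have "g \<zeta> \<noteq> g 1" using N(3,4) \<kappa>(2) that by (auto dest: inj_onD)
    then show ?thesis using False by (simp add: G_def)
  qed
  then have B0: "B \<zeta> \<noteq> 0" if "\<zeta> \<in> ?C" for \<zeta>
    unfolding B_def using that tip(3) by auto
  obtain R where R: "R holomorphic_on ?C" "\<And>z. z \<in> ?C \<Longrightarrow> B z = R z ^ 2"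
    using contractible_imp_holomorphic_sqrt[OF B convex_imp_contractible[OF convex_sector] B0] by metis
  have R0: "R z \<noteq> 0" if "z \<in> ?C" for z using R(2) B0 that by force
  define X where "X = ?C - ?J"
  have X: "\<zeta> - 1 \<notin> \<real>\<^sub>\<le>\<^sub>0" "\<zeta> \<noteq> 1" "\<zeta> \<in> ?C" "g \<zeta> \<in> - \<Delta>" if "\<zeta> \<in> X" for \<zeta>
  proof -
    show z: "\<zeta> \<in> ?C" "g \<zeta> \<in> - \<Delta>" using that \<kappa>(3) by (auto simp: X_def)
    show "\<zeta> - 1 \<notin> \<real>\<^sub>\<le>\<^sub>0"
    proof
      assume "\<zeta> - 1 \<in> \<real>\<^sub>\<le>\<^sub>0"
      then have "\<zeta> = of_real (Re \<zeta>)" "Re \<zeta> \<le> 1" by (auto simp: complex_nonpos_Reals_iff complex_eq_iff)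
      moreover have "Re \<zeta> > 0" using z by (simp add: sector_def)
      ultimately show False using that unfolding X_def by auto
    qed
    then show "\<zeta> \<noteq> 1" by auto
  qed
  \<comment> \<open>The given branch \<open>w\<close> is compared with the explicit one on the slit
    sector; by connectedness they differ by a fixed sign.\<close>
  define q where "q \<zeta> = w (g \<zeta>) / (csqrt (\<zeta> - 1) * R \<zeta>)" for \<zeta>
  have contq: "continuous_on X q"
    unfolding q_def
  proof (intro continuous_intros)
    show "continuous_on X (\<lambda>\<zeta>. w (g \<zeta>))"
      by (rule continuous_on_compose2[OF w(1) continuous_on_subset[OF holomorphic_on_imp_continuous_on[OF holg]]])
         (use X in auto)
    show "continuous_on X (\<lambda>\<zeta>. csqrt (\<zeta> - 1))"
      by (rule continuous_on_compose2[OF continuous_on_csqrt]) (use X in \<open>auto intro!: continuous_intros\<close>)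
    show "continuous_on X R"
      by (rule continuous_on_subset[OF holomorphic_on_imp_continuous_on[OF R(1)]]) (auto simp: X_def)
  qed (use X R0 in auto)
  have q1: "(q \<zeta>)\<^sup>2 = 1" if "\<zeta> \<in> X" for \<zeta>
    unfolding q_def using X[OF that] w(2)[of "g \<zeta>"] R0[of \<zeta>] R(2)[of \<zeta>]
    by (simp add: power_divide power_mult_distrib Beq)
  obtain \<sigma> where \<sigma>: "\<sigma>\<^sup>2 = 1" "\<And>z. z \<in> X \<Longrightarrow> q z = \<sigma>"
    using connected_sq_const[OF connected_slit_sector[OF \<kappa>(1)] contq[unfolded X_def]] q1 X_def by metis
  have weq: "w (g \<zeta>) = \<sigma> * csqrt (\<zeta> - 1) * R \<zeta>" if "\<zeta> \<in> X" for \<zeta>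
    using \<sigma>(2)[OF that] X[OF that] R0[of \<zeta>] unfolding q_def by (auto simp: field_simps)
  \<comment> \<open>\<open>\<i> * csqrt (1 - \<zeta>)\<close> is holomorphic across the slit to the
    left of the tip; it equals \<open>csqrt (\<zeta> - 1)\<close> above the real axis and its
    negative below.\<close>
  define W where "W \<zeta> = \<sigma> * (\<i> * csqrt (1 - \<zeta>)) * R \<zeta>" for \<zeta>
  show ?thesis
  proof
    have "1 - z \<notin> \<real>\<^sub>\<le>\<^sub>0" if "Re z < 1" for z using that by (auto simp: complex_nonpos_Reals_iff)
    then show "W holomorphic_on (sector \<kappa> \<inter> {\<zeta>. Re \<zeta> < 1})"
      unfolding W_def
      by (intro holomorphic_intros holomorphic_on_subset[OF R(1)]) auto
    fix \<zeta> assume \<zeta>: "\<zeta> \<in> ?C" "Re \<zeta> < 1"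
    show "(W \<zeta>)\<^sup>2 = branch_poly a (g \<zeta>)"
      using \<sigma>(1) R(2)[OF \<zeta>(1)] by (simp add: W_def power_mult_distrib Beq algebra_simps)
    have X': "\<zeta> \<in> X" if "Im \<zeta> \<noteq> 0" using \<zeta> that by (auto simp: X_def)
    show "w (g \<zeta>) = W \<zeta>" if "0 < Im \<zeta>"
      using weq[OF X'] that csqrt_minus[of "1 - \<zeta>"] by (auto simp: W_def)
    show "w (g \<zeta>) = - W \<zeta>" if "Im \<zeta> < 0"
      using weq[OF X'] that csqrt_minus[of "\<zeta> - 1"] by (auto simp: W_def algebra_simps)
  qed
qed

section \<open>Charts for the three arcs together with \<open>w\<close>\<close>

lemma analytic_arc_chart:
  assumes "analytic_arc \<gamma>"
  obtains g N where "open N" "complex_of_real ` {0..1} \<subseteq> N" "g holomorphic_on N" "inj_on g N"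
    "\<And>u. u \<in> {0..1} \<Longrightarrow> g (of_real u) = \<gamma> u"
proof -
  obtain g where g: "g analytic_on (complex_of_real ` {0..1})"
    "\<And>t. t \<in> {0..1} \<Longrightarrow> g (of_real t) = \<gamma> t" "\<And>t. t \<in> {0..1} \<Longrightarrow> deriv g (of_real t) \<noteq> 0"
    using assms unfolding analytic_arc_def by blast
  have inj: "inj_on g (complex_of_real ` {0..1})"
    using assms g(2) unfolding analytic_arc_def arc_def inj_on_def by (auto simp: g(2))
  have "compact (complex_of_real ` {0..1})"
    by (intro compact_continuous_image continuous_intros) auto
  then obtain N where "open N" "complex_of_real ` {0..1} \<subseteq> N" "g holomorphic_on N" "inj_on g N"
    using univalent_neighbourhood[OF g(1) _ inj] g(3) by blast
  then show ?thesis using that g(2) by blast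
qed

lemma tangent_chart:
  assumes N: "open N" "complex_of_real ` {0..1} \<subseteq> N" "g holomorphic_on N"
    and eq: "\<And>u. u \<in> {0..1} \<Longrightarrow> g (of_real u) = \<gamma> u" and t: "t \<in> {0..1}"
  shows "tangent \<gamma> t = deriv g (of_real t)"
proof -
  have "(g has_field_derivative deriv g (of_real t)) (at (of_real t) within UNIV)"
    using N t holomorphic_derivI by blast
  then have "((\<lambda>u. g (of_real u)) has_vector_derivative deriv g (of_real t)) (at t)"
    using has_vector_derivative_real_field[of g "deriv g (of_real t)" t UNIV] by simp
  then have "((\<lambda>u. g (of_real u)) has_vector_derivative deriv g (of_real t)) (at t within {0..1})"
    by (rule has_vector_derivative_at_within)
  then have "(\<gamma> has_vector_derivative deriv g (of_real t)) (at t within {0..1})"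
    by (rule has_vector_derivative_transform[rotated 2]) (use t eq in auto)
  then show ?thesis
    unfolding tangent_def using vector_derivative_within_cbox[of 0 1 t \<gamma>] t by (simp add: cbox_interval)
qed

text \<open>Measured from the first arc, the three directions have argument zero, a positive
  argument, and a larger one. A positive real ratio would make two of them equal. This is how the
  clockwise order of the arcs enters.\<close>

lemma distinct_directions:
  fixes T :: "nat \<Rightarrow> complex"
  assumes nz: "\<And>k. k \<in> {1..3} \<Longrightarrow> T k \<noteq> 0"
    and arg: "0 < Arg2pi (T 3 / T 1)" "Arg2pi (T 3 / T 1) < Arg2pi (T 2 / T 1)"
    and jk: "j \<in> {1..3}" "k \<in> {1..3}" "j \<noteq> k" and c: "0 < c"
  shows "T k / T j \<noteq> complex_of_real c"
proof
  assume "T k / T j = complex_of_real c"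
  then have "T k / T 1 = of_real c * (T j / T 1)"
    using nz[OF jk(1)] by (auto simp: field_simps)
  then have eq: "Arg2pi (T k / T 1) = Arg2pi (T j / T 1)"
    using c by (simp only: Arg2pi_times_of_real)
  have 1: "T 1 / T 1 = of_real 1" using nz[of 1] by simp
  have A1: "Arg2pi (T 1 / T 1) = 0" unfolding 1 using Arg2pi_of_real[of 1] by simp
  have "{1..3} = {1::nat, 2, 3}" by auto
  then have "j \<in> {1, 2, 3}" "k \<in> {1, 2, 3}" using jk by blast+
  then show False using eq A1 arg jk(3) by (elim insertE emptyE) simp_all
qed

text \<open>\<open>W k\<close> continues the left trace of \<open>w\<close> on the \<open>k\<close>-th arc to both sides of the arc.\<close>

locale tripod_chart =
  fixes a :: "nat \<Rightarrow> complex" and \<Delta> :: "complex set" and w :: "complex \<Rightarrow> complex"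
    and g :: "nat \<Rightarrow> complex \<Rightarrow> complex" and N :: "nat \<Rightarrow> complex set"
    and \<kappa> :: "nat \<Rightarrow> real" and W :: "nat \<Rightarrow> complex \<Rightarrow> complex"
  assumes \<Delta>_eq: "\<Delta> = (\<Union>k\<in>{1..3}. g k ` complex_of_real ` {0..1})"
    and open_N: "\<And>k. k \<in> {1..3} \<Longrightarrow> open (N k)"
    and segment_N: "\<And>k. k \<in> {1..3} \<Longrightarrow> complex_of_real ` {0..1} \<subseteq> N k"
    and holo_g: "\<And>k. k \<in> {1..3} \<Longrightarrow> g k holomorphic_on N k"
    and inj_g: "\<And>k. k \<in> {1..3} \<Longrightarrow> inj_on (g k) (N k)"
    and g_0: "\<And>k. k \<in> {1..3} \<Longrightarrow> g k 0 = a 0"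
    and g_1: "\<And>k. k \<in> {1..3} \<Longrightarrow> g k 1 = a k"
    and inj_a: "inj_on a {..3}"
    and \<kappa>_pos: "\<And>k. k \<in> {1..3} \<Longrightarrow> 0 < \<kappa> k"
    and sector_N: "\<And>k. k \<in> {1..3} \<Longrightarrow> sector (\<kappa> k) \<subseteq> N k"
    and sector_\<Delta>: "\<And>k \<zeta>. k \<in> {1..3} \<Longrightarrow> \<zeta> \<in> sector (\<kappa> k) \<Longrightarrow>
                   g k \<zeta> \<in> \<Delta> \<longleftrightarrow> \<zeta> \<in> complex_of_real ` {0<..1}"
    and disjoint_arcs: "\<And>j k \<zeta>. k \<in> {1..3} \<Longrightarrow> j \<in> {1..3} \<Longrightarrow> j \<noteq> k \<Longrightarrow> \<zeta> \<in> sector (\<kappa> k) \<Longrightarrow>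
                        g k \<zeta> \<notin> g j ` complex_of_real ` {0..1}"
    and tip: "\<And>k \<zeta> j. k \<in> {1..3} \<Longrightarrow> \<zeta> \<in> sector (\<kappa> k) \<Longrightarrow> j \<le> 3 \<Longrightarrow> g k \<zeta> = a j \<Longrightarrow> j = k"
    and branch_root: "branch_root a \<Delta> w"
    and holo_W: "\<And>k. k \<in> {1..3} \<Longrightarrow> W k holomorphic_on (sector (\<kappa> k) \<inter> {\<zeta>. Re \<zeta> < 1})"
    and W_sq: "\<And>k \<zeta>. k \<in> {1..3} \<Longrightarrow> \<zeta> \<in> sector (\<kappa> k) \<Longrightarrow> Re \<zeta> < 1 \<Longrightarrow>
                 (W k \<zeta>)\<^sup>2 = branch_poly a (g k \<zeta>)"
    and w_upper: "\<And>k \<zeta>. k \<in> {1..3} \<Longrightarrow> \<zeta> \<in> sector (\<kappa> k) \<Longrightarrow> Re \<zeta> < 1 \<Longrightarrow> 0 < Im \<zeta> \<Longrightarrow>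
                   w (g k \<zeta>) = W k \<zeta>"
    and w_lower: "\<And>k \<zeta>. k \<in> {1..3} \<Longrightarrow> \<zeta> \<in> sector (\<kappa> k) \<Longrightarrow> Re \<zeta> < 1 \<Longrightarrow> Im \<zeta> < 0 \<Longrightarrow>
                   w (g k \<zeta>) = - W k \<zeta>"

text \<open>Once the sector of an arc avoids the two other arcs, its part of \<open>\<Delta>\<close>
  is exactly the segment \<open>(0, 1]\<close>, and the only branch point it can meet is the tip.
  These are the facts on which the continuation of \<open>w\<close> rests.\<close>

lemma ex_tripod_chart:
  assumes tri: "tripod a \<gamma> \<Delta>" and br: "branch_root a \<Delta> w"
  obtains g N \<kappa> W where "tripod_chart a \<Delta> w g N \<kappa> W"
    "\<And>k u. k \<in> {1..3} \<Longrightarrow> u \<in> {0..1} \<Longrightarrow> g k (complex_of_real u) = \<gamma> k u"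
proof -
  let ?I = "complex_of_real ` {0..1}" and ?J = "complex_of_real ` {0<..1}"
  have t1: "\<Delta> = (\<Union>k\<in>{1..3}. path_image (\<gamma> k))"
    and t2: "\<And>k. k \<in> {1..3} \<Longrightarrow> analytic_arc (\<gamma> k)" "\<And>k. k \<in> {1..3} \<Longrightarrow> pathstart (\<gamma> k) = a 0"
      "\<And>k. k \<in> {1..3} \<Longrightarrow> pathfinish (\<gamma> k) = a k"
    and t3: "\<And>j k. j \<in> {1..3} \<Longrightarrow> k \<in> {1..3} \<Longrightarrow> j \<noteq> k \<Longrightarrow> path_image (\<gamma> j) \<inter> path_image (\<gamma> k) = {a 0}"
    and t4: "0 < Arg2pi (tangent (\<gamma> 3) 0 / tangent (\<gamma> 1) 0)"
     "Arg2pi (tangent (\<gamma> 3) 0 / tangent (\<gamma> 1) 0) < Arg2pi (tangent (\<gamma> 2) 0 / tangent (\<gamma> 1) 0)"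
    using tri unfolding tripod_def by blast+
  define P where "P k h M \<longleftrightarrow> open M \<and> ?I \<subseteq> M \<and> h holomorphic_on M \<and> inj_on h M \<and> (\<forall>u\<in>{0..1}. h (of_real u) = \<gamma> k u)"
    for k :: nat and h :: "complex \<Rightarrow> complex" and M
  have "\<forall>k\<in>{1..3}. \<exists>h M. P k h M"
  proof
    fix k :: nat assume "k \<in> {1..3}"
    from analytic_arc_chart[OF t2(1)[OF this]] show "\<exists>h M. P k h M"
      unfolding P_def by metis
  qed
  then obtain g N where "\<And>k. k \<in> {1..3} \<Longrightarrow> P k (g k) (N k)"
    by metis
  then have N: "\<And>k. k \<in> {1..3} \<Longrightarrow> open (N k)" "\<And>k. k \<in> {1..3} \<Longrightarrow> ?I \<subseteq> N k"
    "\<And>k. k \<in> {1..3} \<Longrightarrow> g k holomorphic_on N k" "\<And>k. k \<in> {1..3} \<Longrightarrow> inj_on (g k) (N k)"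
    and eq: "\<And>k u. k \<in> {1..3} \<Longrightarrow> u \<in> {0..1} \<Longrightarrow> g k (complex_of_real u) = \<gamma> k u"
    unfolding P_def by blast+
  have pim: "path_image (\<gamma> k) = g k ` ?I" if "k \<in> {1..3}" for k
    unfolding path_image_def image_image using eq[OF that] by (intro image_cong) auto
  have \<Delta>: "\<Delta> = (\<Union>k\<in>{1..3}. g k ` ?I)" unfolding t1 using pim by (intro SUP_cong) auto
  have g0: "g k 0 = a 0" and g1: "g k 1 = a k" if "k \<in> {1..3}" for k
    using eq[OF that, of 0] eq[OF that, of 1] t2[OF that] by (simp_all add: pathstart_def pathfinish_def)
  have z: "0 \<in> ?I" "1 \<in> ?I" by (auto simp: image_iff intro: bexI[of _ 0] bexI[of _ 1])
  have zN: "0 \<in> N k" "1 \<in> N k" if "k \<in> {1..3}" for k using N(2)[OF that] z by auto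
  have tan: "tangent (\<gamma> k) 0 = deriv (g k) 0" if "k \<in> {1..3}" for k
    using tangent_chart[OF N(1-3)[OF that] eq[OF that], of 0] by simp
  have d0: "deriv (g k) 0 \<noteq> 0" if "k \<in> {1..3}" for k
    by (rule holomorphic_injective_imp_regular[OF N(3,1,4)[OF that] zN(1)[OF that]])
  have arg: "0 < Arg2pi (deriv (g 3) 0 / deriv (g 1) 0)"
     "Arg2pi (deriv (g 3) 0 / deriv (g 1) 0) < Arg2pi (deriv (g 2) 0 / deriv (g 1) 0)"
    using t4 tan[of 1] tan[of 2] tan[of 3] by simp_all
  have meet: "g j ` ?I \<inter> g k ` ?I = {a 0}" if "j \<in> {1..3}" "k \<in> {1..3}" "j \<noteq> k" for j k
    using t3[OF that] pim[OF that(1)] pim[OF that(2)] by simp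
  have "\<exists>c>0. sector c \<subseteq> N k \<and> (\<forall>j\<in>{1..3}-{k}. \<forall>\<zeta>\<in>sector c. g k \<zeta> \<notin> g j ` ?I)" if k: "k \<in> {1..3}" for k
  proof -
    have "\<forall>j\<in>{1..3}-{k}. \<exists>c>0. sector c \<subseteq> N k \<and> (\<forall>\<zeta>\<in>sector c. g k \<zeta> \<notin> g j ` ?I)"
    proof
      fix j assume j: "j \<in> {1..3} - {k}"
      then have j': "j \<in> {1..3}" "j \<noteq> k" by auto
      obtain c where "c > 0" "sector c \<subseteq> N k" "\<And>\<zeta>. \<zeta> \<in> sector c \<Longrightarrow> g k \<zeta> \<notin> g j ` ?I"
      proof (rule sector_avoids_arc[OF N(1-4)[OF k] N(1-4)[OF j'(1)]])
        show "g k 0 = g j 0" using g0 k j' by simp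
        show "g k ` ?I \<inter> g j ` ?I \<subseteq> {g k 0}"
          using meet[OF k j'(1)] j'(2) g0[OF k] by simp
        show "deriv (g k) 0 / deriv (g j) 0 \<noteq> complex_of_real c" if "0 < c" for c
          using distinct_directions[of "\<lambda>k. deriv (g k) 0", OF d0 arg j'(1) k j'(2) that] by simp
      qed auto
      then show "\<exists>c>0. sector c \<subseteq> N k \<and> (\<forall>\<zeta>\<in>sector c. g k \<zeta> \<notin> g j ` ?I)" by blast
    qed
    then obtain cf where cf: "\<forall>j\<in>{1..3}-{k}. cf j > 0 \<and> sector (cf j) \<subseteq> N k \<and> (\<forall>\<zeta>\<in>sector (cf j). g k \<zeta> \<notin> g j ` ?I)"
      by (rule bchoice[THEN exE])
    \<comment> \<open>Sectors grow with their parameter, so the smaller of the two openings works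
      against both other arcs.\<close>
    let ?c = "Min (cf ` ({1..3}-{k}))"
    have "(if k = 1 then 2 else 1) \<in> {1..3} - {k}" by auto
    then have ne: "{1..3} - {k} \<noteq> {}" by blast
    have "?c \<in> cf ` ({1..3}-{k})" using ne by (intro Min_in) auto
    then obtain j0 where j0: "j0 \<in> {1..3}-{k}" "?c = cf j0" by blast
    then have c0: "?c > 0" "sector ?c \<subseteq> N k" using bspec[OF cf j0(1)] by simp_all
    have "g k \<zeta> \<notin> g j ` ?I" if "j \<in> {1..3}-{k}" "\<zeta> \<in> sector ?c" for j \<zeta>
    proof -
      have "?c \<le> cf j" using that by (intro Min_le) auto
      then have "\<zeta> \<in> sector (cf j)" using sector_mono that(2) by blast
      then show ?thesis using cf that(1) by blast
    qed
    then show ?thesis using c0 by blast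
  qed
  then obtain \<kappa> where \<kappa>: "\<And>k. k \<in> {1..3} \<Longrightarrow> \<kappa> k > 0" "\<And>k. k \<in> {1..3} \<Longrightarrow> sector (\<kappa> k) \<subseteq> N k"
    and avoid: "\<And>j k \<zeta>. k \<in> {1..3} \<Longrightarrow> j \<in> {1..3} \<Longrightarrow> j \<noteq> k \<Longrightarrow> \<zeta> \<in> sector (\<kappa> k) \<Longrightarrow> g k \<zeta> \<notin> g j ` ?I"
    by (metis (no_types, lifting) Diff_iff singletonD)
  have cd: "g k \<zeta> \<in> \<Delta> \<longleftrightarrow> \<zeta> \<in> ?J" if k: "k \<in> {1..3}" and \<zeta>: "\<zeta> \<in> sector (\<kappa> k)" for k \<zeta>
  proof
    assume "g k \<zeta> \<in> \<Delta>"
    then obtain j where "j \<in> {1..3}" "g k \<zeta> \<in> g j ` ?I" unfolding \<Delta> by blast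
    then have "g k \<zeta> \<in> g k ` ?I" using avoid[OF k _ _ \<zeta>] by blast
    then have "\<zeta> \<in> ?I" using N(2,4)[OF k] \<kappa>(2)[OF k] \<zeta> by (auto dest!: inj_onD)
    then show "\<zeta> \<in> ?J" using \<zeta> unfolding sector_def by auto
  next
    assume "\<zeta> \<in> ?J"
    then have "\<zeta> \<in> ?I" by auto
    then show "g k \<zeta> \<in> \<Delta>" unfolding \<Delta> using k by blast
  qed
  have a0: "a k \<noteq> a 0" if "k \<in> {1..3}" for k
  proof
    assume "a k = a 0"
    then have "g k 0 = g k 1" using g0[OF that] g1[OF that] by simp
    then show False using inj_onD[OF N(4)[OF that] _ zN[OF that]] by simp
  qed
  have ain: "a k \<in> g k ` ?I" if "k \<in> {1..3}" for k using g1[OF that] z by (metis imageI)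
  have aj: "a j \<noteq> a k" if "j \<in> {1..3}" "k \<in> {1..3}" "j \<noteq> k" for j k
  proof
    assume "a j = a k"
    then have "a j \<in> g j ` ?I \<inter> g k ` ?I" using ain[OF that(1)] ain[OF that(2)] by simp
    then show False using meet[OF that] a0[OF that(1)] by simp
  qed
  have inja: "inj_on a {..3}"
  proof (rule inj_onI)
    fix i j assume ij: "i \<in> {..3}" "j \<in> {..3}" "a i = a j"
    have "i = 0 \<or> i \<in> {1..3}" "j = 0 \<or> j \<in> {1..3}" using ij by auto
    then show "i = j" using ij(3) a0 aj by metis
  qed
  have w: "continuous_on (- \<Delta>) w" "\<And>z. z \<in> - \<Delta> \<Longrightarrow> (w z)\<^sup>2 = branch_poly a z"
    using br unfolding branch_root_def by (auto intro: holomorphic_on_imp_continuous_on)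
  have tip: "j = k" if k: "k \<in> {1..3}" and j: "\<zeta> \<in> sector (\<kappa> k)" "j \<le> 3" "g k \<zeta> = a j" for k \<zeta> j
  proof (cases "j = 0")
    case True
    then have "g k \<zeta> = g k 0" using j g0[OF k] by simp
    then have "\<zeta> = 0" using N(4)[OF k] zN(1)[OF k] j \<kappa>(2)[OF k] by (auto dest!: inj_onD)
    then show ?thesis using j(1) by (simp add: sector_def)
  next
    case False
    then have j1: "j \<in> {1..3}" using j(2) by auto
    show ?thesis using avoid[OF k j1 _ j(1)] ain[OF j1] j(3) by auto
  qed
  define R where "R k V \<longleftrightarrow> V holomorphic_on (sector (\<kappa> k) \<inter> {\<zeta>. Re \<zeta> < 1}) \<and>
    (\<forall>\<zeta>\<in>sector (\<kappa> k). Re \<zeta> < 1 \<longrightarrow> (V \<zeta>)\<^sup>2 = branch_poly a (g k \<zeta>)) \<and>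
    (\<forall>\<zeta>\<in>sector (\<kappa> k). Re \<zeta> < 1 \<longrightarrow> 0 < Im \<zeta> \<longrightarrow> w (g k \<zeta>) = V \<zeta>) \<and>
    (\<forall>\<zeta>\<in>sector (\<kappa> k). Re \<zeta> < 1 \<longrightarrow> Im \<zeta> < 0 \<longrightarrow> w (g k \<zeta>) = - V \<zeta>)" for k V
  have "\<forall>k\<in>{1..3}. \<exists>V. R k V"
  proof
    fix k :: nat assume k: "k \<in> {1..3}"
    show "\<exists>V. R k V"
    proof (rule branch_root_in_chart[OF w N(1,3,4)[OF k] zN(2)[OF k] \<kappa>[OF k] cd[OF k]])
      show "k \<le> 3" using k by auto
      show "g k 1 = a k" by (rule g1[OF k])
      show "j = k" if "j \<le> 3" "\<zeta> \<in> sector (\<kappa> k)" "g k \<zeta> = a j" for j \<zeta>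
        using tip[OF k that(2,1,3)] .
    next
      fix V assume "V holomorphic_on (sector (\<kappa> k) \<inter> {\<zeta>. Re \<zeta> < 1})"
        "\<And>\<zeta>. \<zeta> \<in> sector (\<kappa> k) \<Longrightarrow> Re \<zeta> < 1 \<Longrightarrow> (V \<zeta>)\<^sup>2 = branch_poly a (g k \<zeta>)"
        "\<And>\<zeta>. \<zeta> \<in> sector (\<kappa> k) \<Longrightarrow> Re \<zeta> < 1 \<Longrightarrow> 0 < Im \<zeta> \<Longrightarrow> w (g k \<zeta>) = V \<zeta>"
        "\<And>\<zeta>. \<zeta> \<in> sector (\<kappa> k) \<Longrightarrow> Re \<zeta> < 1 \<Longrightarrow> Im \<zeta> < 0 \<Longrightarrow> w (g k \<zeta>) = - V \<zeta>"
      then show ?thesis unfolding R_def by blast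
    qed
  qed
  then obtain W where W: "\<forall>k\<in>{1..3}. R k (W k)" by (rule bchoice[THEN exE])
  have "tripod_chart a \<Delta> w g N \<kappa> W"
    by (unfold_locales; (intro \<Delta> N g0 g1 inja \<kappa> cd avoid tip br; assumption)?) (use W R_def in \<open>auto\<close>)
  then show ?thesis using that eq by blast
qed

section \<open>Boundary copies\<close>

lemma boundary_copyD:
  assumes "boundary_copy \<Delta> t U" "0 < r"
  shows "t \<in> \<Delta>" "U r \<in> components (ball t r - \<Delta>)" "t \<in> closure (U r)" "U r \<subseteq> ball t r - \<Delta>"
    "connected (U r)" "\<And>s. r \<le> s \<Longrightarrow> U r \<subseteq> U s"
  using assms in_components_subset in_components_connected unfolding boundary_copy_def by blast+

text \<open>Coherence of the copy makes the sets \<open>U r\<close> a filter base, so the infimum of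
  principal filters is already attained at a single radius.\<close>

lemma eventually_copy_nhds:
  assumes "boundary_copy \<Delta> t U"
  shows "eventually P (copy_nhds U) \<longleftrightarrow> (\<exists>r>0. \<forall>z\<in>U r. P z)"
proof -
  have "eventually P (copy_nhds U) \<longleftrightarrow> (\<exists>r\<in>{0<..}. eventually P (principal (U r)))"
    unfolding copy_nhds_def
  proof (rule eventually_INF_base)
    fix r s :: real assume rs: "r \<in> {0<..}" "s \<in> {0<..}"
    then have "U (min r s) \<subseteq> U r" "U (min r s) \<subseteq> U s"
      using boundary_copyD(6)[OF assms, of "min r s"] by auto
    then show "\<exists>x\<in>{0<..}. principal (U x) \<le> inf (principal (U r)) (principal (U s))"
      using rs by (intro bexI[of _ "min r s"]) auto
  qed auto
  then show ?thesis by (simp add: eventually_principal Bex_def)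
qed

lemma copy_nhds_neq_bot:
  assumes "boundary_copy \<Delta> t U" shows "copy_nhds U \<noteq> bot"
proof
  assume "copy_nhds U = bot"
  then have "eventually (\<lambda>_. False) (copy_nhds U)" by simp
  then obtain r where "r > 0" "\<forall>z\<in>U r. False" unfolding eventually_copy_nhds[OF assms] by blast
  then show False using in_components_nonempty[OF boundary_copyD(2)[OF assms]] by blast
qed

lemma copy_nhds_le_at_within:
  assumes "boundary_copy \<Delta> t U" shows "copy_nhds U \<le> at t within - \<Delta>"
proof (rule filter_leI)
  fix P assume "eventually P (at t within - \<Delta>)"
  then obtain d where d: "d > 0" "\<forall>x\<in>- \<Delta>. x \<noteq> t \<and> dist x t < d \<longrightarrow> P x"
    unfolding eventually_at by blast
  have "\<forall>z\<in>U d. P z"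
    using boundary_copyD(1,4)[OF assms d(1)] d(2) by (auto simp: dist_commute subset_eq)
  then show "eventually P (copy_nhds U)"
    unfolding eventually_copy_nhds[OF assms] using d(1) by blast
qed

text \<open>A connected approach region determines a copy: for each radius the image of a small
  piece \<open>A \<inter> ball x c\<close> is connected and avoids \<open>\<Delta>\<close>, so it
  lies in one component of the slit disc. Any two small pieces overlap, which makes the components
  for different radii coherent and puts \<open>t\<close> in their closures.\<close>

lemma ex_boundary_copy:
  assumes t: "t \<in> \<Delta>" and c0: "0 < c0"
    and A: "\<And>c. 0 < c \<Longrightarrow> c \<le> c0 \<Longrightarrow> connected (A \<inter> ball x c)"
      "\<And>c. 0 < c \<Longrightarrow> c \<le> c0 \<Longrightarrow> A \<inter> ball x c \<noteq> {}"
    and cont: "continuous_on (A \<inter> ball x c0) g" and lim: "(g \<longlongrightarrow> t) (at x within A)"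
    and x: "x \<notin> A" and im: "g ` (A \<inter> ball x c0) \<subseteq> - \<Delta>"
  obtains U where "boundary_copy \<Delta> t U" "\<And>r. 0 < r \<Longrightarrow> \<exists>c>0. g ` (A \<inter> ball x c) \<subseteq> U r"
proof -
  have "\<exists>c. 0 < c \<and> c \<le> c0 \<and> g ` (A \<inter> ball x c) \<subseteq> ball t r - \<Delta>" if "r > 0" for r
  proof -
    have "eventually (\<lambda>z. dist (g z) t < r) (at x within A)" using lim that by (rule tendstoD)
    then obtain d where d: "d > 0" "\<forall>z\<in>A. z \<noteq> x \<and> dist z x < d \<longrightarrow> dist (g z) t < r"
      unfolding eventually_at by blast
    have "g ` (A \<inter> ball x (min d c0)) \<subseteq> ball t r - \<Delta>"
    proof (rule image_subsetI)
      fix z assume z: "z \<in> A \<inter> ball x (min d c0)"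
      then have "z \<noteq> x" "dist z x < d" using x by (auto simp: dist_commute)
      then have "dist (g z) t < r" using d(2) z by blast
      moreover have "z \<in> A \<inter> ball x c0" using z by auto
      then have "g z \<notin> \<Delta>" using im by blast
      ultimately show "g z \<in> ball t r - \<Delta>" by (simp add: dist_commute)
    qed
    then show ?thesis using d c0 by (intro exI[of _ "min d c0"]) auto
  qed
  then obtain c where c: "\<And>r. r > 0 \<Longrightarrow> 0 < c r \<and> c r \<le> c0 \<and> g ` (A \<inter> ball x (c r)) \<subseteq> ball t r - \<Delta>"
    by metis
  have "\<exists>p. p \<in> A \<inter> ball x (c r)" if "r > 0" for r using A(2)[of "c r"] c[OF that] by blast
  then obtain p where p: "\<And>r. r > 0 \<Longrightarrow> p r \<in> A \<inter> ball x (c r)" by metis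
  \<comment> \<open>The base point \<open>p r\<close> merely selects the component; the whole small
    piece lies in it.\<close>
  define U where "U r = connected_component_set (ball t r - \<Delta>) (g (p r))" for r
  have sub: "g ` (A \<inter> ball x (c r)) \<subseteq> U r" if "r > 0" for r
    unfolding U_def
  proof (rule connected_component_maximal)
    show "g (p r) \<in> g ` (A \<inter> ball x (c r))" using p[OF that] by blast
    show "connected (g ` (A \<inter> ball x (c r)))"
      using c[OF that] by (intro connected_continuous_image continuous_on_subset[OF cont] A(1)) auto
    show "g ` (A \<inter> ball x (c r)) \<subseteq> ball t r - \<Delta>" using c[OF that] by blast
  qed
  have comp: "U r \<in> components (ball t r - \<Delta>)" if "r > 0" for r
    unfolding U_def components_def using p[OF that] c[OF that] by blast
  have meet: "U r \<inter> ball t e \<noteq> {}" if "r > 0" "e > 0" for r e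
  proof -
    have "0 < min (c r) (c e)" "min (c r) (c e) \<le> c0" using c[OF that(1)] c[OF that(2)] by auto
    then obtain q where "q \<in> A \<inter> ball x (min (c r) (c e))" using A(2) by blast
    then have "g q \<in> U r" "g q \<in> U e" using sub[OF that(1)] sub[OF that(2)] by auto
    then show ?thesis using in_components_subset[OF comp[OF that(2)]] by blast
  qed
  have bc: "boundary_copy \<Delta> t U"
    unfolding boundary_copy_def
  proof (intro conjI allI impI t comp)
    fix r :: real assume r: "0 < r"
    show "t \<in> closure (U r)"
      unfolding closure_approachable using meet[OF r] by (fastforce simp: dist_commute)
    fix s assume s: "r \<le> s"
    have "0 < min (c r) (c s)" "min (c r) (c s) \<le> c0" using c[OF r] c[of s] r s by auto
    then obtain q where "q \<in> A \<inter> ball x (min (c r) (c s))" using A(2) by blast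
    then have q: "g q \<in> U r" "g q \<in> U s" using sub[OF r] sub[of s] r s by auto
    have "U r \<subseteq> ball t s - \<Delta>" using in_components_subset[OF comp[OF r]] s by auto
    then show "U r \<subseteq> U s"
      using components_maximal[OF comp[of s] in_components_connected[OF comp[OF r]]] q r s by auto
  qed
  show ?thesis
    using that[OF bc] sub c by blast
qed

lemma filterlim_copy_nhds:
  assumes "boundary_copy \<Delta> t U" "x \<notin> A" "\<And>r. 0 < r \<Longrightarrow> \<exists>c>0. g ` (A \<inter> ball x c) \<subseteq> U r"
  shows "filterlim g (copy_nhds U) (at x within A)"
  unfolding filterlim_iff eventually_copy_nhds[OF assms(1)]
proof (intro allI impI)
  fix P assume "\<exists>r>0. \<forall>z\<in>U r. P z"
  then obtain r where r: "r > 0" "\<forall>z\<in>U r. P z" by blast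
  then obtain c where c: "c > 0" "g ` (A \<inter> ball x c) \<subseteq> U r" using assms(3) by blast
  show "\<forall>\<^sub>F z in at x within A. P (g z)"
    unfolding eventually_at
  proof (intro exI[of _ c] conjI ballI impI c(1))
    fix z assume "z \<in> A" "z \<noteq> x \<and> dist z x < c"
    then have "z \<in> A \<inter> ball x c" by (simp add: dist_commute)
    then show "P (g z)" using c(2) r(2) by blast
  qed
qed

text \<open>For \<open>\<sigma> = 1\<close> and \<open>\<sigma> = - 1\<close> these are the two sides of an arc in its chart.\<close>

definition half :: "real \<Rightarrow> complex set" where
  "half \<sigma> = {\<zeta>. 0 < \<sigma> * Im \<zeta>}"

lemma half_eq: "half \<sigma> = {\<zeta>. inner (Complex 0 \<sigma>) \<zeta> > 0}"
  by (auto simp: half_def inner_complex_def)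

lemma open_half: "open (half \<sigma>)" and convex_half: "convex (half \<sigma>)"
  unfolding half_eq by (rule open_halfspace_gt convex_halfspace_gt)+

context tripod_chart
begin

section \<open>Boundary copies seen in the charts\<close>

lemma compact_arc:
  assumes k: "k \<in> {1..3}" and S: "S \<subseteq> {0..1}" "closed S"
  shows "compact (g k ` complex_of_real ` S)"
proof (intro compact_continuous_image)
  have "complex_of_real ` S \<subseteq> N k" using S(1) segment_N[OF k] by blast
  then show "continuous_on (complex_of_real ` S) (g k)"
    by (rule continuous_on_subset[OF holomorphic_on_imp_continuous_on[OF holo_g[OF k]]])
  show "continuous_on S complex_of_real" by (intro continuous_intros)
  have "bounded S" by (rule bounded_subset[OF bounded_closed_interval S(1)])
  then show "compact S" using S(2) by (simp add: compact_eq_bounded_closed)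
qed

lemma closed_\<Delta>: "closed \<Delta>"
  unfolding \<Delta>_eq using compact_arc by (intro compact_imp_closed compact_UN) auto

lemma arc_mem: "k \<in> {1..3} \<Longrightarrow> s \<in> {0..1} \<Longrightarrow> g k (of_real s) \<in> \<Delta>"
  unfolding \<Delta>_eq by blast

lemma a_mem: "j \<le> 3 \<Longrightarrow> a j \<in> \<Delta>"
proof -
  assume "j \<le> 3"
  then have "j = 0 \<or> j \<in> {1..3}" by auto
  then show ?thesis using arc_mem[of 1 0] arc_mem[of j 1] g_0[of 1] g_1[of j] by auto
qed

lemma of_real_sector: "k \<in> {1..3} \<Longrightarrow> s \<in> {0<..1} \<Longrightarrow> complex_of_real s \<in> sector (\<kappa> k)"
  using \<kappa>_pos[of k] by (auto simp: sector_def)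

lemma off_real_sector: "k \<in> {1..3} \<Longrightarrow> \<zeta> \<in> sector (\<kappa> k) \<Longrightarrow> Im \<zeta> \<noteq> 0 \<Longrightarrow> g k \<zeta> \<notin> \<Delta>"
  using sector_\<Delta>[of k \<zeta>] by auto

lemma open_g_image:
  assumes "k \<in> {1..3}" "open S" "S \<subseteq> N k" shows "open (g k ` S)"
  by (rule open_mapping_thm3[OF holomorphic_on_subset[OF holo_g[OF assms(1)] assms(3)] assms(2)
        inj_on_subset[OF inj_g[OF assms(1)] assms(3)]])

lemma isCont_g: "k \<in> {1..3} \<Longrightarrow> \<zeta> \<in> N k \<Longrightarrow> isCont (g k) \<zeta>"
  by (rule continuous_on_interior[OF holomorphic_on_imp_continuous_on[OF holo_g]]) (simp_all add: interior_open open_N)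

lemma ball_in_sector:
  assumes k: "k \<in> {1..3}" and s: "s \<in> {0<..1}"
  obtains c where "0 < c" "ball (complex_of_real s) c \<subseteq> sector (\<kappa> k)"
  using openE[OF open_sector of_real_sector[OF assms]] by blast

lemma interior_ball:
  assumes k: "k \<in> {1..3}" and s: "s \<in> {0<..<1}"
  obtains c where "0 < c" "ball (complex_of_real s) c \<subseteq> sector (\<kappa> k)" "ball (complex_of_real s) c \<subseteq> N k"
    "\<And>\<zeta>. \<zeta> \<in> ball (complex_of_real s) c \<Longrightarrow> Re \<zeta> < 1"
    "\<And>\<zeta>. \<zeta> \<in> ball (complex_of_real s) c \<Longrightarrow> g k \<zeta> \<in> \<Delta> \<longleftrightarrow> Im \<zeta> = 0"
proof -
  let ?s = "complex_of_real s"
  obtain c1 where c1: "0 < c1" "ball ?s c1 \<subseteq> sector (\<kappa> k)" using ball_in_sector[OF k, of s] s by auto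
  \<comment> \<open>The bound \<open>1 - s\<close> keeps the ball to the left of the tip, in the
    domain of \<open>W\<close>; there the real points of the ball are exactly the points that go to
    \<open>\<Delta>\<close>.\<close>
  define c where "c = min c1 (1 - s)"
  have c: "0 < c" "ball ?s c \<subseteq> sector (\<kappa> k)" using c1 s by (auto simp: c_def)
  have Re1: "Re \<zeta> < 1" if "\<zeta> \<in> ball ?s c" for \<zeta>
    using that abs_Re_le_cmod[of "\<zeta> - ?s"] by (auto simp: c_def dist_norm norm_minus_commute)
  show ?thesis
  proof (rule that[OF c _ Re1])
    show "ball ?s c \<subseteq> N k" using c(2) sector_N[OF k] by blast
    fix \<zeta> assume \<zeta>: "\<zeta> \<in> ball ?s c"
    then have \<zeta>c: "\<zeta> \<in> sector (\<kappa> k)" using c(2) by blast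
    show "g k \<zeta> \<in> \<Delta> \<longleftrightarrow> Im \<zeta> = 0"
    proof
      assume "Im \<zeta> = 0"
      then have "\<zeta> = of_real (Re \<zeta>)" by (simp add: complex_eq_iff)
      moreover have "Re \<zeta> < 1" by (rule Re1[OF \<zeta>])
      moreover have "0 < Re \<zeta>" using \<zeta>c by (simp add: sector_def)
      ultimately have "\<zeta> \<in> complex_of_real ` {0<..1}" by (intro image_eqI[of _ _ "Re \<zeta>"]) auto
      then show "g k \<zeta> \<in> \<Delta>" using sector_\<Delta>[OF k \<zeta>c] by simp
    next
      assume "g k \<zeta> \<in> \<Delta>"
      then show "Im \<zeta> = 0" using sector_\<Delta>[OF k \<zeta>c] by auto
    qed
  qed
qed

text \<open>Equality of filters, and not just an inclusion, is what turns limits along a copy into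
  limits within a half-plane and back. It holds because a small slit disc about an interior arc
  point is covered by the disjoint open images of the two half-discs; a connected set that meets one
  of them stays in it.\<close>

lemma side_copy:
  assumes k: "k \<in> {1..3}" and s: "s \<in> {0<..<1}" and \<sigma>: "\<sigma> \<in> {1, -1}"
  obtains U where "boundary_copy \<Delta> (g k (of_real s)) U"
    "copy_nhds U = filtermap (g k) (at (of_real s) within half \<sigma>)"
proof -
  let ?s = "complex_of_real s" and ?A = "half \<sigma>"
  obtain c0 where c0: "0 < c0" "ball ?s c0 \<subseteq> N k"
    and c0\<Delta>: "\<And>\<zeta>. \<zeta> \<in> ball ?s c0 \<Longrightarrow> g k \<zeta> \<in> \<Delta> \<longleftrightarrow> Im \<zeta> = 0"
    using interior_ball[OF k s] by metis
  have sN: "?s \<in> N k" using c0 by auto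
  have sA: "?s \<notin> ?A" by (simp add: half_def)
  have ne: "?A \<inter> ball ?s c \<noteq> {}" if "0 < c" for c
  proof -
    have "?s + \<i> * of_real (\<sigma> * (c/2)) \<in> ?A \<inter> ball ?s c"
      using that \<sigma> by (auto simp: half_def dist_norm norm_mult)
    then show ?thesis by blast
  qed
  have im: "g k ` (?A \<inter> ball ?s c0) \<subseteq> - \<Delta>"
    using c0\<Delta> by (auto simp: half_def)
  obtain U where U: "boundary_copy \<Delta> (g k ?s) U" "\<And>r. 0 < r \<Longrightarrow> \<exists>c>0. g k ` (?A \<inter> ball ?s c) \<subseteq> U r"
  proof (rule ex_boundary_copy[of "g k ?s" \<Delta> c0 ?A ?s "g k"])
    show "g k ?s \<in> \<Delta>" using arc_mem[OF k] s by auto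
    show "connected (?A \<inter> ball ?s c)" for c by (intro convex_connected convex_Int convex_half convex_ball)
    show "continuous_on (?A \<inter> ball ?s c0) (g k)"
      using c0(2) by (intro continuous_on_subset[OF holomorphic_on_imp_continuous_on[OF holo_g[OF k]]]) auto
    show "(g k \<longlongrightarrow> g k ?s) (at ?s within ?A)"
      using isCont_g[OF k sN] unfolding isCont_def by (rule tendsto_within_subset) auto
  qed (use c0 ne sA im in auto)
  \<comment> \<open>This is the inclusion that needs the topology: the component must not leak to
    the other side of the arc.\<close>
  have "copy_nhds U \<le> filtermap (g k) (at ?s within ?A)"
  proof (rule filter_leI)
    fix P assume "eventually P (filtermap (g k) (at ?s within ?A))"
    then obtain d where d: "d > 0" "\<forall>z\<in>?A. z \<noteq> ?s \<and> dist z ?s < d \<longrightarrow> P (g k z)"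
      unfolding eventually_filtermap eventually_at by blast
    define c where "c = min d c0"
    have c: "c > 0" "ball ?s c \<subseteq> ball ?s c0" "c \<le> d" using d c0 by (auto simp: c_def)
    have "g k ?s \<in> g k ` ball ?s c" using c by auto
    moreover have "open (g k ` ball ?s c)" by (rule open_g_image[OF k]) (use c c0(2) in auto)
    ultimately obtain r where r: "r > 0" "ball (g k ?s) r \<subseteq> g k ` ball ?s c" using openE by blast
    note UD = boundary_copyD[OF U(1) r(1)]
    let ?X = "g k ` (half \<sigma> \<inter> ball ?s c)" and ?Y = "g k ` (half (-\<sigma>) \<inter> ball ?s c)"
    have "U r \<subseteq> ?X \<union> ?Y"
    proof
      fix z assume z: "z \<in> U r"
      then have "z \<in> g k ` ball ?s c" "z \<notin> \<Delta>" using UD(4) r(2) by auto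
      then obtain \<zeta> where \<zeta>: "z = g k \<zeta>" "\<zeta> \<in> ball ?s c" by blast
      have "Im \<zeta> \<noteq> 0" using c0\<Delta>[of \<zeta>] \<zeta> c(2) \<open>z \<notin> \<Delta>\<close> by auto
      then show "z \<in> ?X \<union> ?Y" using \<zeta> \<sigma> by (force simp: half_def)
    qed
    moreover have "open ?X" "open ?Y"
      using c c0(2) by (auto intro!: open_g_image[OF k] open_Int open_half)
    moreover have "?X \<inter> ?Y = {}"
    proof -
      have "inj_on (g k) (ball ?s c)" using inj_on_subset[OF inj_g[OF k]] c c0(2) by blast
      moreover have "half \<sigma> \<inter> half (-\<sigma>) = {}" by (auto simp: half_def)
      ultimately show ?thesis by (auto dest!: inj_onD)
    qed
    moreover have "?X \<inter> U r \<noteq> {}"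
    proof -
      obtain c' where c': "c' > 0" "g k ` (?A \<inter> ball ?s c') \<subseteq> U r" using U(2)[OF r(1)] by blast
      have "0 < min c c'" using c(1) c'(1) by simp
      from ne[OF this] obtain q where "q \<in> ?A \<inter> ball ?s (min c c')" by blast
      then have "g k q \<in> ?X" "g k q \<in> U r" using c'(2) by auto
      then show ?thesis by blast
    qed
    ultimately have "U r \<subseteq> ?X" using connectedD[OF UD(5), of ?X ?Y] by blast
    then have "\<forall>z\<in>U r. P z" using d c sA by (fastforce simp: dist_commute)
    then show "eventually P (copy_nhds U)" unfolding eventually_copy_nhds[OF U(1)] using r(1) by blast
  qed
  moreover have "filtermap (g k) (at ?s within ?A) \<le> copy_nhds U"
    using filterlim_copy_nhds[OF U(1) sA U(2)] unfolding filterlim_def .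
  ultimately show ?thesis using that U(1) by (metis order_antisym)
qed

end

section \<open>Traces on the open arcs and bounds at the tips\<close>

lemma bounded_on_copy:
  assumes U: "boundary_copy \<Delta> t U" and F: "continuous_traces \<Delta> F"
  obtains r B where "0 < r" "\<And>z. z \<in> U r \<Longrightarrow> norm (F z) \<le> B"
proof -
  obtain l where l: "(F \<longlongrightarrow> l) (copy_nhds U)" using F U unfolding continuous_traces_def by blast
  then have "eventually (\<lambda>z. dist (F z) l < 1) (copy_nhds U)" by (rule tendstoD) simp
  then obtain r where r: "r > 0" "\<forall>z\<in>U r. dist (F z) l < 1" unfolding eventually_copy_nhds[OF U] by blast
  have "norm (F z) \<le> norm l + 1" if "z \<in> U r" for z
    using bspec[OF r(2) that] norm_triangle_sub[of "F z" l] by (simp add: dist_norm)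
  then show ?thesis using that r(1) by blast
qed

context tripod_chart
begin

lemma side_trace:
  assumes "continuous_traces \<Delta> F" "k \<in> {1..3}" "s \<in> {0<..<1}" "\<sigma> \<in> {1, -1}"
  obtains l where "((\<lambda>\<zeta>. F (g k \<zeta>)) \<longlongrightarrow> l) (at (complex_of_real s) within half \<sigma>)"
proof -
  obtain U where U: "boundary_copy \<Delta> (g k (of_real s)) U"
    "copy_nhds U = filtermap (g k) (at (of_real s) within half \<sigma>)"
    using side_copy[OF assms(2-4)] by blast
  then obtain l where "(F \<longlongrightarrow> l) (copy_nhds U)"
    using assms(1) unfolding continuous_traces_def by blast
  then show ?thesis using that unfolding U(2) filterlim_filtermap by blast
qed

lemma w_trace:
  assumes k: "k \<in> {1..3}" and s: "s \<in> {0<..<1}" and \<sigma>: "\<sigma> \<in> {1, -1}"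
  shows "((\<lambda>\<zeta>. w (g k \<zeta>)) \<longlongrightarrow> of_real \<sigma> * W k (of_real s)) (at (of_real s) within half \<sigma>)"
proof -
  let ?X = "sector (\<kappa> k) \<inter> {\<zeta>. Re \<zeta> < 1}"
  have op: "open ?X" by (intro open_Int open_sector open_halfspace_Re_lt)
  have sX: "complex_of_real s \<in> ?X" using of_real_sector[OF k, of s] s by auto
  have "isCont (W k) (of_real s)"
    by (rule continuous_on_interior[OF holomorphic_on_imp_continuous_on[OF holo_W[OF k]]])
       (use op sX interior_open in blast)
  then have "(W k \<longlongrightarrow> W k (of_real s)) (at (of_real s) within half \<sigma>)"
    unfolding isCont_def by (rule tendsto_within_subset) auto
  then have "((\<lambda>\<zeta>. of_real \<sigma> * W k \<zeta>) \<longlongrightarrow> of_real \<sigma> * W k (of_real s)) (at (of_real s) within half \<sigma>)"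
    by (intro tendsto_mult tendsto_const)
  then show ?thesis
  proof (rule Lim_transform_eventually)
    have "eventually (\<lambda>\<zeta>. \<zeta> \<in> ?X) (at (of_real s) within half \<sigma>)"
      using eventually_at_in_open'[OF op sX] by (rule filter_leD[OF at_le[OF subset_UNIV]])
    moreover have "eventually (\<lambda>\<zeta>. \<zeta> \<in> half \<sigma>) (at (of_real s) within half \<sigma>)"
      by (simp add: eventually_at_filter)
    ultimately show "eventually (\<lambda>\<zeta>. of_real \<sigma> * W k \<zeta> = w (g k \<zeta>)) (at (of_real s) within half \<sigma>)"
      by eventually_elim (use \<sigma> w_upper[OF k] w_lower[OF k] in \<open>auto simp: half_def\<close>)
  qed
qed

lemma W_nonzero:
  assumes k: "k \<in> {1..3}" and s: "s \<in> {0<..<1}"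
  shows "W k (of_real s) \<noteq> 0"
proof
  assume "W k (of_real s) = 0"
  then have "branch_poly a (g k (of_real s)) = 0"
    using W_sq[OF k of_real_sector[OF k], of s] s by simp
  then obtain j where j: "j \<le> 3" "g k (of_real s) = a j" unfolding branch_poly_eq_0_iff by blast
  have "g k (of_real s) = g k (of_real 1)" using tip[OF k of_real_sector[OF k] j] j(2) s g_1[OF k] by simp
  then have "complex_of_real s = of_real 1"
    by (rule inj_onD[OF inj_g[OF k]]) (use segment_N[OF k] s in \<open>auto simp del: of_real_1\<close>)
  then show False using s by simp
qed

text \<open>Around a tip the slit disc is connected in the chart, so a single copy covers all points
  off \<open>\<Delta>\<close> near \<open>a k\<close>, and the one limit along it bounds
  \<open>F\<close> there.\<close>

lemma bounded_near_tip:
  assumes F: "continuous_traces \<Delta> F" and k: "k \<in> {1..3}"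
  obtains B \<rho> where "0 < \<rho>" "\<And>z. z \<in> ball (a k) \<rho> - \<Delta> \<Longrightarrow> norm (F z) \<le> B"
proof -
  \<comment> \<open>The plane cut along the whole ray to the left of the tip: its discs about
    \<open>1\<close> are star-shaped about a real point to the right of the tip.\<close>
  define A where "A = - complex_of_real ` {..1}"
  obtain c0 where c0: "0 < c0" "ball 1 c0 \<subseteq> sector (\<kappa> k)" using ball_in_sector[OF k, of 1] by auto
  have c0N: "ball 1 c0 \<subseteq> N k" using c0(2) sector_N[OF k] by blast
  have 1: "1 \<in> N k" using c0(1) c0N by auto
  have A1: "1 \<notin> A" unfolding A_def by (auto simp: image_iff intro: bexI[of _ 1])
  have Aoff: "g k \<zeta> \<notin> \<Delta>" if "\<zeta> \<in> A" "\<zeta> \<in> sector (\<kappa> k)" for \<zeta>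
    using sector_\<Delta>[OF k that(2)] that(1) unfolding A_def by auto
  have pt: "complex_of_real (1 + c/2) \<in> A \<inter> ball 1 c" if "0 < c" for c
  proof -
    have "complex_of_real (1 + c/2) \<notin> complex_of_real ` {..1}"
    proof
      assume "complex_of_real (1 + c/2) \<in> complex_of_real ` {..1}"
      then obtain u where "complex_of_real (1 + c/2) = of_real u" "u \<le> 1" by (elim imageE) simp
      then show False using that by (simp only: of_real_eq_iff)
    qed
    moreover have "dist 1 (complex_of_real (1 + c/2)) < c"
    proof -
      have "1 - complex_of_real (1 + c/2) = complex_of_real (- (c/2))" by simp
      then have "dist 1 (complex_of_real (1 + c/2)) = \<bar>c/2\<bar>"
        unfolding dist_norm by (simp only: norm_of_real abs_minus_cancel)
      then show ?thesis using that by simp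
    qed
    ultimately show ?thesis by (simp add: A_def)
  qed
  have conn: "connected (A \<inter> ball 1 c)" if "0 < c" for c
  proof (rule starlike_imp_connected)
    show "starlike (A \<inter> ball 1 c)" unfolding starlike_def
    proof (intro bexI[OF _ pt[OF that]] ballI subsetI IntI)
      fix z x assume z: "z \<in> A \<inter> ball 1 c" and x: "x \<in> closed_segment (complex_of_real (1 + c/2)) z"
      show "x \<in> ball 1 c"
        using closed_segment_subset[OF _ _ convex_ball, of "complex_of_real (1 + c/2)" 1 c z] pt[OF that] z x by blast
      obtain u where u: "0 \<le> u" "u \<le> 1" "x = (1 - u) *\<^sub>R complex_of_real (1 + c/2) + u *\<^sub>R z"
        using x by (auto simp: closed_segment_def)
      have cR: "Re (complex_of_real (1 + c/2)) = 1 + c/2" "Im (complex_of_real (1 + c/2)) = 0" by simp_all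
      have xR: "Im x = u * Im z" "Re x = (1 - u) * (1 + c/2) + u * Re z"
        unfolding u(3) plus_complex.sel scaleR_complex.sel cR by simp_all
      show "x \<in> A"
      proof (rule ccontr)
        assume "x \<notin> A"
        then have x1: "Im x = 0" "Re x \<le> 1" unfolding A_def by auto
        show False
        proof (cases "u = 0")
          case True then show False using x1 xR that by simp
        next
          case False
          then have "Im z = 0" using xR x1 by simp
          then have "z = of_real (Re z)" by (simp add: complex_eq_iff)
          then have "Re z > 1" using z unfolding A_def by (metis ComplD IntD1 atMost_iff image_eqI not_le)
          then have "(1 - u) * 1 + u * 1 < (1 - u) * (1 + c/2) + u * Re z"
            using False u that by (intro add_le_less_mono mult_left_mono mult_strict_left_mono) auto
          then show False using xR x1 by simp
        qed
      qed
    qed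
  qed
  obtain U where U: "boundary_copy \<Delta> (g k 1) U" "\<And>r. 0 < r \<Longrightarrow> \<exists>c>0. g k ` (A \<inter> ball 1 c) \<subseteq> U r"
  proof (rule ex_boundary_copy[of "g k 1" \<Delta> c0 A 1 "g k"])
    show "g k 1 \<in> \<Delta>" using arc_mem[OF k, of 1] by simp
    show "continuous_on (A \<inter> ball 1 c0) (g k)"
      using c0N by (intro continuous_on_subset[OF holomorphic_on_imp_continuous_on[OF holo_g[OF k]]]) auto
    show "(g k \<longlongrightarrow> g k 1) (at 1 within A)"
      using isCont_g[OF k 1] unfolding isCont_def by (rule tendsto_within_subset) auto
    show "A \<inter> ball 1 c \<noteq> {}" if "0 < c" for c using pt[OF that] by blast
    show "g k ` (A \<inter> ball 1 c0) \<subseteq> - \<Delta>" using Aoff c0(2) by blast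
  qed (use c0 A1 conn in auto)
  obtain r B where r: "0 < r" "\<And>z. z \<in> U r \<Longrightarrow> norm (F z) \<le> B"
    using bounded_on_copy[OF U(1) F] by blast
  obtain c1 where c1: "c1 > 0" "g k ` (A \<inter> ball 1 c1) \<subseteq> U r" using U(2)[OF r(1)] by blast
  define c where "c = min c1 c0"
  have c: "c > 0" "ball 1 c \<subseteq> N k" "ball (1::complex) c \<subseteq> ball 1 c1" "ball 1 c \<subseteq> sector (\<kappa> k)"
    using c0 c1 c0N by (auto simp: c_def)
  have "a k \<in> g k ` ball 1 c" using c(1) g_1[OF k] by (auto intro!: image_eqI[of _ _ 1])
  then obtain \<rho> where \<rho>: "0 < \<rho>" "ball (a k) \<rho> \<subseteq> g k ` ball 1 c"
    using openE[OF open_g_image[OF k open_ball c(2)]] by blast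
  show ?thesis
  proof (rule that[OF \<rho>(1)])
    fix z assume z: "z \<in> ball (a k) \<rho> - \<Delta>"
    then obtain \<zeta> where \<zeta>: "z = g k \<zeta>" "\<zeta> \<in> ball 1 c" using \<rho>(2) by blast
    have \<zeta>c: "\<zeta> \<in> sector (\<kappa> k)" using \<zeta>(2) c(4) by blast
    have "\<zeta> \<in> A"
    proof (rule ccontr)
      assume "\<zeta> \<notin> A"
      then have "\<zeta> \<in> complex_of_real ` {0<..1}" using \<zeta>c unfolding A_def sector_def by auto
      then show False using sector_\<Delta>[OF k \<zeta>c] z \<zeta>(1) by simp
    qed
    then have "z \<in> U r" using c1(2) \<zeta> c(3) by blast
    then show "norm (F z) \<le> B" by (rule r(2))
  qed
qed

end

section \<open>Removable singularities on the tripod\<close>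

lemma finite_uniform_radius:
  assumes "finite I" "\<And>p. p \<in> I \<Longrightarrow> \<exists>r>0. Q p r"
    and mono: "\<And>p r s. p \<in> I \<Longrightarrow> Q p r \<Longrightarrow> 0 < s \<Longrightarrow> s \<le> r \<Longrightarrow> Q p s"
  shows "\<exists>r>0::real. \<forall>p\<in>I. Q p r"
  using assms
proof (induction I)
  case empty then show ?case by (intro exI[of _ 1]) auto
next
  case (insert x I)
  obtain r where r: "r > 0" "\<forall>p\<in>I. Q p r" using insert.IH insert.prems by (metis insertI2)
  obtain s where s: "s > 0" "Q x s" using insert.prems(1)[of x] by auto
  have "Q p (min r s)" if p: "p \<in> insert x I" for p
  proof (cases "p = x")
    case True then show ?thesis using insert.prems(2)[OF p, of s "min r s"] s r(1) by simp
  next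
    case False then show ?thesis using insert.prems(2)[OF p, of r "min r s"] s r p by simp
  qed
  then show ?case using r(1) s(1) by (intro exI[of _ "min r s"]) simp
qed

lemma finite_removable_singularities:
  assumes "finite S" "H holomorphic_on (- S)" "\<And>s. s \<in> S \<Longrightarrow> ((\<lambda>z. (z - s) * H z) \<longlongrightarrow> 0) (at s)"
  shows "\<exists>G. G holomorphic_on UNIV \<and> (\<forall>z. z \<notin> S \<longrightarrow> G z = H z)"
  using assms
proof (induction S arbitrary: H)
  case empty then show ?case by auto
next
  case (insert s S)
  have op: "open (- S)" using insert.hyps(1) by (simp add: finite_imp_closed open_Compl)
  have "H holomorphic_on (- S - {s})" using insert.prems(1) by (simp add: Compl_insert)
  moreover have "s \<in> interior (- S)" using insert.hyps(2) op by (simp add: interior_open)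
  ultimately obtain G where G: "G holomorphic_on (- S)" "\<And>z. z \<in> - S - {s} \<Longrightarrow> G z = H z"
    using holomorphic_on_extend_lim[of H "- S" s] insert.prems(2)[of s] by auto
  have "((\<lambda>z. (z - t) * G z) \<longlongrightarrow> 0) (at t)" if t: "t \<in> S" for t
  proof (rule Lim_transform_eventually[OF insert.prems(2)[of t]])
    show "t \<in> insert s S" using t by simp
    have "open (- (insert s S - {t}))" using insert.hyps(1) by (intro open_Compl finite_imp_closed) auto
    then have "eventually (\<lambda>z. z \<in> - (insert s S - {t}) - {t}) (at t)"
      by (rule eventually_at_in_open) auto
    then show "\<forall>\<^sub>F z in at t. (z - t) * H z = (z - t) * G z"
      by eventually_elim (use G(2) in auto)
  qed
  then obtain G' where "G' holomorphic_on UNIV" "\<forall>z. z \<notin> S \<longrightarrow> G' z = G z"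
    using insert.IH[OF G(1)] by blast
  then show ?case using G(2) by (intro exI[of _ G']) auto
qed

context tripod_chart
begin

lemma \<Delta>_cases:
  assumes "x \<in> \<Delta>"
  obtains j where "j \<le> 3" "x = a j" | k s where "k \<in> {1..3}" "s \<in> {0<..<1}" "x = g k (complex_of_real s)"
proof -
  obtain k s where k: "k \<in> {1..3}" "s \<in> {0..1}" "x = g k (complex_of_real s)"
    using assms unfolding \<Delta>_eq by blast
  consider "s = 0" | "s = 1" | "s \<in> {0<..<1}" using k(2) by fastforce
  then show ?thesis
  proof cases
    case 1 then show ?thesis using that(1)[of 0] k(3) g_0[OF k(1)] by simp
  next
    case 2 then show ?thesis using that(1)[of k] k(1,3) g_1[OF k(1)] by simp
  next
    case 3 then show ?thesis using that(2) k by blast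
  qed
qed

text \<open>The chart is open, so every point off \<open>\<Delta>\<close> close to the arc point is
  the image of a point in one of the two half-planes; a common limit from these is a limit within
  \<open>- \<Delta>\<close>.\<close>

lemma sides_imp_at_within:
  assumes k: "k \<in> {1..3}" and s: "s \<in> {0<..<1}"
    and l: "\<And>\<sigma>. \<sigma> \<in> {1, -1} \<Longrightarrow> ((\<lambda>\<zeta>. P (g k \<zeta>)) \<longlongrightarrow> l) (at (complex_of_real s) within half \<sigma>)"
  shows "(P \<longlongrightarrow> l) (at (g k (complex_of_real s)) within - \<Delta>)"
proof (rule topological_tendstoI)
  fix S assume S: "open S" "l \<in> S"
  let ?s = "complex_of_real s"
  have "((\<lambda>\<zeta>. P (g k \<zeta>)) \<longlongrightarrow> l) (at ?s within (half 1 \<union> half (-1)))"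
    by (intro Lim_Un l) auto
  from topological_tendstoD[OF this S] obtain d where d: "d > 0"
    "\<forall>\<zeta>\<in>half 1 \<union> half (-1). \<zeta> \<noteq> ?s \<and> dist \<zeta> ?s < d \<longrightarrow> P (g k \<zeta>) \<in> S"
    unfolding eventually_at by blast
  obtain c where c: "0 < c" "ball ?s c \<subseteq> N k" "\<And>\<zeta>. \<zeta> \<in> ball ?s c \<Longrightarrow> g k \<zeta> \<in> \<Delta> \<longleftrightarrow> Im \<zeta> = 0"
    using interior_ball[OF k s] by metis
  let ?B = "ball ?s (min c d)"
  have sub: "?B \<subseteq> N k" using c(2) by auto
  have "g k ?s \<in> g k ` ?B" using c d by auto
  with open_g_image[OF k open_ball sub]
  have "eventually (\<lambda>z. z \<in> g k ` ?B) (at (g k ?s))" by (rule eventually_at_in_open')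
  then have "eventually (\<lambda>z. z \<in> g k ` ?B) (at (g k ?s) within - \<Delta>)"
    by (rule filter_leD[OF at_le[OF subset_UNIV]])
  moreover have "eventually (\<lambda>z. z \<in> - \<Delta>) (at (g k ?s) within - \<Delta>)"
    by (simp add: eventually_at_filter)
  ultimately show "eventually (\<lambda>z. P z \<in> S) (at (g k ?s) within - \<Delta>)"
  proof eventually_elim
    fix z assume z: "z \<in> g k ` ?B" "z \<in> - \<Delta>"
    then obtain \<zeta> where \<zeta>: "z = g k \<zeta>" "\<zeta> \<in> ?B" by blast
    then have "Im \<zeta> \<noteq> 0" using c(3)[of \<zeta>] z(2) by auto
    then have "\<zeta> \<in> half 1 \<union> half (-1)" "\<zeta> \<noteq> ?s" by (auto simp: half_def)
    then show "P z \<in> S" using d(2) \<zeta> by (auto simp: dist_commute)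
  qed
qed

lemma at_within_nontrivial:
  assumes "k \<in> {1..3}" "s \<in> {0<..<1}"
  shows "at (g k (complex_of_real s)) within - \<Delta> \<noteq> bot"
proof -
  obtain U where U: "boundary_copy \<Delta> (g k (complex_of_real s)) U"
    using side_copy[OF assms, of 1] by auto
  show ?thesis using copy_nhds_le_at_within[OF U] copy_nhds_neq_bot[OF U] by (metis bot.extremum_uniqueI)
qed

lemma arc_point_neq_branch_point:
  assumes "k \<in> {1..3}" "\<zeta> \<in> sector (\<kappa> k)" "Re \<zeta> < 1" "j \<le> 3"
  shows "g k \<zeta> \<noteq> a j"
proof
  assume "g k \<zeta> = a j"
  then have "g k \<zeta> = g k 1" using tip[OF assms(1,2,4)] g_1[OF assms(1)] by simp
  then have "\<zeta> = 1"
    by (rule inj_onD[OF inj_g[OF assms(1)]]) (use sector_N[OF assms(1)] assms of_real_sector[OF assms(1), of 1] in auto)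
  then show False using assms(3) by simp
qed

text \<open>Common side limits extend \<open>F\<close> continuously over the open arcs. In the chart
  the extension is holomorphic off the real line and continuous across it, so pasting across the
  line makes it holomorphic. Only then are \<open>a 0, \<dots>, a 3\<close> isolated singularities,
  and the assumption on the ends is Riemann's criterion for removing them.\<close>

theorem removable_tripod:
  assumes F: "F holomorphic_on - \<Delta>"
    and sides: "\<And>k s. k \<in> {1..3} \<Longrightarrow> s \<in> {0<..<1} \<Longrightarrow>
       \<exists>l. \<forall>\<sigma>\<in>{1, -1}. ((\<lambda>\<zeta>. F (g k \<zeta>)) \<longlongrightarrow> l) (at (complex_of_real s) within half \<sigma>)"
    and ends: "\<And>j. j \<le> 3 \<Longrightarrow> ((\<lambda>z. (z - a j) * F z) \<longlongrightarrow> 0) (at (a j) within - \<Delta>)"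
  shows "\<exists>G. G holomorphic_on UNIV \<and> (\<forall>z. z \<notin> \<Delta> \<longrightarrow> G z = F z)"
proof -
  \<comment> \<open>At the four branch points \<open>Lim\<close> may return a default value; these
    points are left out of \<open>?D\<close> and treated at the end as isolated
    singularities.\<close>
  define H where "H z = (if z \<in> \<Delta> then Lim (at z within - \<Delta>) F else F z)" for z
  let ?D = "- a ` {..3}"
  have opD: "open ?D" by (intro open_Compl finite_imp_closed) auto
  have op: "open (- \<Delta>)" using closed_\<Delta> by auto
  have contF: "isCont F x" if "x \<notin> \<Delta>" for x
    by (rule continuous_on_interior[OF holomorphic_on_imp_continuous_on[OF F]]) (use that op in \<open>simp add: interior_open\<close>)
  have lim: "(F \<longlongrightarrow> H x) (at x within - \<Delta>) \<and> at x within - \<Delta> \<noteq> bot" if x: "x \<in> ?D" for x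
  proof (cases "x \<in> \<Delta>")
    case False
    then have "at x within - \<Delta> = at x" using at_within_open[OF _ op] by simp
    then show ?thesis using contF[OF False] False by (simp add: H_def isCont_def)
  next
    case True
    then obtain k s where ks: "k \<in> {1..3}" "s \<in> {0<..<1}" "x = g k (complex_of_real s)"
      using x by (elim \<Delta>_cases) auto
    obtain l where "\<forall>\<sigma>\<in>{1, -1}. ((\<lambda>\<zeta>. F (g k \<zeta>)) \<longlongrightarrow> l) (at (complex_of_real s) within half \<sigma>)"
      using sides[OF ks(1,2)] by blast
    then have l: "(F \<longlongrightarrow> l) (at x within - \<Delta>)"
      unfolding ks(3) by (intro sides_imp_at_within[OF ks(1,2)]) blast
    have nb: "at x within - \<Delta> \<noteq> bot" unfolding ks(3) by (rule at_within_nontrivial[OF ks(1,2)])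
    have "H x = l" unfolding H_def using True tendsto_Lim[OF nb l] by simp
    then show ?thesis using l nb by simp
  qed
  \<comment> \<open>A closed condition that \<open>F\<close> satisfies off \<open>\<Delta>\<close>
    passes in the limit to \<open>H\<close> at arc points. The two forms of \<open>P'\<close> serve
    the continuity of \<open>H\<close> and the smallness of \<open>(z - b) * H z\<close> at a branch
    point \<open>b\<close>.\<close>
  have transfer: "P' (H y) y \<in> C" if y: "y \<in> ball x d" "y \<in> ?D" and C: "closed C" "\<And>z. z \<in> ball x d - \<Delta> \<Longrightarrow> z \<noteq> y \<Longrightarrow> P' (F z) z \<in> C"
     and P': "P' = (\<lambda>u z. (z - b) * u) \<or> P' = (\<lambda>u z. u)"
    for x y d b C and P' :: "complex \<Rightarrow> complex \<Rightarrow> complex"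
  proof (rule Lim_in_closed_set[OF C(1)])
    show "((\<lambda>z. P' (F z) z) \<longlongrightarrow> P' (H y) y) (at y within - \<Delta>)"
      using P' lim[OF y(2)] by (elim disjE) (auto intro!: tendsto_intros)
    show "at y within - \<Delta> \<noteq> bot" using lim[OF y(2)] by blast
    have "eventually (\<lambda>z. z \<in> ball x d - {y}) (at y within - \<Delta>)"
      by (rule filter_leD[OF at_le[OF subset_UNIV]], rule eventually_at_in_open) (use y in auto)
    moreover have "eventually (\<lambda>z. z \<in> - \<Delta>) (at y within - \<Delta>)"
      by (simp add: eventually_at_filter)
    ultimately show "\<forall>\<^sub>F z in at y within - \<Delta>. P' (F z) z \<in> C"
      by eventually_elim (use C(2) in auto)
  qed
  have contH: "isCont H x" if x: "x \<in> ?D" for x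
    unfolding isCont_def
  proof (rule tendstoI)
    fix e :: real assume e: "0 < e"
    have "eventually (\<lambda>z. dist (F z) (H x) < e/2) (at x within - \<Delta>)"
      using lim[OF x] e by (intro tendstoD[of F]) auto
    then obtain d where d: "d > 0" "\<forall>z\<in>- \<Delta>. z \<noteq> x \<and> dist z x < d \<longrightarrow> dist (F z) (H x) < e/2"
      unfolding eventually_at by blast
    obtain d' where d': "d' > 0" "ball x d' \<subseteq> ?D" using openE[OF opD x] by blast
    have "dist (H y) (H x) < e" if y: "y \<in> ball x (min d d')" for y
    proof -
      \<comment> \<open>Passing to the limit only preserves a weak inequality, hence the margin
        between \<open>e/2\<close> and \<open>e\<close>.\<close>
      have "(\<lambda>u z. u) (H y) y \<in> cball (H x) (e/2)"
      proof (rule transfer[of y x d])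
        fix z assume "z \<in> ball x d - \<Delta>" "z \<noteq> y"
        then show "F z \<in> cball (H x) (e/2)"
          using d(2) e by (cases "z = x") (auto simp: dist_commute H_def less_imp_le)
      qed (use y d' in auto)
      then show ?thesis using e by (simp add: dist_commute)
    qed
    then show "\<forall>\<^sub>F y in at x. dist (H y) (H x) < e"
      unfolding eventually_at using d(1) d'(1) by (intro exI[of _ "min d d'"]) (auto simp: dist_commute)
  qed
  have holH: "H holomorphic_on ?D"
  proof -
    have "H analytic_on {x}" if x: "x \<in> ?D" for x
    proof (cases "x \<in> \<Delta>")
      case False
      have "H holomorphic_on - \<Delta>"
        using holomorphic_transform[OF F] by (metis ComplD H_def)
      then show ?thesis using False op unfolding analytic_at by blast
    next
      case True
      then obtain k s where ks: "k \<in> {1..3}" "s \<in> {0<..<1}" "x = g k (complex_of_real s)"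
        using x by (elim \<Delta>_cases) auto
      let ?s = "complex_of_real s"
      obtain c where c: "0 < c" "ball ?s c \<subseteq> sector (\<kappa> k)" "ball ?s c \<subseteq> N k"
          "\<And>\<zeta>. \<zeta> \<in> ball ?s c \<Longrightarrow> Re \<zeta> < 1"
          "\<And>\<zeta>. \<zeta> \<in> ball ?s c \<Longrightarrow> g k \<zeta> \<in> \<Delta> \<longleftrightarrow> Im \<zeta> = 0"
        using interior_ball[OF ks(1,2)] by metis
      let ?B = "ball ?s c"
      have gD: "g k \<zeta> \<in> ?D" if "\<zeta> \<in> ?B" for \<zeta>
        using arc_point_neq_branch_point[OF ks(1) subsetD[OF c(2) that] c(4)[OF that]] by auto
      have holg: "g k holomorphic_on T" if "T \<subseteq> ?B" for T
        using holomorphic_on_subset[OF holo_g[OF ks(1)]] that c(3) by blast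
      have part: "(\<lambda>\<zeta>. H (g k \<zeta>)) holomorphic_on T" if T: "T \<subseteq> ?B" "\<And>\<zeta>. \<zeta> \<in> T \<Longrightarrow> Im \<zeta> \<noteq> 0" for T
      proof -
        have off: "g k \<zeta> \<notin> \<Delta>" if "\<zeta> \<in> T" for \<zeta> using T c(5) that by blast
        have "(F \<circ> g k) holomorphic_on T"
          by (rule holomorphic_on_compose_gen[OF holg[OF T(1)] F]) (use off in auto)
        then show ?thesis
          by (rule holomorphic_transform) (use off in \<open>simp add: H_def\<close>)
      qed
      \<comment> \<open>The inner product with \<open>\<i>\<close> is the imaginary part, so the
        line of pasting is the real axis, the straightened arc.\<close>
      have Hg: "(\<lambda>\<zeta>. H (g k \<zeta>)) holomorphic_on ?B"
      proof (rule holomorphic_on_paste_across_line[of ?B \<i> _ 0])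
        show "continuous_on ?B (\<lambda>\<zeta>. H (g k \<zeta>))"
        proof (rule continuous_on_compose2[of ?D H])
          show "continuous_on ?D H" by (rule continuous_at_imp_continuous_on) (use contH in blast)
          show "continuous_on ?B (g k)" by (rule holomorphic_on_imp_continuous_on[OF holg]) simp
          show "g k ` ?B \<subseteq> ?D" using gD by (rule image_subsetI)
        qed
        show "(\<lambda>\<zeta>. H (g k \<zeta>)) holomorphic_on ?B \<inter> {z. \<i> \<bullet> z < 0}"
          by (rule part) (auto simp: inner_complex_def)
        show "(\<lambda>\<zeta>. H (g k \<zeta>)) holomorphic_on ?B \<inter> {z. 0 < \<i> \<bullet> z}"
          by (rule part) (auto simp: inner_complex_def)
      qed auto
      have injB: "inj_on (g k) ?B" by (rule inj_on_subset[OF inj_g[OF ks(1)] c(3)])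
      obtain h where h: "h holomorphic_on g k ` ?B" "\<And>z. z \<in> ?B \<Longrightarrow> h (g k z) = z"
        using holomorphic_has_inverse[OF holg[OF order_refl] open_ball injB] by metis
      have "((\<lambda>\<zeta>. H (g k \<zeta>)) \<circ> h) holomorphic_on g k ` ?B"
        by (rule holomorphic_on_compose_gen[OF h(1) Hg]) (use h(2) in auto)
      then have "H holomorphic_on g k ` ?B"
        by (rule holomorphic_transform) (use h(2) in auto)
      moreover have "x \<in> g k ` ?B" using c(1) ks(3) by auto
      ultimately show ?thesis using open_g_image[OF ks(1) open_ball c(3)] unfolding analytic_at by blast
    qed
    then have "H analytic_on ?D" using analytic_on_analytic_at by blast
    then show ?thesis by (rule analytic_imp_holomorphic)
  qed
  have "((\<lambda>z. (z - b) * H z) \<longlongrightarrow> 0) (at b)" if b: "b \<in> a ` {..3}" for b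
  proof (rule tendstoI)
    fix e :: real assume e: "0 < e"
    have "((\<lambda>z. (z - b) * F z) \<longlongrightarrow> 0) (at b within - \<Delta>)" using b ends by auto
    then have "eventually (\<lambda>z. dist ((z - b) * F z) 0 < e/2) (at b within - \<Delta>)"
      by (rule tendstoD) (use e in simp)
    then obtain d where d: "d > 0" "\<forall>z\<in>- \<Delta>. z \<noteq> b \<and> dist z b < d \<longrightarrow> dist ((z - b) * F z) 0 < e/2"
      unfolding eventually_at by blast
    have "open (- (a ` {..3} - {b}))" by (intro open_Compl finite_imp_closed) auto
    then obtain d' where d': "d' > 0" "ball b d' \<subseteq> - (a ` {..3} - {b})" using openE[of _ b] by blast
    have "dist ((y - b) * H y) 0 < e" if y: "y \<in> ball b (min d d')" "y \<noteq> b" for y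
    proof -
      have "y \<in> ball b d'" using y by simp
      then have yD: "y \<in> ?D" using d'(2) y(2) by blast
      have "(\<lambda>u z. (z - b) * u) (H y) y \<in> cball 0 (e/2)"
      proof (rule transfer[of y b d, OF _ yD])
        fix z assume z: "z \<in> ball b d - \<Delta>" "z \<noteq> y"
        show "(z - b) * F z \<in> cball 0 (e/2)"
          using d(2) e z by (cases "z = b") (auto simp: dist_commute less_imp_le)
      qed (use y in auto)
      then show ?thesis using e by (simp add: dist_commute)
    qed
    then show "\<forall>\<^sub>F y in at b. dist ((y - b) * H y) 0 < e"
      unfolding eventually_at using d(1) d'(1) by (intro exI[of _ "min d d'"]) (auto simp: dist_commute)
  qed
  then obtain G where G: "G holomorphic_on UNIV" "\<forall>z. z \<notin> a ` {..3} \<longrightarrow> G z = H z"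
    using finite_removable_singularities[OF _ holH] by blast
  have "G z = F z" if "z \<notin> \<Delta>" for z
  proof -
    have "z \<notin> a ` {..3}" using that a_mem by auto
    then show ?thesis using that G(2) by (simp add: H_def)
  qed
  then show ?thesis using G(1) by blast
qed

text \<open>
  Each component of a punctured slit disc about \<open>a 0\<close> has a point of an open arc in its frontier,
  so it is one of the six boundary copies that start in the two halves of the three sectors.
\<close>

lemma bounded_near_center:
  assumes F: "continuous_traces \<Delta> F"
  obtains B \<rho> where "0 < \<rho>" "\<And>z. z \<in> ball (a 0) \<rho> - \<Delta> \<Longrightarrow> norm (F z) \<le> B"
proof -
  \<comment> \<open>An index is an arc together with one of its sides: six half-sectors, two of
    which may belong to the same copy of \<open>a 0\<close>.\<close>
  define I where "I = {1..3::nat} \<times> {1, -1::real}"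
  define A where "A p = sector (\<kappa> (fst p)) \<inter> half (snd p)" for p
  have finI: "finite I" by (simp add: I_def)
  have IE: "fst p \<in> {1..3}" "snd p \<in> {1, -1}" if "p \<in> I" for p using that unfolding I_def by auto
  have z0: "0 \<in> N k" if "k \<in> {1..3}" for k using segment_N[OF that] by (force intro: image_eqI[of _ _ 0])
  have "\<exists>U. boundary_copy \<Delta> (a 0) U \<and> (\<forall>r>0. \<exists>c>0. g (fst p) ` (A p \<inter> ball 0 c) \<subseteq> U r)" if p: "p \<in> I" for p
  proof -
    note k = IE(1)[OF p] and \<sigma> = IE(2)[OF p]
    let ?k = "fst p"
    have AN: "A p \<subseteq> N ?k" using sector_N[OF k] unfolding A_def by blast
    obtain U where U: "boundary_copy \<Delta> (a 0) U" "\<And>r. 0 < r \<Longrightarrow> \<exists>c>0. g ?k ` (A p \<inter> ball 0 c) \<subseteq> U r"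
    proof (rule ex_boundary_copy[of "a 0" \<Delta> 1 "A p" 0 "g ?k"])
      show "a 0 \<in> \<Delta>" by (rule a_mem) simp
      show "connected (A p \<inter> ball 0 c)" for c
        unfolding A_def by (intro convex_connected convex_Int convex_sector convex_half convex_ball)
      show "continuous_on (A p \<inter> ball 0 1) (g ?k)"
        by (rule continuous_on_subset[OF holomorphic_on_imp_continuous_on[OF holo_g[OF k]]]) (use AN in blast)
      show "(g ?k \<longlongrightarrow> a 0) (at 0 within A p)"
        using isCont_g[OF k z0[OF k]] g_0[OF k] unfolding isCont_def
        by (simp add: tendsto_within_subset[OF _ subset_UNIV])
      show "0 \<notin> A p" by (simp add: A_def half_def)
      show "g ?k ` (A p \<inter> ball 0 1) \<subseteq> - \<Delta>"
      proof (rule image_subsetI)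
        fix \<zeta> assume "\<zeta> \<in> A p \<inter> ball 0 1"
        then have "\<zeta> \<in> sector (\<kappa> ?k)" "Im \<zeta> \<noteq> 0" unfolding A_def half_def by auto
        then show "g ?k \<zeta> \<in> - \<Delta>" using off_real_sector[OF k] by blast
      qed
      fix c :: real assume c: "0 < c" "c \<le> 1"
      \<comment> \<open>A slope below \<open>\<kappa>\<close> keeps the witness
        \<open>c/2 \<plusminus> \<i> \<tau> c/2\<close> in the sector, and a slope below
        \<open>1\<close> keeps its norm below \<open>c\<close>.\<close>
      define \<tau> where "\<tau> = min (\<kappa> ?k) 1 / 2"
      have \<tau>: "0 < \<tau>" "\<tau> < \<kappa> ?k" "\<tau> < 1" using \<kappa>_pos[OF k] by (auto simp: \<tau>_def min_def)
      let ?z = "Complex (c/2) (snd p * (\<tau> * (c/2)))"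
      have "norm ?z \<le> \<bar>c/2\<bar> + \<bar>snd p * (\<tau> * (c/2))\<bar>" using cmod_le[of ?z] by simp
      also have "\<dots> = c/2 + \<tau> * (c/2)" using \<sigma> c(1) \<tau>(1) by auto
      also have "\<dots> < c/2 + 1 * (c/2)" using c(1) \<tau>(3) by (intro add_strict_left_mono mult_strict_right_mono) auto
      finally have "norm ?z < c" by simp
      moreover have "\<bar>snd p * (\<tau> * (c/2))\<bar> < \<kappa> ?k * (c/2)" using \<sigma> c(1) \<tau> by (auto simp: abs_mult)
      then have "?z \<in> sector (\<kappa> ?k)" using c \<kappa>_pos[OF k] by (simp add: sector_def)
      moreover have "?z \<in> half (snd p)" using \<sigma> c(1) \<tau>(1) by (auto simp: half_def)
      ultimately have "?z \<in> A p \<inter> ball 0 c" unfolding A_def by (simp add: dist_norm)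
      then show "A p \<inter> ball 0 c \<noteq> {}" by blast
    qed auto
    then show ?thesis by blast
  qed
  then obtain U where U: "\<And>p. p \<in> I \<Longrightarrow> boundary_copy \<Delta> (a 0) (U p)"
      "\<And>p r. p \<in> I \<Longrightarrow> 0 < r \<Longrightarrow> \<exists>c>0. g (fst p) ` (A p \<inter> ball 0 c) \<subseteq> U p r"
    by metis
  have "\<exists>r>0. \<forall>p\<in>I. \<exists>B. \<forall>z\<in>U p r. norm (F z) \<le> B"
  proof (rule finite_uniform_radius[OF finI])
    fix p assume p: "p \<in> I"
    obtain r B where "0 < r" "\<And>z. z \<in> U p r \<Longrightarrow> norm (F z) \<le> B" using bounded_on_copy[OF U(1)[OF p] F] by blast
    then show "\<exists>r>0. \<exists>B. \<forall>z\<in>U p r. norm (F z) \<le> B" by blast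
  next
    fix p and r s :: real assume p: "p \<in> I" "\<exists>B. \<forall>z\<in>U p r. norm (F z) \<le> B" "0 < s" "s \<le> r"
    then show "\<exists>B. \<forall>z\<in>U p s. norm (F z) \<le> B" using boundary_copyD(6)[OF U(1)[OF p(1)] p(3,4)] by blast
  qed
  then obtain r where r: "r > 0" "\<forall>p\<in>I. \<exists>B. \<forall>z\<in>U p r. norm (F z) \<le> B" by blast
  then obtain Bf where Bf: "\<forall>p\<in>I. \<forall>z\<in>U p r. norm (F z) \<le> Bf p" by (elim bchoice[THEN exE])
  have "\<exists>c>0. \<forall>p\<in>I. g (fst p) ` (A p \<inter> ball 0 c) \<subseteq> U p r"
  proof (rule finite_uniform_radius[OF finI])
    show "\<exists>c>0. g (fst p) ` (A p \<inter> ball 0 c) \<subseteq> U p r" if "p \<in> I" for p by (rule U(2)[OF that r(1)])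
    show "g (fst p) ` (A p \<inter> ball 0 s) \<subseteq> U p r" if "g (fst p) ` (A p \<inter> ball 0 c) \<subseteq> U p r" "s \<le> c" for p c s
    proof -
      have "ball (0::complex) s \<subseteq> ball 0 c" using that(2) by auto
      then show ?thesis using that(1) by blast
    qed
  qed
  then obtain c0 where c0: "c0 > 0" "\<And>p. p \<in> I \<Longrightarrow> g (fst p) ` (A p \<inter> ball 0 c0) \<subseteq> U p r" by blast
  \<comment> \<open>The bound by \<open>1\<close> makes the real points of a sector in
    \<open>ball 0 c\<close> points of the arc, not points beyond its tip.\<close>
  define c where "c = min c0 1"
  have c1: "c > 0" "c \<le> 1" "ball (0::complex) c \<subseteq> ball 0 c0" using c0(1) by (auto simp: c_def)
  then have c: "c > 0" "\<And>p. p \<in> I \<Longrightarrow> g (fst p) ` (A p \<inter> ball 0 c) \<subseteq> U p r" using c0(2) by blast+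
  \<comment> \<open>The parts of the arcs at parameter distance at least \<open>c\<close> from the
    centre. A disc about \<open>a 0\<close> that avoids them meets the arcs only at parameters that
    the half-sectors of radius \<open>c\<close> accompany.\<close>
  define K where "K = (\<Union>k\<in>{1..3}. g k ` complex_of_real ` ({0..1} \<inter> {c..}))"
  have "closed K" unfolding K_def
    by (intro compact_imp_closed compact_UN compact_arc) auto
  moreover have "a 0 \<notin> K"
  proof
    assume "a 0 \<in> K"
    then obtain k s where ks: "k \<in> {1..3}" "s \<in> {0..1} \<inter> {c..}" "a 0 = g k (complex_of_real s)" unfolding K_def by blast
    have "g k 0 = g k (complex_of_real s)" using ks g_0 by simp
    then have "0 = complex_of_real s"
      by (rule inj_onD[OF inj_g[OF ks(1)] _ z0[OF ks(1)]]) (use segment_N[OF ks(1)] ks(2) in auto)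
    then show False using ks(2) c(1) by simp
  qed
  ultimately obtain \<rho>1 where \<rho>1: "0 < \<rho>1" "ball (a 0) \<rho>1 \<subseteq> - K"
    using openE[of "- K" "a 0"] by auto
  define \<rho> where "\<rho> = min \<rho>1 r"
  have \<rho>: "0 < \<rho>" "ball (a 0) \<rho> \<subseteq> - K" "ball (a 0) \<rho> \<subseteq> ball (a 0) r" using \<rho>1 r(1) by (auto simp: \<rho>_def)
  show ?thesis
  proof (rule that[OF \<rho>(1)])
    fix z assume z: "z \<in> ball (a 0) \<rho> - \<Delta>"
    let ?V = "ball (a 0) r - \<Delta>"
    define C where "C = connected_component_set ?V z"
    have opV: "open ?V" using closed_\<Delta> by (simp add: open_Diff)
    have zV: "z \<in> ?V" using z \<rho>(3) by blast
    have C: "C \<in> components ?V" "z \<in> C" "open C" "C \<subseteq> ?V"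
      unfolding C_def using zV opV
      by (auto simp: componentsI open_connected_component connected_component_subset connected_component_refl)
    \<comment> \<open>The punctured disc is connected, it meets \<open>C\<close>, and it is not
      contained in \<open>C\<close> because the first arc enters it; so it contains a frontier point
      of \<open>C\<close>, which must lie on an open arc.\<close>
    let ?O = "ball (a 0) \<rho> - {a 0}"
    have "connected ?O" by (rule connected_punctured_convex) (use \<rho>(1) in \<open>simp_all add: aff_dim_open\<close>)
    moreover have "?O \<inter> C \<noteq> {}" using z C(2) a_mem[of 0] by auto
    moreover have "?O - C \<noteq> {}"
    proof -
      have lim: "(g 1 \<longlongrightarrow> a 0) (at 0)" using isCont_g[of 1 0] z0[of 1] g_0[of 1] unfolding isCont_def by simp
      have "(complex_of_real \<longlongrightarrow> 0) (at_right 0)" using tendsto_of_real[OF tendsto_ident_at, of 0 "{0<..}"] by simp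
      then have f: "filterlim complex_of_real (at 0) (at_right 0)"
        unfolding filterlim_at by (auto simp: eventually_at_filter)
      have "((\<lambda>u. g 1 (complex_of_real u)) \<longlongrightarrow> a 0) (at_right 0)" by (rule filterlim_compose[OF lim f])
      then have "eventually (\<lambda>u. g 1 (complex_of_real u) \<in> ball (a 0) \<rho>) (at_right 0)"
        by (rule topological_tendstoD) (use \<rho>(1) in auto)
      moreover have "eventually (\<lambda>u::real. 0 < u \<and> u < 1) (at_right 0)"
        using eventually_at_right_real[of 0 1] by simp
      ultimately have "eventually (\<lambda>u. g 1 (complex_of_real u) \<in> ball (a 0) \<rho> \<and> 0 < u \<and> u < 1) (at_right 0)"
        by eventually_elim simp
      then have "\<exists>u. g 1 (complex_of_real u) \<in> ball (a 0) \<rho> \<and> 0 < u \<and> u < 1"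
        by (rule eventually_happens'[OF trivial_limit_at_right_real])
      then obtain u where u: "g 1 (complex_of_real u) \<in> ball (a 0) \<rho>" "0 < u" "u < 1"
        by (elim exE conjE)
      have "g 1 (complex_of_real u) \<noteq> a 0"
        by (rule arc_point_neq_branch_point) (use u of_real_sector[of 1 u] in auto)
      moreover have "g 1 (complex_of_real u) \<in> \<Delta>" by (rule arc_mem) (use u in auto)
      ultimately show ?thesis using u(1) C(4) by blast
    qed
    ultimately obtain x where x: "x \<in> ?O" "x \<in> frontier C" using connected_Int_frontier by blast
    have xC: "x \<in> closure C" "x \<notin> C" using x(2) C(3) by (auto simp: frontier_def interior_open)
    have "x \<in> \<Delta>"
    proof (rule ccontr)
      assume "x \<notin> \<Delta>"
      then have xV: "x \<in> ?V" using x(1) \<rho>(3) by blast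
      let ?C' = "connected_component_set ?V x"
      have "open ?C'" "x \<in> ?C'" "?C' \<in> components ?V"
        using xV opV by (auto simp: componentsI open_connected_component connected_component_refl)
      moreover then have "?C' \<inter> C \<noteq> {}" using xC(1) open_Int_closure_eq_empty[of ?C' C] by blast
      ultimately have "?C' = C" using components_eq[OF _ C(1), of ?C'] by blast
      then show False using xC(2) \<open>x \<in> ?C'\<close> by blast
    qed
    then obtain k u where ku: "k \<in> {1..3}" "u \<in> {0..1}" "x = g k (complex_of_real u)" unfolding \<Delta>_eq by blast
    have "x \<notin> K" using x(1) \<rho>(2) by blast
    then have "u < c" using ku unfolding K_def by force
    moreover have "u \<noteq> 0" using x(1) ku(3) g_0[OF ku(1)] by auto
    ultimately have u: "0 < u" "u \<le> 1" "u < c" using ku(2) by auto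
    \<comment> \<open>The chart image of \<open>?T\<close> is an open neighbourhood of the frontier
      point, so it meets \<open>C\<close>. The point of intersection lies in one of the
      half-sectors, hence in some \<open>U p r\<close>, and two components with a common point
      coincide.\<close>
    let ?T = "sector (\<kappa> k) \<inter> ball 0 c"
    have uT: "complex_of_real u \<in> ?T" using of_real_sector[OF ku(1), of u] u by simp
    have "?T \<subseteq> N k" using sector_N[OF ku(1)] by blast
    then have "open (g k ` ?T)" by (intro open_g_image[OF ku(1)] open_Int open_sector open_ball)
    moreover have "x \<in> g k ` ?T" using uT ku(3) by blast
    ultimately obtain y where y: "y \<in> g k ` ?T" "y \<in> C"
      using xC(1) open_Int_closure_eq_empty[of "g k ` ?T" C] by blast
    then obtain \<zeta> where \<zeta>: "y = g k \<zeta>" "\<zeta> \<in> ?T" by blast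
    have "y \<notin> \<Delta>" using y(2) C(4) by blast
    have "Im \<zeta> \<noteq> 0"
    proof
      assume "Im \<zeta> = 0"
      then have "\<zeta> = of_real (Re \<zeta>)" by (simp add: complex_eq_iff)
      moreover have "Re \<zeta> \<le> 1" using \<zeta>(2) c1(2) complex_Re_le_cmod[of \<zeta>] by simp
      moreover have "0 < Re \<zeta>" using \<zeta>(2) by (simp add: sector_def)
      ultimately have "\<zeta> \<in> complex_of_real ` {0<..1}" by (intro image_eqI[of _ _ "Re \<zeta>"]) auto
      then show False using sector_\<Delta>[OF ku(1), of \<zeta>] \<zeta> \<open>y \<notin> \<Delta>\<close> by blast
    qed
    define p where "p = (k, sgn (Im \<zeta>))"
    have p: "p \<in> I" using ku(1) \<open>Im \<zeta> \<noteq> 0\<close> unfolding I_def p_def by (auto simp: sgn_if)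
    have "\<zeta> \<in> A p \<inter> ball 0 c" using \<zeta>(2) \<open>Im \<zeta> \<noteq> 0\<close> unfolding A_def p_def half_def by (auto simp: sgn_if)
    then have "y \<in> U p r" using c(2)[OF p] \<zeta>(1) unfolding p_def by auto
    then have "C = U p r" using components_eq[OF C(1) boundary_copyD(2)[OF U(1)[OF p] r(1)]] y(2) by blast
    then have "norm (F z) \<le> Bf p" using Bf p C(2) by blast
    also have "\<dots> \<le> Max (Bf ` I)" using finI p by (intro Max_ge) auto
    finally show "norm (F z) \<le> Max (Bf ` I)" .
  qed
qed

end

section \<open>Cauchy integrals along a straightened arc\<close>

lemma cauchy_kernel_integrable:
  fixes D \<gamma> :: "real \<Rightarrow> complex"
  assumes D: "D absolutely_integrable_on {\<alpha>..\<beta>}" and cont: "continuous_on {\<alpha>..\<beta>} \<gamma>" and z: "z \<notin> \<gamma> ` {\<alpha>..\<beta>}"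
  shows "(\<lambda>u. D u / (\<gamma> u - z)) absolutely_integrable_on {\<alpha>..\<beta>}"
proof -
  have c: "continuous_on {\<alpha>..\<beta>} (\<lambda>u. 1 / (\<gamma> u - z))" using z by (intro continuous_intros cont) auto
  have "(\<lambda>u. (1 / (\<gamma> u - z)) * D u) absolutely_integrable_on {\<alpha>..\<beta>}"
  proof (rule absolutely_integrable_bounded_measurable_product[where h = "\<lambda>x y. x * y" and f = "\<lambda>u. 1 / (\<gamma> u - z)", OF _ _ _ _ D])
    show "bilinear (\<lambda>x y :: complex. x * y)" by (simp add: bilinear_conv_bounded_bilinear bounded_bilinear_mult)
    show "(\<lambda>u. 1 / (\<gamma> u - z)) \<in> borel_measurable (lebesgue_on {\<alpha>..\<beta>})"
      by (rule continuous_imp_measurable_on_sets_lebesgue[OF c]) simp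
    show "bounded ((\<lambda>u. 1 / (\<gamma> u - z)) ` {\<alpha>..\<beta>})"
      by (intro compact_imp_bounded compact_continuous_image c) simp
  qed simp
  then show ?thesis by simp
qed

text \<open>The densities to come blow up at the ends of the arcs, so \<open>D\<close> is only taken
  absolutely integrable and the difference quotient is estimated by hand. After subtraction of the
  expected derivative, the integrand is
  \<open>D * (z - z0) / ((\<gamma> - z) * (\<gamma> - z0)^2)\<close>.\<close>

lemma cauchy_integral_holomorphic:
  fixes D \<gamma> :: "real \<Rightarrow> complex"
  assumes D: "D absolutely_integrable_on {\<alpha>..\<beta>}" and cont: "continuous_on {\<alpha>..\<beta>} \<gamma>"
  shows "(\<lambda>z. integral {\<alpha>..\<beta>} (\<lambda>u. D u / (\<gamma> u - z))) holomorphic_on - (\<gamma> ` {\<alpha>..\<beta>})"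
proof -
  let ?T = "{\<alpha>..\<beta>}"
  let ?F = "\<lambda>z. integral ?T (\<lambda>u. D u / (\<gamma> u - z))"
  have comp: "compact (\<gamma> ` ?T)" by (intro compact_continuous_image cont) simp
  then have op: "open (- (\<gamma> ` ?T))" using compact_imp_closed by auto
  have int: "(\<lambda>u. D u / (\<gamma> u - z)) integrable_on ?T" if "z \<notin> \<gamma> ` ?T" for z
    using cauchy_kernel_integrable[OF D cont that] by (rule set_lebesgue_integral_eq_integral(1))
  have nD: "(\<lambda>u. norm (D u)) integrable_on ?T" using D by (simp add: absolutely_integrable_on_def)
  show ?thesis
    unfolding holomorphic_on_open[OF op]
  proof (intro ballI)
    fix z0 assume z0: "z0 \<in> - (\<gamma> ` ?T)"
    obtain d where d: "d > 0" "ball z0 d \<subseteq> - (\<gamma> ` ?T)" using openE[OF op z0] by blast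
    have low: "norm (\<gamma> u - z) \<ge> d/2" if "u \<in> ?T" "z \<in> ball z0 (d/2)" for u z
    proof (rule ccontr)
      assume "\<not> ?thesis"
      then have "dist z0 (\<gamma> u) < d" using that(2) dist_triangle[of z0 "\<gamma> u" z]
        by (simp add: dist_norm norm_minus_commute)
      then show False using d(2) that(1) by auto
    qed
    have "(\<lambda>u. (D u / (\<gamma> u - z0)) / (\<gamma> u - z0)) integrable_on ?T"
      using cauchy_kernel_integrable[OF cauchy_kernel_integrable[OF D cont] cont, of z0 z0] z0
      by (intro set_lebesgue_integral_eq_integral(1)) auto
    then have intL: "(\<lambda>u. D u / (\<gamma> u - z0)^2) integrable_on ?T" by (simp add: power2_eq_square)
    \<comment> \<open>Each of the three distances in the denominator is at least \<open>d/2\<close>,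
      whence the constant \<open>8 / d^3\<close>.\<close>
    let ?L = "integral ?T (\<lambda>u. D u / (\<gamma> u - z0)^2)" and ?I = "integral ?T (\<lambda>u. norm (D u))"
    have bound: "norm ((?F z - ?F z0) / (z - z0) - ?L) \<le> norm (z - z0) * (8 / d^3 * ?I)"
      if z: "z \<in> ball z0 (d/2)" "z \<noteq> z0" for z
    proof -
      have "z \<in> ball z0 d" using z(1) d(1) by auto
      then have zT: "z \<notin> \<gamma> ` ?T" "z0 \<notin> \<gamma> ` ?T" using d(2) z0 by blast+
      have *: "\<gamma> u - z \<noteq> 0" "\<gamma> u - z0 \<noteq> 0" if "u \<in> ?T" for u using zT that by auto
      have i1: "(\<lambda>u. (D u / (\<gamma> u - z) - D u / (\<gamma> u - z0)) / (z - z0)) integrable_on ?T"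
        using integrable_on_mult_right[OF integrable_diff[OF int[OF zT(1)] int[OF zT(2)]], of "1 / (z - z0)"]
        by (simp add: field_simps)
      have "(?F z - ?F z0) / (z - z0) - ?L
         = integral ?T (\<lambda>u. (D u / (\<gamma> u - z) - D u / (\<gamma> u - z0)) / (z - z0) - D u / (\<gamma> u - z0)^2)"
        using i1 intL int zT by (simp add: integral_diff)
      also have "norm \<dots> \<le> integral ?T (\<lambda>u. norm (z - z0) * (8 / d^3) * norm (D u))"
      proof (rule integral_norm_bound_integral)
        show "(\<lambda>u. (D u / (\<gamma> u - z) - D u / (\<gamma> u - z0)) / (z - z0) - D u / (\<gamma> u - z0)^2) integrable_on ?T"
          by (intro integrable_diff i1 intL)
        show "(\<lambda>u. norm (z - z0) * (8 / d^3) * norm (D u)) integrable_on ?T"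
          by (intro integrable_on_mult_right nD)
        fix u assume u: "u \<in> ?T"
        have "D u / (\<gamma> u - z) - D u / (\<gamma> u - z0) = D u * (z - z0) / ((\<gamma> u - z) * (\<gamma> u - z0))"
          using *[OF u] by (simp add: field_simps)
        then have "(D u / (\<gamma> u - z) - D u / (\<gamma> u - z0)) / (z - z0) - D u / (\<gamma> u - z0)^2
           = D u / ((\<gamma> u - z) * (\<gamma> u - z0)) - D u / (\<gamma> u - z0)^2" using z(2) by simp
        also have "\<dots> = D u * (z - z0) / ((\<gamma> u - z) * (\<gamma> u - z0)^2)"
          using *[OF u] by (simp add: divide_simps power2_eq_square) (simp add: algebra_simps)
        finally have e: "norm ((D u / (\<gamma> u - z) - D u / (\<gamma> u - z0)) / (z - z0) - D u / (\<gamma> u - z0)^2)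
           = norm (D u) * norm (z - z0) / (norm (\<gamma> u - z) * norm (\<gamma> u - z0)^2)"
          by (simp add: norm_divide norm_mult norm_power)
        have "(d/2) * (d/2)^2 \<le> norm (\<gamma> u - z) * norm (\<gamma> u - z0)^2"
          using low[OF u z(1)] low[OF u, of z0] d(1) by (intro mult_mono power_mono) auto
        then have "norm (D u) * norm (z - z0) / (norm (\<gamma> u - z) * norm (\<gamma> u - z0)^2)
           \<le> norm (D u) * norm (z - z0) / ((d/2) * (d/2)^2)"
          using d(1) by (intro frac_le) auto
        also have "\<dots> = norm (z - z0) * (8 / d^3) * norm (D u)"
          using d(1) by (simp add: field_simps power2_eq_square power3_eq_cube)
        finally show "norm ((D u / (\<gamma> u - z) - D u / (\<gamma> u - z0)) / (z - z0) - D u / (\<gamma> u - z0)^2)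
           \<le> norm (z - z0) * (8 / d^3) * norm (D u)" using e by simp
      qed
      also have "\<dots> = norm (z - z0) * (8 / d^3 * ?I)" by (simp only: integral_mult_right mult.assoc)
      finally show ?thesis .
    qed
    have "((\<lambda>z. (?F z - ?F z0) / (z - z0) - ?L) \<longlongrightarrow> 0) (at z0)"
    proof (rule Lim_null_comparison)
      have "eventually (\<lambda>z. z \<in> ball z0 (d/2) - {z0}) (at z0)"
        by (rule eventually_at_in_open) (use d(1) in auto)
      then show "\<forall>\<^sub>F z in at z0. norm ((?F z - ?F z0) / (z - z0) - ?L) \<le> norm (z - z0) * (8 / d^3 * ?I)"
        by eventually_elim (use bound in blast)
      have "((\<lambda>z. norm (z - z0) * (8 / d^3 * ?I)) \<longlongrightarrow> norm (z0 - z0) * (8 / d^3 * ?I)) (at z0)"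
        by (intro tendsto_intros)
      then show "((\<lambda>z. norm (z - z0) * (8 / d^3 * ?I)) \<longlongrightarrow> 0) (at z0)" by simp
    qed
    then have "((\<lambda>z. (?F z - ?F z0) / (z - z0)) \<longlongrightarrow> ?L) (at z0)" by (simp only: LIM_zero_iff)
    then show "\<exists>f'. (?F has_field_derivative f') (at z0)"
      unfolding has_field_derivative_iff by blast
  qed
qed

lemma cauchy_integral_at_infinity:
  fixes D \<gamma> :: "real \<Rightarrow> complex"
  assumes D: "D absolutely_integrable_on {\<alpha>..\<beta>}" and cont: "continuous_on {\<alpha>..\<beta>} \<gamma>"
  shows "(\<lambda>z. integral {\<alpha>..\<beta>} (\<lambda>u. D u / (\<gamma> u - z))) \<in> O[at_infinity](\<lambda>z. 1 / z)"
proof -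
  let ?T = "{\<alpha>..\<beta>}"
  have "bounded (\<gamma> ` ?T)" by (intro compact_imp_bounded compact_continuous_image cont) simp
  then obtain R where R: "R > 0" "\<And>u. u \<in> ?T \<Longrightarrow> norm (\<gamma> u) \<le> R" unfolding bounded_pos by auto
  have nD: "(\<lambda>u. norm (D u)) integrable_on ?T" using D by (simp add: absolutely_integrable_on_def)
  let ?I = "integral ?T (\<lambda>u. norm (D u))"
  show ?thesis
  \<comment> \<open>The factor two: for \<open>norm z \<ge> 2 * R + 1\<close> every point of the
    curve has distance at least \<open>norm z / 2\<close> from \<open>z\<close>.\<close>
  proof (rule bigoI[where c = "2 * ?I"])
    have "norm (integral ?T (\<lambda>u. D u / (\<gamma> u - z))) \<le> 2 * ?I * norm (1 / z)" if z: "norm z \<ge> 2 * R + 1" for z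
    proof -
      have low: "norm (\<gamma> u - z) \<ge> norm z / 2" if "u \<in> ?T" for u
      proof -
        have "norm z - norm (\<gamma> u) \<le> norm (\<gamma> u - z)" by (metis norm_minus_commute norm_triangle_ineq2)
        then show ?thesis using R(2)[OF that] z R(1) by linarith
      qed
      have zT: "z \<notin> \<gamma> ` ?T"
      proof
        assume "z \<in> \<gamma> ` ?T"
        then show False using R z by fastforce
      qed
      have z0: "norm z > 0" using z R(1) by linarith
      have "norm (integral ?T (\<lambda>u. D u / (\<gamma> u - z))) \<le> integral ?T (\<lambda>u. 2 / norm z * norm (D u))"
      proof (rule integral_norm_bound_integral)
        show "(\<lambda>u. D u / (\<gamma> u - z)) integrable_on ?T"
          using cauchy_kernel_integrable[OF D cont zT] by (rule set_lebesgue_integral_eq_integral(1))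
        show "(\<lambda>u. 2 / norm z * norm (D u)) integrable_on ?T" by (rule integrable_on_mult_right[OF nD])
        fix u assume u: "u \<in> ?T"
        have "norm (D u) / norm (\<gamma> u - z) \<le> norm (D u) / (norm z / 2)"
          using low[OF u] z0 by (intro divide_left_mono mult_pos_pos) auto
        then show "norm (D u / (\<gamma> u - z)) \<le> 2 / norm z * norm (D u)" by (simp add: norm_divide mult.commute)
      qed
      also have "\<dots> = 2 * ?I * norm (1 / z)" by (simp add: norm_divide)
      finally show ?thesis .
    qed
    then show "\<forall>\<^sub>F z in at_infinity. norm (integral ?T (\<lambda>u. D u / (\<gamma> u - z))) \<le> 2 * ?I * norm (1 / z)"
      unfolding eventually_at_infinity by blast
  qed
qed

section \<open>Comparison of the kernel with its polar part\<close>

text \<open>As a function of \<open>u\<close> the kernel has at \<open>\<zeta>\<close> a simple pole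
  with residue \<open>E \<zeta> / deriv g \<zeta>\<close>. Over a common denominator the difference
  has a numerator bounded by a multiple of \<open>norm (u - \<zeta>)^2\<close>, by the Lipschitz
  bound for \<open>E\<close> and a second-order Taylor bound for \<open>g\<close>, and a denominator
  bounded below by such a multiple. The constant is uniform in both variables, which is what later
  permits a passage to the limit under the integral.\<close>

lemma univalent_kernel:
  assumes N: "open N" "g holomorphic_on N" "inj_on g N" "x \<in> N"
    and M: "open M" "E holomorphic_on M" "x \<in> M"
  obtains \<delta> C where "0 < \<delta>" "ball x \<delta> \<subseteq> N \<inter> M"
    "\<forall>\<zeta>\<in>ball x \<delta>. norm (E \<zeta> / deriv g \<zeta>) \<le> C"
    "\<forall>u\<in>ball x \<delta>. \<forall>\<zeta>\<in>ball x \<delta>. norm (g u - g \<zeta>) \<le> C * norm (u - \<zeta>)"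
    "\<forall>u\<in>ball x \<delta>. \<forall>\<zeta>\<in>ball x \<delta>. u \<noteq> \<zeta> \<longrightarrow>
       norm (E u / (g u - g \<zeta>) - E \<zeta> / deriv g \<zeta> / (u - \<zeta>)) \<le> C"
proof -
  obtain d0 where d0: "0 < d0" "cball x d0 \<subseteq> N \<inter> M"
    using open_contains_cball[of "N \<inter> M"] N M by (metis IntI open_Int)
  have comp: "\<exists>B>0. \<forall>z\<in>cball x d0. norm (h z) \<le> B" if "h holomorphic_on N \<or> h holomorphic_on M" for h :: "complex \<Rightarrow> complex"
  proof -
    have "continuous_on (cball x d0) h"
      using that d0(2) by (elim disjE) (rule continuous_on_subset[OF holomorphic_on_imp_continuous_on], assumption, blast)+
    then have "bounded (h ` cball x d0)" by (intro compact_imp_bounded compact_continuous_image) auto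
    then show ?thesis unfolding bounded_pos by auto
  qed
  have hg': "deriv g holomorphic_on N" using N by (intro holomorphic_deriv)
  have hg'': "deriv (deriv g) holomorphic_on N" using N hg' by (intro holomorphic_deriv)
  have hE': "deriv E holomorphic_on M" using M by (intro holomorphic_deriv)
  obtain B0 where B0: "B0 > 0" "\<And>z. z \<in> cball x d0 \<Longrightarrow> norm (E z) \<le> B0" using comp[of E] M by blast
  obtain B1 where B1: "B1 > 0" "\<And>z. z \<in> cball x d0 \<Longrightarrow> norm (deriv E z) \<le> B1" using comp[of "deriv E"] hE' by blast
  obtain B2 where B2: "B2 > 0" "\<And>z. z \<in> cball x d0 \<Longrightarrow> norm (deriv g z) \<le> B2" using comp[of "deriv g"] hg' by blast
  obtain B3 where B3: "B3 > 0" "\<And>z. z \<in> cball x d0 \<Longrightarrow> norm (deriv (deriv g) z) \<le> B3" using comp[of "deriv (deriv g)"] hg'' by blast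
  \<comment> \<open>With \<open>\<delta> \<le> m / B3\<close> the derivative of \<open>g\<close>
    varies by at most \<open>m\<close> on the ball. So it stays at least \<open>m\<close> in norm,
    and \<open>g\<close> expands distances by at least \<open>m\<close>.\<close>
  define m where "m = norm (deriv g x) / 2"
  have m: "m > 0" unfolding m_def using holomorphic_injective_imp_regular[OF N(2,1,3,4)] by simp
  define \<delta> where "\<delta> = min d0 (m / B3)"
  have \<delta>: "\<delta> > 0" "ball x \<delta> \<subseteq> cball x d0" "\<And>z. z \<in> ball x \<delta> \<Longrightarrow> B3 * norm (z - x) \<le> m"
  proof -
    show "\<delta> > 0" using d0 m B3 by (simp add: \<delta>_def)
    show "ball x \<delta> \<subseteq> cball x d0" by (auto simp: \<delta>_def)
    fix z assume "z \<in> ball x \<delta>"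
    then have "norm (z - x) \<le> m / B3" by (simp add: \<delta>_def dist_norm norm_minus_commute)
    then show "B3 * norm (z - x) \<le> m" using B3(1) by (simp add: field_simps)
  qed
  have bN: "z \<in> N" "z \<in> M" if "z \<in> ball x \<delta>" for z using that \<delta>(2) d0(2) by blast+
  have lip: "norm (f u - f v) \<le> B * norm (u - v)"
    if f: "\<And>z. z \<in> ball x \<delta> \<Longrightarrow> (f has_field_derivative f' z) (at z)" "\<And>z. z \<in> T \<Longrightarrow> norm (f' z) \<le> B"
       and T: "convex T" "T \<subseteq> ball x \<delta>" "u \<in> T" "v \<in> T" for f f' B u v T
    by (rule field_differentiable_bound[OF T(1) has_field_derivative_at_within[OF f(1)[OF subsetD[OF T(2)]]] f(2) T(3,4)])
  have dg: "(g has_field_derivative deriv g z) (at z)" if "z \<in> ball x \<delta>" for z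
    using N bN[OF that] holomorphic_derivI by blast
  have dg': "(deriv g has_field_derivative deriv (deriv g) z) (at z)" if "z \<in> ball x \<delta>" for z
    using N hg' bN[OF that] holomorphic_derivI by blast
  have dE: "(E has_field_derivative deriv E z) (at z)" if "z \<in> ball x \<delta>" for z
    using M bN[OF that] holomorphic_derivI by blast
  have xB: "x \<in> ball x \<delta>" using \<delta>(1) by simp
  have g'lip: "norm (deriv g u - deriv g v) \<le> B3 * norm (u - v)" if "u \<in> ball x \<delta>" "v \<in> ball x \<delta>" for u v
    by (rule lip[OF dg' _ convex_ball _ that]) (use B3 \<delta>(2) in auto)
  have near: "norm (deriv g z - deriv g x) \<le> m" if "z \<in> ball x \<delta>" for z
    using g'lip[OF that xB] \<delta>(3)[OF that] by linarith
  have g'low: "norm (deriv g z) \<ge> m" if "z \<in> ball x \<delta>" for z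
    using near[OF that] norm_triangle_ineq2[of "deriv g x" "deriv g z"] norm_minus_commute[of "deriv g x" "deriv g z"]
    unfolding m_def by linarith
  have glow: "m * norm (u - v) \<le> norm (g u - g v)" if "u \<in> ball x \<delta>" "v \<in> ball x \<delta>" for u v
  proof -
    have "norm ((g u - deriv g x * u) - (g v - deriv g x * v)) \<le> m * norm (u - v)"
      by (rule lip[of "\<lambda>z. g z - deriv g x * z" "\<lambda>z. deriv g z - deriv g x", OF _ near convex_ball _ that])
         (auto intro!: derivative_eq_intros dg)
    also have "(g u - deriv g x * u) - (g v - deriv g x * v) = (g u - g v) - deriv g x * (u - v)" by (simp add: algebra_simps)
    finally have "norm (deriv g x * (u - v)) - norm (g u - g v) \<le> m * norm (u - v)"
      by (metis norm_minus_commute norm_triangle_ineq2 order_trans)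
    moreover have "norm (deriv g x * (u - v)) = 2 * m * norm (u - v)" by (simp add: norm_mult m_def)
    ultimately show ?thesis by linarith
  qed
  have gtaylor: "norm (g u - g v - deriv g v * (u - v)) \<le> B3 * norm (u - v) * norm (u - v)"
    if uv: "u \<in> ball x \<delta>" "v \<in> ball x \<delta>" for u v
  proof -
    have seg: "closed_segment v u \<subseteq> ball x \<delta>" using uv by (intro closed_segment_subset convex_ball)
    have "norm ((g u - deriv g v * u) - (g v - deriv g v * v)) \<le> B3 * norm (u - v) * norm (u - v)"
    proof (rule lip[of "\<lambda>z. g z - deriv g v * z" "\<lambda>z. deriv g z - deriv g v" "closed_segment v u"])
      fix z assume z: "z \<in> closed_segment v u"
      have "norm (deriv g z - deriv g v) \<le> B3 * norm (z - v)" using g'lip uv(2) z seg by blast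
      also have "\<dots> \<le> B3 * norm (u - v)"
        using segment_bound1[OF z] B3(1) by (intro mult_left_mono) auto
      finally show "norm (deriv g z - deriv g v) \<le> B3 * norm (u - v)" .
    qed (use seg in \<open>auto intro!: derivative_eq_intros dg\<close>)
    then show ?thesis by (simp add: algebra_simps)
  qed
  \<comment> \<open>The three summands are the bounds for the residue, the Lipschitz constant of
    \<open>g\<close> and the kernel difference; their sum serves for all three.\<close>
  define C where "C = B0 / m + B2 + (B1 * B2 + B0 * B3) / (m * m)"
  have Cs: "B0 / m \<ge> 0" "B2 \<ge> 0" "(B1 * B2 + B0 * B3) / (m * m) \<ge> 0" using B0 B1 B2 B3 m by auto
  show ?thesis
  proof (rule that[of \<delta> C, OF \<delta>(1)]; (intro ballI impI)?)
    show "ball x \<delta> \<subseteq> N \<inter> M" using \<delta>(2) d0(2) by blast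
    fix \<zeta> assume \<zeta>: "\<zeta> \<in> ball x \<delta>"
    have "norm (E \<zeta>) / norm (deriv g \<zeta>) \<le> B0 / m"
      using B0 \<zeta> \<delta>(2) g'low[OF \<zeta>] m by (intro frac_le) auto
    then show "norm (E \<zeta> / deriv g \<zeta>) \<le> C" using Cs by (simp add: norm_divide C_def)
    fix u assume u: "u \<in> ball x \<delta>"
    have "norm (g u - g \<zeta>) \<le> B2 * norm (u - \<zeta>)"
      by (rule lip[OF dg _ convex_ball _ u \<zeta>]) (use B2 \<delta>(2) in auto)
    also have "\<dots> \<le> C * norm (u - \<zeta>)" using Cs by (intro mult_right_mono) (auto simp: C_def)
    finally show "norm (g u - g \<zeta>) \<le> C * norm (u - \<zeta>)" .
    assume ne: "u \<noteq> \<zeta>"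
    let ?d = "norm (u - \<zeta>)"
    have d: "?d > 0" using ne by simp
    have nz: "g u - g \<zeta> \<noteq> 0" "deriv g \<zeta> \<noteq> 0" "u - \<zeta> \<noteq> 0"
    proof -
      have "0 < m * ?d" using m d by simp
      then show "g u - g \<zeta> \<noteq> 0" using glow[OF u \<zeta>] by auto
      show "deriv g \<zeta> \<noteq> 0" using g'low[OF \<zeta>] m by auto
    qed (use ne in simp)
    have E1: "norm (E u - E \<zeta>) \<le> B1 * ?d"
      by (rule lip[OF dE _ convex_ball _ u \<zeta>]) (use B1 \<delta>(2) in auto)
    have num: "E u / (g u - g \<zeta>) - E \<zeta> / deriv g \<zeta> / (u - \<zeta>)
      = ((E u - E \<zeta>) * deriv g \<zeta> * (u - \<zeta>) - E \<zeta> * (g u - g \<zeta> - deriv g \<zeta> * (u - \<zeta>)))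
         / ((g u - g \<zeta>) * (deriv g \<zeta> * (u - \<zeta>)))"
      using nz by (simp add: divide_simps) (simp add: algebra_simps)
    have "norm ((E u - E \<zeta>) * deriv g \<zeta> * (u - \<zeta>) - E \<zeta> * (g u - g \<zeta> - deriv g \<zeta> * (u - \<zeta>)))
       \<le> norm (E u - E \<zeta>) * norm (deriv g \<zeta>) * ?d + norm (E \<zeta>) * norm (g u - g \<zeta> - deriv g \<zeta> * (u - \<zeta>))"
      by (metis norm_mult norm_triangle_ineq4)
    also have "\<dots> \<le> (B1 * ?d) * B2 * ?d + B0 * (B3 * ?d * ?d)"
      using E1 B2 B0 B1 gtaylor[OF u \<zeta>] \<zeta> \<delta>(2) d by (intro add_mono mult_mono) auto
    finally have n1: "norm ((E u - E \<zeta>) * deriv g \<zeta> * (u - \<zeta>) - E \<zeta> * (g u - g \<zeta> - deriv g \<zeta> * (u - \<zeta>)))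
       \<le> (B1 * B2 + B0 * B3) * (?d * ?d)" by (simp add: algebra_simps)
    have "(m * ?d) * (m * ?d) \<le> norm (g u - g \<zeta>) * (norm (deriv g \<zeta>) * ?d)"
      using glow[OF u \<zeta>] g'low[OF \<zeta>] m d by (intro mult_mono) auto
    then have n2: "m * m * (?d * ?d) \<le> norm ((g u - g \<zeta>) * (deriv g \<zeta> * (u - \<zeta>)))"
      unfolding norm_mult by (simp only: mult_ac)
    have "norm (E u / (g u - g \<zeta>) - E \<zeta> / deriv g \<zeta> / (u - \<zeta>)) \<le> (B1 * B2 + B0 * B3) * (?d * ?d) / (m * m * (?d * ?d))"
      unfolding num norm_divide using n1 n2 m d B0 B1 B2 B3 by (intro frac_le) auto
    also have "\<dots> = (B1 * B2 + B0 * B3) / (m * m)" using d by simp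
    also have "\<dots> \<le> C" using Cs by (simp add: C_def)
    finally show "norm (E u / (g u - g \<zeta>) - E \<zeta> / deriv g \<zeta> / (u - \<zeta>)) \<le> C" .
  qed
qed

section \<open>The model integrals\<close>

lemma has_integral_inverse_sqrt:
  assumes "0 \<le> c" shows "((\<lambda>u. 1 / sqrt u) has_integral 2 * sqrt c) {0..c}"
proof -
  have "((\<lambda>u. 1 / sqrt u) has_integral (2 * sqrt c - 2 * sqrt 0)) {0..c}"
  proof (rule fundamental_theorem_of_calculus_interior[OF assms])
    show "continuous_on {0..c} (\<lambda>u. 2 * sqrt u)" by (intro continuous_intros)
    fix u assume "u \<in> {0<..<c}"
    then have "((\<lambda>u. 2 * sqrt u) has_real_derivative 1 / sqrt u) (at u)"
      by (auto intro!: derivative_eq_intros simp: field_simps)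
    then show "((\<lambda>u. 2 * sqrt u) has_vector_derivative 1 / sqrt u) (at u)"
      by (simp add: has_real_derivative_iff_has_vector_derivative)
  qed
  then show ?thesis by simp
qed

lemma norm_Ln_bound: "w \<noteq> 0 \<Longrightarrow> norm (Ln w) \<le> \<bar>ln (norm w)\<bar> + pi"
  using cmod_le[of "Ln w"] mpi_less_Im_Ln[of w] Im_Ln_le_pi[of w] by auto

text \<open>With \<open>v = sqrt u\<close> and \<open>\<eta>^2 = \<zeta>\<close> the integrand
  becomes \<open>2 / (v^2 - \<eta>^2)\<close>, with the primitive
  \<open>Ln ((\<eta> - v) / (\<eta> + v)) / \<eta>\<close>. As \<open>\<eta>\<close> is not real,
  the argument of \<open>Ln\<close> never meets the cut, so the principal branch serves on the whole
  interval. The primitive vanishes at \<open>0\<close>, and the factor \<open>1 / \<eta>\<close>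
  gives the inverse square root in the bound.\<close>

lemma has_integral_sqrt_kernel:
  assumes c: "0 < c" and \<zeta>: "\<zeta> \<notin> complex_of_real ` {0..}" and small: "norm \<zeta> \<le> c / 4"
  obtains I where "((\<lambda>u. 1 / (complex_of_real (sqrt u) * (complex_of_real u - \<zeta>))) has_integral I) {0..c}"
    "norm I \<le> 6 / sqrt (norm \<zeta>)"
proof -
  define \<eta> where "\<eta> = csqrt \<zeta>"
  have \<eta>2: "\<eta>^2 = \<zeta>" by (simp add: \<eta>_def)
  have \<eta>R: "\<eta> \<notin> \<real>"
  proof
    assume "\<eta> \<in> \<real>"
    then obtain r where "\<eta> = of_real r" by (auto elim: Reals_cases)
    then have "\<zeta> = of_real (r^2)" using \<eta>2 by simp
    moreover have "r^2 \<in> {0..}" by simp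
    ultimately show False using \<zeta> by blast
  qed
  have den: "\<eta> + of_real v \<noteq> 0" "\<eta> - of_real v \<noteq> 0" for v
    using \<eta>R by (metis Reals_minus Reals_of_real add.commute add_eq_0_iff, metis Reals_of_real eq_iff_diff_eq_0)
  define q where "q v = (\<eta> - of_real v) / (\<eta> + of_real v)" for v :: real
  have q0: "q v \<noteq> 0" for v using den[of v] by (simp add: q_def)
  have qR: "q v \<notin> \<real>\<^sub>\<le>\<^sub>0" if "v \<ge> 0" for v
  proof
    assume "q v \<in> \<real>\<^sub>\<le>\<^sub>0"
    then have "q v = of_real (- (- Re (q v)))" "- Re (q v) \<ge> 0"
      by (auto simp: complex_nonpos_Reals_iff complex_eq_iff)
    then obtain r where r: "q v = of_real (- r)" "r \<ge> 0" by blast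
    then have "\<eta> - of_real v = - of_real r * (\<eta> + of_real v)" using den[of v] by (simp add: q_def field_simps)
    then have "Im (\<eta> - of_real v) = Im (- of_real r * (\<eta> + of_real v))" by simp
    then have "Im \<eta> * (1 + r) = 0" by (simp add: algebra_simps)
    then have "Im \<eta> = 0" using r(2) by simp
    then show False using \<eta>R by (simp add: complex_is_Real_iff)
  qed
  define P where "P u = Ln (q (sqrt u)) / \<eta>" for u
  have \<eta>0: "\<eta> \<noteq> 0" using \<eta>R by auto
  have "((\<lambda>u. 1 / (complex_of_real (sqrt u) * (complex_of_real u - \<zeta>))) has_integral (P c - P 0)) {0..c}"
  proof (rule fundamental_theorem_of_calculus_interior)
    show "0 \<le> c" using c by simp
    show "continuous_on {0..c} P"
      unfolding P_def
      by (intro continuous_intros) (use qR q_def den \<eta>0 in \<open>auto intro!: continuous_intros\<close>)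
    fix u assume u: "u \<in> {0<..<c}"
    have s: "((\<lambda>u. complex_of_real (sqrt u)) has_vector_derivative complex_of_real (1 / (2 * sqrt u))) (at u)"
      using u by (intro has_vector_derivative_of_real) (auto intro!: derivative_eq_intros simp: field_simps)
    let ?v = "complex_of_real (sqrt u)"
    have v2: "?v^2 = of_real u" using u by (simp flip: of_real_power)
    have "((\<lambda>v. Ln ((\<eta> - v) / (\<eta> + v)) / \<eta>) has_field_derivative
        (((- 1) * (\<eta> + ?v) - (\<eta> - ?v) * 1) / ((\<eta> + ?v) * (\<eta> + ?v))) / ((\<eta> - ?v) / (\<eta> + ?v)) / \<eta>) (at ?v)"
      using qR[of "sqrt u"] den[of "sqrt u"] u unfolding q_def
      by (auto intro!: derivative_eq_intros simp: divide_simps)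
    from field_vector_diff_chain_at[OF s this]
    have "(P has_vector_derivative of_real (1 / (2 * sqrt u)) *
        ((((- 1) * (\<eta> + ?v) - (\<eta> - ?v) * 1) / ((\<eta> + ?v) * (\<eta> + ?v))) / ((\<eta> - ?v) / (\<eta> + ?v)) / \<eta>)) (at u)"
      unfolding P_def q_def o_def .
    moreover have "of_real (1 / (2 * sqrt u)) *
        ((((- 1) * (\<eta> + ?v) - (\<eta> - ?v) * 1) / ((\<eta> + ?v) * (\<eta> + ?v))) / ((\<eta> - ?v) / (\<eta> + ?v)) / \<eta>)
       = 1 / (?v * (of_real u - \<zeta>))"
    proof -
      have "(((- 1) * (\<eta> + ?v) - (\<eta> - ?v) * 1) / ((\<eta> + ?v) * (\<eta> + ?v))) / ((\<eta> - ?v) / (\<eta> + ?v)) / \<eta>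
         = - 2 / ((\<eta> + ?v) * (\<eta> - ?v))"
        using den[of "sqrt u"] \<eta>0 by (simp add: divide_simps)
      also have "(\<eta> + ?v) * (\<eta> - ?v) = - (of_real u - \<zeta>)"
        using \<eta>2 v2 by (simp add: algebra_simps power2_eq_square)
      also have "- 2 / - (of_real u - \<zeta>) = 2 / (of_real u - \<zeta>)" by (simp only: minus_divide_divide)
      finally have X: "(((- 1) * (\<eta> + ?v) - (\<eta> - ?v) * 1) / ((\<eta> + ?v) * (\<eta> + ?v))) / ((\<eta> - ?v) / (\<eta> + ?v)) / \<eta>
         = 2 / (of_real u - \<zeta>)" .
      show ?thesis unfolding X by simp
    qed
    ultimately show "(P has_vector_derivative 1 / (?v * (complex_of_real u - \<zeta>))) (at u)" by simp
  qed
  moreover have "P 0 = 0" using \<eta>0 by (simp add: P_def q_def)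
  moreover have "norm (P c) \<le> 6 / sqrt (norm \<zeta>)"
  proof -
    have n\<eta>: "norm \<eta> = sqrt (norm \<zeta>)" using \<eta>2 by (metis norm_ge_zero norm_power real_sqrt_unique)
    have "sqrt (norm \<zeta>) \<le> sqrt (c / 4)" using small by (simp only: real_sqrt_le_iff)
    also have "\<dots> = sqrt c / 2" by (simp add: real_sqrt_divide)
    finally have h: "norm \<eta> \<le> sqrt c / 2" using n\<eta> by simp
    let ?v = "complex_of_real (sqrt c)"
    have sc: "sqrt c > 0" "norm ?v = sqrt c" using c by auto
    have b: "norm (\<eta> - ?v) \<le> 3/2 * sqrt c" "norm (\<eta> + ?v) \<le> 3/2 * sqrt c"
      "sqrt c / 2 \<le> norm (\<eta> - ?v)" "sqrt c / 2 \<le> norm (\<eta> + ?v)"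
      using h sc norm_triangle_ineq4[of \<eta> ?v] norm_triangle_ineq[of \<eta> ?v] norm_triangle_ineq2[of ?v \<eta>]
        norm_minus_commute[of ?v \<eta>] norm_triangle_ineq2[of ?v "- \<eta>"] by (auto simp: add.commute)
    have "norm (q (sqrt c)) \<le> (3/2 * sqrt c) / (sqrt c / 2)"
      unfolding q_def norm_divide using b sc by (intro frac_le) auto
    then have q3: "norm (q (sqrt c)) \<le> 3" using sc by simp
    have "(sqrt c / 2) / (3/2 * sqrt c) \<le> norm (q (sqrt c))"
      unfolding q_def norm_divide using b sc den[of "sqrt c"] by (intro frac_le) auto
    then have q13: "1 / 3 \<le> norm (q (sqrt c))" using sc by simp
    have e: "ln (3::real) \<le> 2" using ln_le_minus_one[of "3::real"] by simp
    have "ln (norm (q (sqrt c))) \<le> ln 3" using q3 q0 by simp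
    moreover have "ln (1/3) \<le> ln (norm (q (sqrt c)))" using q13 q0 by (subst ln_le_cancel_iff) auto
    then have "- ln 3 \<le> ln (norm (q (sqrt c)))" by (simp add: ln_div)
    ultimately have "\<bar>ln (norm (q (sqrt c)))\<bar> \<le> 2" using e by linarith
    \<comment> \<open>Since \<open>norm \<eta> \<le> sqrt c / 2\<close>, the quotient has norm
      between \<open>1/3\<close> and \<open>3\<close>. Then \<open>6\<close> comes from
      \<open>ln 3 \<le> 2\<close> and \<open>pi < 4\<close>.\<close>
    then have "norm (Ln (q (sqrt c))) \<le> 6" using norm_Ln_bound[OF q0, of "sqrt c"] pi_less_4 by linarith
    then show ?thesis unfolding P_def norm_divide n\<eta> by (intro divide_right_mono) auto
  qed
  ultimately show ?thesis using that by simp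
qed

lemma has_integral_log_kernel:
  assumes "\<alpha> \<le> \<beta>" "Im \<zeta> \<noteq> 0"
  shows "((\<lambda>u. 1 / (complex_of_real u - \<zeta>)) has_integral (Ln (of_real \<beta> - \<zeta>) - Ln (of_real \<alpha> - \<zeta>))) {\<alpha>..\<beta>}"
proof (rule fundamental_theorem_of_calculus[OF assms(1)])
  fix u :: real
  have "complex_of_real u - \<zeta> \<notin> \<real>\<^sub>\<le>\<^sub>0" using assms(2) by (auto simp: complex_nonpos_Reals_iff)
  then have "((\<lambda>z. Ln (z - \<zeta>)) has_field_derivative 1 / (of_real u - \<zeta>)) (at (complex_of_real u))"
    by (auto intro!: derivative_eq_intros simp: divide_inverse)
  from field_vector_diff_chain_at[OF has_vector_derivative_of_real[OF DERIV_ident] this]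
  have "((\<lambda>u. Ln (of_real u - \<zeta>)) has_vector_derivative 1 / (of_real u - \<zeta>)) (at u)"
    by (simp add: o_def)
  then show "((\<lambda>u. Ln (of_real u - \<zeta>)) has_vector_derivative 1 / (of_real u - \<zeta>)) (at u within {\<alpha>..\<beta>})"
    by (rule has_vector_derivative_at_within)
qed

text \<open>The source of the jump: \<open>\<beta> - \<zeta>\<close> stays away from the cut of
  \<open>Ln\<close>, while \<open>\<alpha> - \<zeta>\<close> tends to the negative axis, from below
  when \<open>\<zeta>\<close> comes from the upper half-plane and from above otherwise.\<close>

lemma log_kernel_trace:
  assumes s: "\<alpha> < s" "s < \<beta>" and \<sigma>: "\<sigma> \<in> {1, -1}"
  shows "((\<lambda>\<zeta>. Ln (of_real \<beta> - \<zeta>) - Ln (of_real \<alpha> - \<zeta>)) \<longlongrightarrow>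
     Ln (of_real (\<beta> - s)) - Ln (of_real (s - \<alpha>)) + \<i> * of_real (\<sigma> * pi)) (at (complex_of_real s) within half \<sigma>)"
proof -
  have "((\<lambda>\<zeta>. Ln (of_real \<beta> - \<zeta>)) \<longlongrightarrow> Ln (of_real \<beta> - of_real s)) (at (complex_of_real s) within half \<sigma>)"
    by (intro tendsto_Ln tendsto_intros) (use s in \<open>auto simp: complex_nonpos_Reals_iff\<close>)
  moreover have "((\<lambda>\<zeta>. Ln (\<zeta> - of_real \<alpha>) - \<i> * of_real (\<sigma> * pi)) \<longlongrightarrow>
      Ln (of_real s - of_real \<alpha>) - \<i> * of_real (\<sigma> * pi)) (at (complex_of_real s) within half \<sigma>)"
    by (intro tendsto_diff tendsto_Ln tendsto_intros) (use s in \<open>auto simp: complex_nonpos_Reals_iff\<close>)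
  then have "((\<lambda>\<zeta>. Ln (of_real \<alpha> - \<zeta>)) \<longlongrightarrow> Ln (of_real s - of_real \<alpha>) - \<i> * of_real (\<sigma> * pi)) (at (complex_of_real s) within half \<sigma>)"
  proof (rule Lim_transform_eventually)
    have "Ln (\<zeta> - of_real \<alpha>) - \<i> * of_real (\<sigma> * pi) = Ln (of_real \<alpha> - \<zeta>)" if "\<zeta> \<in> half \<sigma>" for \<zeta>
    proof -
      have "\<zeta> - of_real \<alpha> \<noteq> 0" using that by (auto simp: half_def)
      from Ln_minus[OF this] show ?thesis using that \<sigma> by (auto simp: half_def)
    qed
    then show "\<forall>\<^sub>F \<zeta> in at (complex_of_real s) within half \<sigma>. Ln (\<zeta> - of_real \<alpha>) - \<i> * of_real (\<sigma> * pi) = Ln (of_real \<alpha> - \<zeta>)"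
      by (simp add: eventually_at_filter)
  qed
  ultimately have "((\<lambda>\<zeta>. Ln (of_real \<beta> - \<zeta>) - Ln (of_real \<alpha> - \<zeta>)) \<longlongrightarrow> Ln (of_real \<beta> - of_real s) - (Ln (of_real s - of_real \<alpha>) - \<i> * of_real (\<sigma> * pi)))
     (at (complex_of_real s) within half \<sigma>)" by (rule tendsto_diff)
  then show ?thesis by (simp add: algebra_simps)
qed

section \<open>Cauchy integrals at an end and at an interior point of an arc\<close>

text \<open>Replacing the kernel by its polar part costs a bounded factor times
  \<open>1 / sqrt u\<close>, which is integrable. The remaining model integral is of the order of
  \<open>1 / sqrt (norm \<zeta>)\<close>. As \<open>z - G 0\<close> is of the order of
  \<open>norm \<zeta>\<close>, the product is of the order of \<open>sqrt (norm \<zeta>)\<close> and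
  tends to \<open>0\<close>.\<close>

lemma endpoint_estimate:
  assumes N: "open N" "G holomorphic_on N" "inj_on G N" "0 \<in> N"
    and M: "open M" "E holomorphic_on M" "0 \<in> M"
  obtains c where "0 < c"
    "\<And>c' D. 0 < c' \<Longrightarrow> c' < c \<Longrightarrow> D absolutely_integrable_on {0..c'} \<Longrightarrow>
      (\<And>u. u \<in> {0<..<c'} \<Longrightarrow> D u = E (of_real u) / of_real (sqrt u)) \<Longrightarrow>
      ((\<lambda>z. (z - G 0) * integral {0..c'} (\<lambda>u. D u / (G (of_real u) - z))) \<longlongrightarrow> 0)
        (at (G 0) within - (G ` complex_of_real ` {0..c'}))"
proof -
  obtain \<delta> C where \<delta>: "0 < \<delta>" "ball 0 \<delta> \<subseteq> N \<inter> M"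
    and C': "\<forall>\<zeta>\<in>ball 0 \<delta>. norm (E \<zeta> / deriv G \<zeta>) \<le> C"
    "\<forall>u\<in>ball 0 \<delta>. \<forall>\<zeta>\<in>ball 0 \<delta>. norm (G u - G \<zeta>) \<le> C * norm (u - \<zeta>)"
    "\<forall>u\<in>ball 0 \<delta>. \<forall>\<zeta>\<in>ball 0 \<delta>. u \<noteq> \<zeta> \<longrightarrow>
       norm (E u / (G u - G \<zeta>) - E \<zeta> / deriv G \<zeta> / (u - \<zeta>)) \<le> C"
    by (rule univalent_kernel[OF N M])
  note C = C'(1)[rule_format] C'(2)[rule_format] C'(3)[rule_format]
  have C0: "C \<ge> 0" using C(1)[of 0] \<delta>(1) norm_ge_zero[of "E 0 / deriv G 0"] by (simp del: norm_ge_zero)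
  obtain H where H: "H holomorphic_on G ` N" "\<And>z. z \<in> N \<Longrightarrow> H (G z) = z"
    using holomorphic_has_inverse[OF N(2,1,3)] by metis
  have opGN: "open (G ` N)" by (rule open_mapping_thm3[OF N(2,1,3)])
  have H0: "H (G 0) = 0" using H(2)[OF N(4)] .
  have contH: "isCont H (G 0)"
    by (rule continuous_on_interior[OF holomorphic_on_imp_continuous_on[OF H(1)]]) (use opGN N(4) interior_open in blast)
  show ?thesis
  proof (rule that[OF \<delta>(1)])
    fix c' :: real and D assume c': "0 < c'" "c' < \<delta>" and D: "D absolutely_integrable_on {0..c'}"
      and DE: "\<And>u. u \<in> {0<..<c'} \<Longrightarrow> D u = E (of_real u) / of_real (sqrt u)"
    let ?\<Gamma> = "G ` complex_of_real ` {0..c'}"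
    let ?F = "\<lambda>z. integral {0..c'} (\<lambda>u. D u / (G (of_real u) - z))"
    define B where "B z = C * norm (H z) * (2 * C * sqrt c') + 6 * C * C * sqrt (norm (H z))" for z
    have sN: "complex_of_real u \<in> ball 0 \<delta>" if "u \<in> {0..c'}" for u using that c' by simp
    have contG: "continuous_on {0..c'} (\<lambda>u. G (complex_of_real u))"
      by (rule continuous_on_compose2[OF holomorphic_on_imp_continuous_on[OF N(2)]])
         (use sN \<delta>(2) in \<open>auto intro!: continuous_intros\<close>)
    \<comment> \<open>The radius \<open>c'/4\<close> is the smallness that the model integral asks
      for; the two summands of \<open>B\<close> are the kernel difference and the polar
      part.\<close>
    have bound: "norm ((z - G 0) * ?F z) \<le> B z" if z: "z \<in> G ` ball 0 (c'/4)" "z \<notin> ?\<Gamma>" for z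
    proof -
      obtain \<zeta> where \<zeta>: "z = G \<zeta>" "\<zeta> \<in> ball 0 (c'/4)" using z(1) by blast
      have \<zeta>\<delta>: "\<zeta> \<in> ball 0 \<delta>" using \<zeta>(2) c' by simp
      then have Hz: "H z = \<zeta>" using H(2) \<delta>(2) \<zeta>(1) by blast
      have \<zeta>off: "\<zeta> \<notin> complex_of_real ` {0..}"
      proof
        assume "\<zeta> \<in> complex_of_real ` {0..}"
        then obtain x where x: "\<zeta> = of_real x" "x \<ge> 0" by auto
        then have "x \<in> {0..c'}" using \<zeta>(2) c'(1) by simp
        then show False using z(2) \<zeta>(1) x(1) by blast
      qed
      have "norm \<zeta> \<le> c' / 4" using \<zeta>(2) by simp
      then obtain I where I: "((\<lambda>u. 1 / (complex_of_real (sqrt u) * (complex_of_real u - \<zeta>))) has_integral I) {0..c'}"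
        "norm I \<le> 6 / sqrt (norm \<zeta>)" using has_integral_sqrt_kernel[OF c'(1) \<zeta>off] by blast
      define q where "q = E \<zeta> / deriv G \<zeta>"
      define R where "R u = D u / (G (of_real u) - z) - q * (1 / (of_real (sqrt u) * (of_real u - \<zeta>)))" for u :: real
      have zG: "z \<notin> (\<lambda>u. G (complex_of_real u)) ` {0..c'}" using z(2) by auto
      have iF: "(\<lambda>u. D u / (G (of_real u) - z)) integrable_on {0..c'}"
        using cauchy_kernel_integrable[OF D contG zG] by (rule set_lebesgue_integral_eq_integral(1))
      have iq: "((\<lambda>u. q * (1 / (complex_of_real (sqrt u) * (complex_of_real u - \<zeta>)))) has_integral (q * I)) {0..c'}"
        by (rule has_integral_mult_right[OF I(1)])
      have iR: "R integrable_on {0..c'}" unfolding R_def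
        by (intro integrable_diff iF has_integral_integrable[OF iq])
      have "integral {0..c'} R = ?F z - q * I" unfolding R_def
        using integral_diff[OF iF has_integral_integrable[OF iq]] integral_unique[OF iq] by simp
      then have F: "?F z = integral {0..c'} R + q * I" by simp
      have "norm (integral {0..c'} R) \<le> C * (2 * sqrt c')"
      proof -
        have hs: "((\<lambda>u. C * (1 / sqrt u)) has_integral (C * (2 * sqrt c'))) {0..c'}"
          by (rule has_integral_mult_right[OF has_integral_inverse_sqrt]) (use c' in simp)
        \<comment> \<open>The shape of \<open>D\<close> is prescribed only in the open interval;
          dropping the ends changes no integral.\<close>
        have "norm (integral {0<..<c'} R) \<le> integral {0<..<c'} (\<lambda>u. C * (1 / sqrt u))"
        proof (rule integral_norm_bound_integral)
          show "R integrable_on {0<..<c'}" using iR by (simp add: integrable_on_open_interval_real)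
          show "(\<lambda>u. C * (1 / sqrt u)) integrable_on {0<..<c'}"
            using has_integral_integrable[OF hs] by (simp add: integrable_on_open_interval_real)
          fix u assume u: "u \<in> {0<..<c'}"
          have ne: "complex_of_real u \<noteq> \<zeta>" using \<zeta>off u by auto
          have "R u = (E (of_real u) / (G (of_real u) - G \<zeta>) - q / (of_real u - \<zeta>)) / of_real (sqrt u)"
            unfolding R_def DE[OF u] \<zeta>(1) by (simp add: diff_divide_distrib mult.commute)
          then have "norm (R u) = norm (E (of_real u) / (G (of_real u) - G \<zeta>) - q / (of_real u - \<zeta>)) / sqrt u"
            using u by (simp add: norm_divide)
          also have "\<dots> \<le> C / sqrt u"
            unfolding q_def using C(3)[OF sN \<zeta>\<delta> ne] u by (intro divide_right_mono) auto
          finally show "norm (R u) \<le> C * (1 / sqrt u)" by simp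
        qed
        then show ?thesis using integral_unique[OF hs] by (simp add: integral_open_interval_real)
      qed
      moreover have "norm (q * I) \<le> C * (6 / sqrt (norm \<zeta>))"
        unfolding norm_mult q_def using C(1)[OF \<zeta>\<delta>] I(2) C0 by (intro mult_mono) auto
      ultimately have Fb: "norm (?F z) \<le> C * (2 * sqrt c') + C * (6 / sqrt (norm \<zeta>))"
        unfolding F by (rule norm_triangle_mono)
      have "norm (z - G 0) \<le> C * norm \<zeta>" using C(2)[OF \<zeta>\<delta>, of 0] \<delta>(1) \<zeta>(1) by simp
      then have "norm ((z - G 0) * ?F z) \<le> (C * norm \<zeta>) * (C * (2 * sqrt c') + C * (6 / sqrt (norm \<zeta>)))"
        unfolding norm_mult using Fb C0 by (intro mult_mono) auto
      also have "\<dots> = C * norm \<zeta> * (2 * C * sqrt c') + 6 * C * C * (norm \<zeta> / sqrt (norm \<zeta>))"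
        by (simp add: algebra_simps)
      also have "norm \<zeta> / sqrt (norm \<zeta>) = sqrt (norm \<zeta>)" by (rule real_div_sqrt) simp
      finally show ?thesis unfolding B_def Hz .
    qed
    have sub: "ball 0 (c'/4) \<subseteq> N" using \<delta>(2) c' by auto
    have "open (G ` ball 0 (c'/4))"
      by (rule open_mapping_thm3[OF holomorphic_on_subset[OF N(2) sub] open_ball inj_on_subset[OF N(3) sub]])
    moreover have "G 0 \<in> G ` ball 0 (c'/4)" using c' by auto
    ultimately have "eventually (\<lambda>z. z \<in> G ` ball 0 (c'/4)) (at (G 0))" by (rule eventually_at_in_open')
    then have "eventually (\<lambda>z. z \<in> G ` ball 0 (c'/4)) (at (G 0) within - ?\<Gamma>)"
      by (rule filter_leD[OF at_le[OF subset_UNIV]])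
    moreover have "eventually (\<lambda>z. z \<in> - ?\<Gamma>) (at (G 0) within - ?\<Gamma>)" by (simp add: eventually_at_filter)
    ultimately have ev: "\<forall>\<^sub>F z in at (G 0) within - ?\<Gamma>. norm ((z - G 0) * ?F z) \<le> B z"
      by eventually_elim (use bound in blast)
    have "(H \<longlongrightarrow> 0) (at (G 0))" using contH H0 unfolding isCont_def by simp
    then have "(H \<longlongrightarrow> 0) (at (G 0) within - ?\<Gamma>)" by (rule tendsto_within_subset) simp
    then have "(B \<longlongrightarrow> C * norm (0::complex) * (2 * C * sqrt c') + 6 * C * C * sqrt (norm (0::complex))) (at (G 0) within - ?\<Gamma>)"
      unfolding B_def by (intro tendsto_intros)
    then have "(B \<longlongrightarrow> 0) (at (G 0) within - ?\<Gamma>)" by simp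
    with ev show "((\<lambda>z. (z - G 0) * ?F z) \<longlongrightarrow> 0) (at (G 0) within - ?\<Gamma>)"
      by (rule Lim_null_comparison)
  qed
qed

text \<open>The kernel minus its polar part is bounded uniformly in \<open>\<zeta>\<close>, so its
  integral has by dominated convergence the same limit from both sides. The polar part integrates to
  a difference of logarithms, which alone produces the term with
  \<open>\<sigma> * pi\<close>.\<close>

lemma interior_estimate:
  assumes N: "open N" "G holomorphic_on N" "inj_on G N" "complex_of_real s \<in> N"
    and M: "open M" "E holomorphic_on M" "complex_of_real s \<in> M"
  obtains c where "0 < c"
    "\<And>\<alpha> \<beta>. s - c < \<alpha> \<Longrightarrow> \<alpha> < s \<Longrightarrow> s < \<beta> \<Longrightarrow> \<beta> < s + c \<Longrightarrow>
      \<exists>l. \<forall>\<sigma>\<in>{1, -1}. ((\<lambda>\<zeta>. integral {\<alpha>..\<beta>} (\<lambda>u. E (of_real u) / (G (of_real u) - G \<zeta>))) \<longlongrightarrow>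
         l + \<i> * of_real (\<sigma> * pi) * (E (of_real s) / deriv G (of_real s))) (at (complex_of_real s) within half \<sigma>)"
proof -
  let ?s = "complex_of_real s"
  obtain \<delta> C where \<delta>: "0 < \<delta>" "ball ?s \<delta> \<subseteq> N \<inter> M"
    and C': "\<forall>\<zeta>\<in>ball ?s \<delta>. norm (E \<zeta> / deriv G \<zeta>) \<le> C"
    "\<forall>u\<in>ball ?s \<delta>. \<forall>\<zeta>\<in>ball ?s \<delta>. norm (G u - G \<zeta>) \<le> C * norm (u - \<zeta>)"
    "\<forall>u\<in>ball ?s \<delta>. \<forall>\<zeta>\<in>ball ?s \<delta>. u \<noteq> \<zeta> \<longrightarrow>
       norm (E u / (G u - G \<zeta>) - E \<zeta> / deriv G \<zeta> / (u - \<zeta>)) \<le> C"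
    by (rule univalent_kernel[OF N M])
  note C = C'(3)[rule_format]
  define q where "q \<zeta> = E \<zeta> / deriv G \<zeta>" for \<zeta>
  have cont: "isCont f \<zeta>" if "f holomorphic_on T" "open T" "\<zeta> \<in> T" for f T and \<zeta> :: complex
    by (rule continuous_on_interior[OF holomorphic_on_imp_continuous_on[OF that(1)]]) (use that in \<open>simp add: interior_open\<close>)
  have contG: "isCont G \<zeta>" and contq: "isCont q \<zeta>" if "\<zeta> \<in> ball ?s \<delta>" for \<zeta>
  proof -
    have \<zeta>: "\<zeta> \<in> N" "\<zeta> \<in> M" using that \<delta>(2) by blast+
    show "isCont G \<zeta>" by (rule cont[OF N(2,1) \<zeta>(1)])
    have cE: "isCont E \<zeta>" by (rule cont[OF M(2,1) \<zeta>(2)])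
    have "isCont (deriv G) \<zeta>" by (rule cont[OF holomorphic_deriv[OF N(2,1)] N(1) \<zeta>(1)])
    then show "isCont q \<zeta>" unfolding q_def
      using cE holomorphic_injective_imp_regular[OF N(2,1,3) \<zeta>(1)] by (intro continuous_intros)
  qed
  have Gne: "G u \<noteq> G v" if "u \<in> ball ?s \<delta>" "v \<in> ball ?s \<delta>" "u \<noteq> v" for u v
    using inj_onD[OF N(3), of u v] subsetD[OF \<delta>(2) that(1)] subsetD[OF \<delta>(2) that(2)] that(3) by auto
  show ?thesis
  proof (rule that[OF \<delta>(1)])
    fix \<alpha> \<beta> assume ab: "s - \<delta> < \<alpha>" "\<alpha> < s" "s < \<beta>" "\<beta> < s + \<delta>"
    have uB: "complex_of_real u \<in> ball ?s \<delta>" if "u \<in> {\<alpha>..\<beta>}" for u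
    proof -
      have "dist ?s (complex_of_real u) = \<bar>s - u\<bar>" by (metis dist_of_real dist_real_def)
      then show ?thesis using that ab by auto
    qed
    \<comment> \<open>The limiting integrand \<open>J ?s\<close> has a vanishing denominator at
      \<open>u = s\<close>. That point is removed, which \<open>spike\<close> shows to be
      harmless.\<close>
    let ?S = "{\<alpha>..\<beta>} - {s}"
    define J where "J \<zeta> u = E (of_real u) / (G (of_real u) - G \<zeta>) - q \<zeta> * (1 / (of_real u - \<zeta>))" for \<zeta> and u :: real
    have spike: "f integrable_on ?S \<longleftrightarrow> f integrable_on {\<alpha>..\<beta>}" "integral ?S f = integral {\<alpha>..\<beta>} f"
      for f :: "real \<Rightarrow> 'b::banach"
    proof -
      have n: "negligible {x \<in> ?S - {\<alpha>..\<beta>}. f x \<noteq> 0}" "negligible {x \<in> {\<alpha>..\<beta>} - ?S. f x \<noteq> 0}"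
        by (rule negligible_subset[of "{s}"]; auto)+
      show "f integrable_on ?S \<longleftrightarrow> f integrable_on {\<alpha>..\<beta>}"
        using integrable_spike_set[OF _ n] integrable_spike_set[OF _ n(2,1)] by blast
      show "integral ?S f = integral {\<alpha>..\<beta>} f" by (rule integral_spike_set[OF n])
    qed
    have split: "J \<zeta> integrable_on {\<alpha>..\<beta>} \<and> integral {\<alpha>..\<beta>} (\<lambda>u. E (of_real u) / (G (of_real u) - G \<zeta>))
        = integral {\<alpha>..\<beta>} (J \<zeta>) + q \<zeta> * (Ln (of_real \<beta> - \<zeta>) - Ln (of_real \<alpha> - \<zeta>))"
      if \<zeta>: "\<zeta> \<in> ball ?s \<delta>" "Im \<zeta> \<noteq> 0" for \<zeta>
    proof -
      have ne: "complex_of_real u \<noteq> \<zeta>" for u using \<zeta>(2) by auto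
      have "continuous_on {\<alpha>..\<beta>} (\<lambda>u. E (of_real u) / (G (of_real u) - G \<zeta>))"
      proof (intro continuous_intros)
        show "continuous_on {\<alpha>..\<beta>} (\<lambda>u. E (complex_of_real u))"
          by (rule continuous_on_compose2[OF holomorphic_on_imp_continuous_on[OF M(2)]])
             (use uB \<delta>(2) in \<open>auto intro!: continuous_intros\<close>)
        show "continuous_on {\<alpha>..\<beta>} (\<lambda>u. G (complex_of_real u))"
          by (rule continuous_on_compose2[OF holomorphic_on_imp_continuous_on[OF N(2)]])
             (use uB \<delta>(2) in \<open>auto intro!: continuous_intros\<close>)
        show "\<forall>u\<in>{\<alpha>..\<beta>}. G (complex_of_real u) - G \<zeta> \<noteq> 0" using Gne[OF uB \<zeta>(1) ne] by simp
      qed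
      then have i1: "(\<lambda>u. E (of_real u) / (G (of_real u) - G \<zeta>)) integrable_on {\<alpha>..\<beta>}" by (rule integrable_continuous_interval)
      have i2: "((\<lambda>u. q \<zeta> * (1 / (complex_of_real u - \<zeta>))) has_integral q \<zeta> * (Ln (of_real \<beta> - \<zeta>) - Ln (of_real \<alpha> - \<zeta>))) {\<alpha>..\<beta>}"
        by (rule has_integral_mult_right[OF has_integral_log_kernel[OF _ \<zeta>(2)]]) (use ab in simp)
      show ?thesis
        using integral_diff[OF i1 has_integral_integrable[OF i2]] integral_unique[OF i2]
          integrable_diff[OF i1 has_integral_integrable[OF i2]] unfolding J_def by simp
    qed
    \<comment> \<open>Everything that does not depend on the side: the regular integral and the real
      logarithms of the distances to the ends of the interval.\<close>
    define l where "l = integral {\<alpha>..\<beta>} (J ?s) + q ?s * (Ln (of_real (\<beta> - s)) - Ln (of_real (s - \<alpha>)))"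
    have "((\<lambda>\<zeta>. integral {\<alpha>..\<beta>} (\<lambda>u. E (of_real u) / (G (of_real u) - G \<zeta>))) \<longlongrightarrow>
         l + \<i> * of_real (\<sigma> * pi) * q ?s) (at ?s within half \<sigma>)" if \<sigma>: "\<sigma> \<in> {1, -1}" for \<sigma>
    proof -
      let ?A = "half \<sigma> \<inter> ball ?s \<delta>"
      have at: "at ?s within half \<sigma> = at ?s within ?A"
        by (rule at_within_nhd[of _ "ball ?s \<delta>"]) (use \<delta>(1) in auto)
      have "((\<lambda>\<zeta>. integral {\<alpha>..\<beta>} (J \<zeta>)) \<longlongrightarrow> integral {\<alpha>..\<beta>} (J ?s)) (at ?s within ?A)"
        unfolding tendsto_at_iff_sequentially
      proof (intro allI impI)
        fix X assume X: "\<forall>i. X i \<in> ?A - {?s}" "X \<longlonglongrightarrow> ?s"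
        have Xi: "X i \<in> ball ?s \<delta>" "Im (X i) \<noteq> 0" for i using X(1)[rule_format, of i] by (auto simp: half_def)
        have "(\<lambda>i. integral ?S (J (X i))) \<longlonglongrightarrow> integral ?S (J ?s)"
        proof (rule dominated_convergence(2))
          show "J (X i) integrable_on ?S" for i unfolding spike using split[OF Xi] by blast
          show "(\<lambda>u. C) integrable_on ?S" unfolding spike by (rule integrable_const_ivl)
          fix u assume u: "u \<in> ?S"
          have uB': "complex_of_real u \<in> ball ?s \<delta>" using uB u by blast
          show "norm (J (X i) u) \<le> C" for i
          proof -
            have "complex_of_real u \<noteq> X i" using Xi(2)[of i] by (metis Im_complex_of_real)
            then show ?thesis using C[OF uB' Xi(1)[of i]] by (simp add: J_def q_def)
          qed
          have us: "complex_of_real u \<noteq> ?s" using u by simp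
          have sB: "?s \<in> ball ?s \<delta>" using \<delta>(1) by simp
          have "isCont (\<lambda>\<zeta>. J \<zeta> u) ?s"
            unfolding J_def using us Gne[OF uB' sB us] contG[OF sB] contq[OF sB]
            by (intro continuous_intros) auto
          then show "(\<lambda>i. J (X i) u) \<longlonglongrightarrow> J ?s u" using X(2) by (rule isCont_tendsto_compose)
        qed
        then show "((\<lambda>\<zeta>. integral {\<alpha>..\<beta>} (J \<zeta>)) \<circ> X) \<longlonglongrightarrow> integral {\<alpha>..\<beta>} (J ?s)"
          unfolding spike o_def .
      qed
      then have t1: "((\<lambda>\<zeta>. integral {\<alpha>..\<beta>} (J \<zeta>)) \<longlongrightarrow> integral {\<alpha>..\<beta>} (J ?s)) (at ?s within half \<sigma>)"
        unfolding at .
      have sB: "?s \<in> ball ?s \<delta>" using \<delta>(1) by simp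
      have t2: "(q \<longlongrightarrow> q ?s) (at ?s within half \<sigma>)"
        using contq[OF sB] unfolding isCont_def by (rule tendsto_within_subset) simp
      have "((\<lambda>\<zeta>. integral {\<alpha>..\<beta>} (J \<zeta>) + q \<zeta> * (Ln (of_real \<beta> - \<zeta>) - Ln (of_real \<alpha> - \<zeta>))) \<longlongrightarrow>
          integral {\<alpha>..\<beta>} (J ?s) + q ?s * (Ln (of_real (\<beta> - s)) - Ln (of_real (s - \<alpha>)) + \<i> * of_real (\<sigma> * pi))) (at ?s within half \<sigma>)"
        by (intro tendsto_add tendsto_mult t1 t2 log_kernel_trace \<sigma> ab)
      also have "integral {\<alpha>..\<beta>} (J ?s) + q ?s * (Ln (of_real (\<beta> - s)) - Ln (of_real (s - \<alpha>)) + \<i> * of_real (\<sigma> * pi))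
         = l + \<i> * of_real (\<sigma> * pi) * q ?s" by (simp add: l_def algebra_simps)
      finally show ?thesis
      proof (rule Lim_transform_eventually)
        have "eventually (\<lambda>\<zeta>. \<zeta> \<in> ball ?s \<delta>) (at ?s within half \<sigma>)"
          using eventually_at_in_open'[OF open_ball sB] by (rule filter_leD[OF at_le[OF subset_UNIV]])
        moreover have "eventually (\<lambda>\<zeta>. \<zeta> \<in> half \<sigma>) (at ?s within half \<sigma>)" by (simp add: eventually_at_filter)
        ultimately show "\<forall>\<^sub>F \<zeta> in at ?s within half \<sigma>. integral {\<alpha>..\<beta>} (J \<zeta>) + q \<zeta> * (Ln (of_real \<beta> - \<zeta>) - Ln (of_real \<alpha> - \<zeta>))
           = integral {\<alpha>..\<beta>} (\<lambda>u. E (of_real u) / (G (of_real u) - G \<zeta>))"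
        proof eventually_elim
          fix \<zeta> assume "\<zeta> \<in> ball ?s \<delta>" "\<zeta> \<in> half \<sigma>"
          moreover then have "Im \<zeta> \<noteq> 0" by (auto simp: half_def)
          ultimately show "integral {\<alpha>..\<beta>} (J \<zeta>) + q \<zeta> * (Ln (of_real \<beta> - \<zeta>) - Ln (of_real \<alpha> - \<zeta>))
           = integral {\<alpha>..\<beta>} (\<lambda>u. E (of_real u) / (G (of_real u) - G \<zeta>))" using split by simp
        qed
      qed
    qed
    then show "\<exists>l. \<forall>\<sigma>\<in>{1, -1}. ((\<lambda>\<zeta>. integral {\<alpha>..\<beta>} (\<lambda>u. E (of_real u) / (G (of_real u) - G \<zeta>))) \<longlongrightarrow>
         l + \<i> * of_real (\<sigma> * pi) * (E (of_real s) / deriv G (of_real s))) (at (complex_of_real s) within half \<sigma>)"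
      unfolding q_def by blast
  qed
qed

lemma continuous_on_chart_interval:
  assumes "G holomorphic_on N" "complex_of_real ` S \<subseteq> N"
  shows "continuous_on S (\<lambda>u. G (complex_of_real u))"
  by (rule continuous_on_compose2[OF holomorphic_on_imp_continuous_on[OF assms(1)]])
     (use assms(2) in \<open>auto intro!: continuous_intros\<close>)

lemma cauchy_integral_tendsto:
  fixes D \<gamma> :: "real \<Rightarrow> complex"
  assumes "D absolutely_integrable_on {\<alpha>..\<beta>}" "continuous_on {\<alpha>..\<beta>} \<gamma>" "z0 \<notin> \<gamma> ` {\<alpha>..\<beta>}"
  shows "((\<lambda>z. integral {\<alpha>..\<beta>} (\<lambda>u. D u / (\<gamma> u - z))) \<longlongrightarrow> integral {\<alpha>..\<beta>} (\<lambda>u. D u / (\<gamma> u - z0))) (at z0)"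
proof -
  have "open (- (\<gamma> ` {\<alpha>..\<beta>}))"
    by (intro open_Compl compact_imp_closed compact_continuous_image assms(2)) simp
  then have "isCont (\<lambda>z. integral {\<alpha>..\<beta>} (\<lambda>u. D u / (\<gamma> u - z))) z0"
    by (intro continuous_on_interior[OF holomorphic_on_imp_continuous_on[OF cauchy_integral_holomorphic[OF assms(1,2)]]])
       (use assms(3) in \<open>simp add: interior_open\<close>)
  then show ?thesis by (simp add: isCont_def)
qed

text \<open>The arc is cut near its end. By injectivity the remote piece stays away from
  \<open>G 0\<close>, so its integral converges there, and the factor \<open>z - G 0\<close> sends
  its contribution to \<open>0\<close>.\<close>

lemma endpoint_transform:
  assumes N: "open N" "complex_of_real ` {0..1} \<subseteq> N" "G holomorphic_on N" "inj_on G N"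
    and D: "D absolutely_integrable_on {0..1}"
    and M: "open M" "E holomorphic_on M" "0 \<in> M" and c: "0 < c"
    and DE: "\<And>u. u \<in> {0<..<c} \<Longrightarrow> D u = E (of_real u) / of_real (sqrt u)"
  shows "((\<lambda>z. (z - G 0) * integral {0..1} (\<lambda>u. D u / (G (of_real u) - z))) \<longlongrightarrow> 0)
           (at (G 0) within - (G ` complex_of_real ` {0..1}))"
proof -
  let ?G = "\<lambda>u. G (complex_of_real u)" and ?\<Gamma> = "\<lambda>S. G ` complex_of_real ` S"
  have 0: "0 \<in> N" using N(2) by (force intro: image_eqI[of _ _ 0])
  show ?thesis
  proof (rule endpoint_estimate[OF N(1,3,4) 0 M])
    fix d :: real assume d: "0 < d"
      and est: "\<And>c' D. 0 < c' \<Longrightarrow> c' < d \<Longrightarrow> D absolutely_integrable_on {0..c'} \<Longrightarrow>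
        (\<And>u. u \<in> {0<..<c'} \<Longrightarrow> D u = E (of_real u) / of_real (sqrt u)) \<Longrightarrow>
        ((\<lambda>z. (z - G 0) * integral {0..c'} (\<lambda>u. D u / (G (of_real u) - z))) \<longlongrightarrow> 0)
          (at (G 0) within - (G ` complex_of_real ` {0..c'}))"
    define e where "e = min (min c d) 1 / 2"
    have e: "0 < e" "e < d" "e < 1" "e \<le> c" using c d by (auto simp: e_def)
    have cont: "continuous_on {0..1} ?G" by (rule continuous_on_chart_interval[OF N(3,2)])
    have D1: "D absolutely_integrable_on {0..e}" and D2: "D absolutely_integrable_on {e..1}"
      using absolutely_integrable_on_subinterval[OF D] e by auto
    have c2: "continuous_on {e..1} ?G" using continuous_on_subset[OF cont] e by auto
    have "((\<lambda>z. (z - G 0) * integral {0..e} (\<lambda>u. D u / (?G u - z))) \<longlongrightarrow> 0) (at (G 0) within - ?\<Gamma> {0..e})"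
      by (rule est[OF e(1,2) D1 DE]) (use e(4) in auto)
    moreover have "- ?\<Gamma> {0..1} \<subseteq> - ?\<Gamma> {0..e}" using e by fastforce
    ultimately have t1: "((\<lambda>z. (z - G 0) * integral {0..e} (\<lambda>u. D u / (?G u - z))) \<longlongrightarrow> 0) (at (G 0) within - ?\<Gamma> {0..1})"
      by (rule tendsto_within_subset)
    have "G 0 \<notin> ?G ` {e..1}"
    proof
      assume "G 0 \<in> ?G ` {e..1}"
      then obtain u where u: "u \<in> {e..1}" "G 0 = ?G u" by blast
      have "0 = complex_of_real u" by (rule inj_onD[OF N(4) u(2) 0]) (use N(2) u(1) e in auto)
      then show False using u(1) e(1) by simp
    qed
    from cauchy_integral_tendsto[OF D2 c2 this]
    have "((\<lambda>z. integral {e..1} (\<lambda>u. D u / (?G u - z))) \<longlongrightarrow> integral {e..1} (\<lambda>u. D u / (?G u - G 0))) (at (G 0) within - ?\<Gamma> {0..1})"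
      by (rule tendsto_within_subset) simp
    then have "((\<lambda>z. (z - G 0) * integral {e..1} (\<lambda>u. D u / (?G u - z))) \<longlongrightarrow> (G 0 - G 0) * integral {e..1} (\<lambda>u. D u / (?G u - G 0)))
        (at (G 0) within - ?\<Gamma> {0..1})" by (intro tendsto_intros)
    from tendsto_add[OF t1 this]
    have "((\<lambda>z. (z - G 0) * integral {0..e} (\<lambda>u. D u / (?G u - z)) + (z - G 0) * integral {e..1} (\<lambda>u. D u / (?G u - z))) \<longlongrightarrow> 0)
        (at (G 0) within - ?\<Gamma> {0..1})" by simp
    then show ?thesis
    proof (rule Lim_transform_eventually)
      have "(z - G 0) * integral {0..e} (\<lambda>u. D u / (?G u - z)) + (z - G 0) * integral {e..1} (\<lambda>u. D u / (?G u - z))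
         = (z - G 0) * integral {0..1} (\<lambda>u. D u / (?G u - z))" if z: "z \<in> - ?\<Gamma> {0..1}" for z
      proof -
        have "z \<notin> ?G ` {0..1}" using z by auto
        then have "(\<lambda>u. D u / (?G u - z)) integrable_on {0..1}"
          using cauchy_kernel_integrable[OF D cont] by (intro set_lebesgue_integral_eq_integral(1)) auto
        from Henstock_Kurzweil_Integration.integral_combine[OF _ _ this, of e] show ?thesis
          using e by (simp flip: distrib_left)
      qed
      then show "\<forall>\<^sub>F z in at (G 0) within - ?\<Gamma> {0..1}. (z - G 0) * integral {0..e} (\<lambda>u. D u / (?G u - z))
         + (z - G 0) * integral {e..1} (\<lambda>u. D u / (?G u - z)) = (z - G 0) * integral {0..1} (\<lambda>u. D u / (?G u - z))"
        by (simp add: eventually_at_filter)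
    qed
  qed
qed

text \<open>The two outer pieces of the arc have integrals continuous at the point in question; they
  are absorbed into \<open>l\<close>, and the jump of the middle piece survives.\<close>

lemma interior_transform:
  assumes N: "open N" "complex_of_real ` {0..1} \<subseteq> N" "G holomorphic_on N" "inj_on G N"
    and D: "D absolutely_integrable_on {0..1}" and s: "s \<in> {0<..<1}"
    and M: "open M" "E holomorphic_on M" "complex_of_real s \<in> M" and c: "0 < c"
    and DE: "\<And>u. \<bar>u - s\<bar> < c \<Longrightarrow> D u = E (of_real u)"
  shows "\<exists>l. \<forall>\<sigma>\<in>{1, -1}. ((\<lambda>\<zeta>. integral {0..1} (\<lambda>u. D u / (G (of_real u) - G \<zeta>))) \<longlongrightarrow>
         l + \<i> * of_real (\<sigma> * pi) * (E (of_real s) / deriv G (of_real s))) (at (complex_of_real s) within half \<sigma>)"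
proof -
  let ?G = "\<lambda>u. G (complex_of_real u)" and ?s = "complex_of_real s"
  have sN: "?s \<in> N" using N(2) s by auto
  show ?thesis
  proof (rule interior_estimate[OF N(1,3,4) sN M])
    fix d :: real assume d: "0 < d"
      and est: "\<And>\<alpha> \<beta>. s - d < \<alpha> \<Longrightarrow> \<alpha> < s \<Longrightarrow> s < \<beta> \<Longrightarrow> \<beta> < s + d \<Longrightarrow>
        \<exists>l. \<forall>\<sigma>\<in>{1, -1}. ((\<lambda>\<zeta>. integral {\<alpha>..\<beta>} (\<lambda>u. E (of_real u) / (G (of_real u) - G \<zeta>))) \<longlongrightarrow>
           l + \<i> * of_real (\<sigma> * pi) * (E (of_real s) / deriv G (of_real s))) (at (complex_of_real s) within half \<sigma>)"
    define e where "e = min (min c d) (min s (1 - s)) / 2"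
    have e: "0 < e" "e < d" "e < s" "e < 1 - s" "e < c" using c d s by (auto simp: e_def min_def)
    let ?\<alpha> = "s - e" and ?\<beta> = "s + e"
    have ab: "s - d < ?\<alpha>" "?\<alpha> < s" "s < ?\<beta>" "?\<beta> < s + d" using e by auto
    from est[OF this] obtain l where l': "\<forall>\<sigma>\<in>{1, -1}. ((\<lambda>\<zeta>. integral {?\<alpha>..?\<beta>} (\<lambda>u. E (of_real u) / (G (of_real u) - G \<zeta>))) \<longlongrightarrow>
           l + \<i> * of_real (\<sigma> * pi) * (E (of_real s) / deriv G (of_real s))) (at ?s within half \<sigma>)" by (rule exE)
    note l = bspec[OF l']
    have cont: "continuous_on {0..1} ?G" by (rule continuous_on_chart_interval[OF N(3,2)])
    have outer: "((\<lambda>\<zeta>. integral {\<alpha>..\<beta>} (\<lambda>u. D u / (?G u - G \<zeta>))) \<longlongrightarrow> integral {\<alpha>..\<beta>} (\<lambda>u. D u / (?G u - G ?s))) (at ?s within half \<sigma>)"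
      if ab: "{\<alpha>..\<beta>} \<subseteq> {0..1}" "s \<notin> {\<alpha>..\<beta>}" for \<alpha> \<beta> \<sigma>
    proof -
      have "D absolutely_integrable_on {\<alpha>..\<beta>}" "continuous_on {\<alpha>..\<beta>} ?G"
        using absolutely_integrable_on_subinterval[OF D ab(1)] continuous_on_subset[OF cont ab(1)] by auto
      moreover have "G ?s \<notin> ?G ` {\<alpha>..\<beta>}"
      proof
        assume "G ?s \<in> ?G ` {\<alpha>..\<beta>}"
        then obtain u where u: "u \<in> {\<alpha>..\<beta>}" "G ?s = ?G u" by blast
        have "?s = complex_of_real u" by (rule inj_onD[OF N(4) u(2) sN]) (use N(2) u(1) ab(1) in auto)
        then show False using u(1) ab(2) by simp
      qed
      ultimately have "((\<lambda>z. integral {\<alpha>..\<beta>} (\<lambda>u. D u / (?G u - z))) \<longlongrightarrow> integral {\<alpha>..\<beta>} (\<lambda>u. D u / (?G u - G ?s))) (at (G ?s))"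
        by (rule cauchy_integral_tendsto)
      then have "isCont (\<lambda>z. integral {\<alpha>..\<beta>} (\<lambda>u. D u / (?G u - z))) (G ?s)" by (simp add: isCont_def)
      moreover have "isCont G ?s"
        by (rule continuous_on_interior[OF holomorphic_on_imp_continuous_on[OF N(3)]]) (use N(1) sN in \<open>simp add: interior_open\<close>)
      ultimately have "isCont (\<lambda>\<zeta>. integral {\<alpha>..\<beta>} (\<lambda>u. D u / (?G u - G \<zeta>))) ?s"
        using isCont_o2[where f = G and g = "\<lambda>z. integral {\<alpha>..\<beta>} (\<lambda>u. D u / (?G u - z))" and a = ?s] by blast
      then show ?thesis unfolding isCont_def by (rule tendsto_within_subset) simp
    qed
    define l' where "l' = integral {0..?\<alpha>} (\<lambda>u. D u / (?G u - G ?s)) + l + integral {?\<beta>..1} (\<lambda>u. D u / (?G u - G ?s))"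
    have "((\<lambda>\<zeta>. integral {0..1} (\<lambda>u. D u / (?G u - G \<zeta>))) \<longlongrightarrow>
           l' + \<i> * of_real (\<sigma> * pi) * (E ?s / deriv G ?s)) (at ?s within half \<sigma>)" if \<sigma>: "\<sigma> \<in> {1, -1}" for \<sigma>
    proof -
      have "((\<lambda>\<zeta>. integral {0..?\<alpha>} (\<lambda>u. D u / (?G u - G \<zeta>)) + integral {?\<alpha>..?\<beta>} (\<lambda>u. E (of_real u) / (?G u - G \<zeta>))
          + integral {?\<beta>..1} (\<lambda>u. D u / (?G u - G \<zeta>))) \<longlongrightarrow>
        integral {0..?\<alpha>} (\<lambda>u. D u / (?G u - G ?s)) + (l + \<i> * of_real (\<sigma> * pi) * (E ?s / deriv G ?s))
          + integral {?\<beta>..1} (\<lambda>u. D u / (?G u - G ?s))) (at ?s within half \<sigma>)"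
        by (intro tendsto_add outer l[OF \<sigma>]) (use e in auto)
      also have "integral {0..?\<alpha>} (\<lambda>u. D u / (?G u - G ?s)) + (l + \<i> * of_real (\<sigma> * pi) * (E ?s / deriv G ?s))
          + integral {?\<beta>..1} (\<lambda>u. D u / (?G u - G ?s)) = l' + \<i> * of_real (\<sigma> * pi) * (E ?s / deriv G ?s)"
        by (simp add: l'_def)
      finally show ?thesis
      proof (rule Lim_transform_eventually)
        have "eventually (\<lambda>\<zeta>. \<zeta> \<in> N) (at ?s within half \<sigma>)"
          using eventually_at_in_open'[OF N(1) sN] by (rule filter_leD[OF at_le[OF subset_UNIV]])
        moreover have "eventually (\<lambda>\<zeta>. \<zeta> \<in> half \<sigma>) (at ?s within half \<sigma>)" by (simp add: eventually_at_filter)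
        ultimately show "\<forall>\<^sub>F \<zeta> in at ?s within half \<sigma>. integral {0..?\<alpha>} (\<lambda>u. D u / (?G u - G \<zeta>))
            + integral {?\<alpha>..?\<beta>} (\<lambda>u. E (of_real u) / (?G u - G \<zeta>)) + integral {?\<beta>..1} (\<lambda>u. D u / (?G u - G \<zeta>))
           = integral {0..1} (\<lambda>u. D u / (?G u - G \<zeta>))"
        proof eventually_elim
          fix \<zeta> assume \<zeta>: "\<zeta> \<in> N" "\<zeta> \<in> half \<sigma>"
          have z: "G \<zeta> \<notin> ?G ` {0..1}"
          proof
            assume "G \<zeta> \<in> ?G ` {0..1}"
            then obtain u where u: "u \<in> {0..1}" "G \<zeta> = ?G u" by blast
            have "\<zeta> = complex_of_real u" by (rule inj_onD[OF N(4) u(2) \<zeta>(1)]) (use N(2) u(1) in auto)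
            then show False using \<zeta>(2) by (simp add: half_def)
          qed
          have i: "(\<lambda>u. D u / (?G u - G \<zeta>)) integrable_on {0..1}"
            using cauchy_kernel_integrable[OF D cont z] by (rule set_lebesgue_integral_eq_integral(1))
          then have i': "(\<lambda>u. D u / (?G u - G \<zeta>)) integrable_on {?\<alpha>..1}"
            by (rule integrable_on_subinterval) (use e in auto)
          have "integral {?\<alpha>..?\<beta>} (\<lambda>u. E (of_real u) / (?G u - G \<zeta>)) = integral {?\<alpha>..?\<beta>} (\<lambda>u. D u / (?G u - G \<zeta>))"
            by (rule Henstock_Kurzweil_Integration.integral_cong) (use DE e in auto)
          then show "integral {0..?\<alpha>} (\<lambda>u. D u / (?G u - G \<zeta>))
            + integral {?\<alpha>..?\<beta>} (\<lambda>u. E (of_real u) / (?G u - G \<zeta>)) + integral {?\<beta>..1} (\<lambda>u. D u / (?G u - G \<zeta>))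
           = integral {0..1} (\<lambda>u. D u / (?G u - G \<zeta>))"
            using Henstock_Kurzweil_Integration.integral_combine[OF _ _ i, of ?\<alpha>]
              Henstock_Kurzweil_Integration.integral_combine[OF _ _ i', of ?\<beta>] e by (simp add: add.assoc)
        qed
      qed
    qed
    then show ?thesis by blast
  qed
qed

section \<open>Densities with an inverse square-root singularity\<close>

text \<open>The \<open>a i\<close> are distinct and \<open>G\<close> is univalent, so
  \<open>branch_poly a (G \<zeta>)\<close> is \<open>\<zeta> * B \<zeta>\<close> with
  \<open>B 0 \<noteq> 0\<close>. With a holomorphic root \<open>R\<close> of \<open>B\<close> near
  \<open>0\<close>, the function \<open>V\<close> is \<open>sqrt u * R u\<close> up to a sign, which
  is constant on the interval.\<close>

lemma sqrt_density:
  assumes inj_a: "inj_on a {..3}" and j: "j \<le> 3"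
    and N: "open N" "G holomorphic_on N" "inj_on G N" "0 \<in> N" "G 0 = a j"
    and V: "0 < c1" "continuous_on {0<..<c1} V" "\<And>u. u \<in> {0<..<c1} \<Longrightarrow> (V u)\<^sup>2 = branch_poly a (G (complex_of_real u))"
    and M: "open M" "\<Phi> holomorphic_on M" "0 \<in> M"
  obtains c E M' where "0 < c" "c \<le> c1" "open M'" "0 \<in> M'" "E holomorphic_on M'"
    "\<And>u. u \<in> {0<..<c} \<Longrightarrow> \<Phi> (of_real u) / V u = E (of_real u) / of_real (sqrt u)"
proof -
  define G' where "G' \<zeta> = (if \<zeta> = 0 then deriv G 0 else (G \<zeta> - G 0) / (\<zeta> - 0))" for \<zeta>
  have G': "G' holomorphic_on N"
    unfolding G'_def by (rule pole_lemma[OF N(2)]) (use N in \<open>simp add: interior_open\<close>)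
  define B where "B \<zeta> = G' \<zeta> * (\<Prod>i\<in>{..3}-{j}. G \<zeta> - a i)" for \<zeta>
  have B: "B holomorphic_on N" unfolding B_def by (intro holomorphic_intros G' N)
  have Beq: "branch_poly a (G \<zeta>) = \<zeta> * B \<zeta>" for \<zeta>
    unfolding branch_poly_split[OF j] B_def G'_def using N(5) by auto
  have "G' 0 \<noteq> 0" using holomorphic_injective_imp_regular[OF N(2,1,3,4)] by (simp add: G'_def)
  moreover have "G 0 \<noteq> a i" if "i \<in> {..3} - {j}" for i
    using inj_onD[OF inj_a, of j i] that j N(5) by auto
  ultimately have B0: "B 0 \<noteq> 0" unfolding B_def by auto
  have "open (N \<inter> B -` (- {0}))"
    by (rule continuous_open_preimage[OF holomorphic_on_imp_continuous_on[OF B] N(1)]) auto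
  then obtain d where d: "d > 0" "ball 0 d \<subseteq> N \<inter> B -` (- {0})" using openE[of _ 0] B0 N(4) by blast
  have dN: "ball 0 d \<subseteq> N" using d(2) by blast
  obtain R where R: "R holomorphic_on ball 0 d" "\<And>z. z \<in> ball 0 d \<Longrightarrow> B z = R z ^ 2"
    using contractible_imp_holomorphic_sqrt[OF holomorphic_on_subset[OF B dN] convex_imp_contractible[OF convex_ball]] d(2)
    by (metis ComplD IntD2 singletonI subsetD vimageD)
  have R0: "R z \<noteq> 0" if "z \<in> ball 0 d" for z using R(2)[OF that] d(2) that by force
  define c where "c = min d c1"
  have c: "0 < c" "c \<le> c1" "c \<le> d" using d V by (auto simp: c_def)
  have uB: "complex_of_real u \<in> ball 0 d" if "u \<in> {0<..<c}" for u using that c by simp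
  define q where "q u = V u / (of_real (sqrt u) * R (of_real u))" for u
  have contq: "continuous_on {0<..<c} q"
    unfolding q_def
  proof (intro continuous_intros)
    have "{0<..<c} \<subseteq> {0<..<c1}" using c by auto
    then show "continuous_on {0<..<c} V" by (rule continuous_on_subset[OF V(2)])
    show "continuous_on {0<..<c} (\<lambda>u. R (complex_of_real u))"
      by (rule continuous_on_chart_interval[OF R(1)]) (use uB in blast)
    show "\<forall>u\<in>{0<..<c}. complex_of_real (sqrt u) * R (complex_of_real u) \<noteq> 0" using R0[OF uB] by auto
  qed
  have q1: "(q u)\<^sup>2 = 1" if u: "u \<in> {0<..<c}" for u
  proof -
    have "(V u)\<^sup>2 = of_real u * (R (of_real u))\<^sup>2" using V(3)[of u] Beq[of "of_real u"] R(2)[OF uB[OF u]] u c by simp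
    moreover have "(complex_of_real (sqrt u))\<^sup>2 = of_real u" using u by (simp flip: of_real_power)
    ultimately show ?thesis using R0[OF uB[OF u]] u unfolding q_def by (simp add: power_divide power_mult_distrib)
  qed
  obtain \<sigma> where \<sigma>: "\<sigma>\<^sup>2 = 1" "\<And>u. u \<in> {0<..<c} \<Longrightarrow> q u = \<sigma>"
    by (rule connected_sq_const[OF _ contq q1]) auto
  define E where "E \<zeta> = \<Phi> \<zeta> / (\<sigma> * R \<zeta>)" for \<zeta>
  have \<sigma>0: "\<sigma> \<noteq> 0" using \<sigma>(1) by auto
  show ?thesis
  proof (rule that[OF c(1,2), of "M \<inter> ball 0 d" E])
    show "E holomorphic_on M \<inter> ball 0 d"
      unfolding E_def using R0 \<sigma>0
      by (intro holomorphic_intros holomorphic_on_subset[OF M(2)] holomorphic_on_subset[OF R(1)]) auto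
    fix u assume u: "u \<in> {0<..<c}"
    have "V u = \<sigma> * (of_real (sqrt u) * R (of_real u))"
      using \<sigma>(2)[OF u] R0[OF uB[OF u]] u unfolding q_def by (auto simp: field_simps)
    then show "\<Phi> (of_real u) / V u = E (of_real u) / of_real (sqrt u)" by (simp add: E_def mult.commute mult.left_commute)
  qed (use M d in auto)
qed

section \<open>The Cauchy transform on the tripod\<close>

lemma has_integral_reflect_unit:
  fixes f :: "real \<Rightarrow> 'a::euclidean_space"
  assumes "(f has_integral i) {0..1}" shows "((\<lambda>u. f (1 - u)) has_integral i) {0..1}"
proof -
  have "(\<lambda>x::real. (1 / (- 1)) *\<^sub>R x + - ((1 / (- 1)) *\<^sub>R 1)) ` cbox 0 1 = {0..1}"
    by (auto simp: image_iff intro!: bexI[of _ "1 - _"])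
  then show ?thesis
    using has_integral_affinity[of f i 0 1 "- 1" 1] assms by (simp add: cbox_interval)
qed

lemma integral_reflect_unit:
  fixes f :: "real \<Rightarrow> 'a::euclidean_space"
  assumes "f integrable_on {0..1}" shows "integral {0..1} (\<lambda>u. f (1 - u)) = integral {0..1} f"
  using has_integral_reflect_unit[OF integrable_integral[OF assms]] by (rule integral_unique)

lemma absolutely_integrable_reflect_unit:
  fixes f :: "real \<Rightarrow> complex"
  assumes "f absolutely_integrable_on {0..1}" shows "(\<lambda>u. f (1 - u)) absolutely_integrable_on {0..1}"
  using assms has_integral_reflect_unit[of f] has_integral_reflect_unit[of "\<lambda>u. norm (f u)"]
  unfolding absolutely_integrable_on_def integrable_on_def by blast

lemma inverse_sqrt_density_bound:
  fixes D :: "real \<Rightarrow> complex"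
  assumes M: "open M" "E holomorphic_on M" "0 \<in> M" and c: "0 < c"
    and DE: "\<And>u. u \<in> {0<..<c} \<Longrightarrow> D u = E (of_real u) / of_real (sqrt u)"
  obtains r A where "0 < r" "r < 1/2" "0 \<le> A" "\<And>u. u \<in> {0<..r} \<Longrightarrow> norm (D u) \<le> A * (1 / sqrt u)"
proof -
  have "isCont E 0"
    by (rule continuous_on_interior[OF holomorphic_on_imp_continuous_on[OF M(2)]]) (use M in \<open>simp add: interior_open\<close>)
  then have "eventually (\<lambda>\<zeta>. dist (E \<zeta>) (E 0) < 1) (at 0)" unfolding isCont_def by (rule tendstoD) simp
  then obtain d where d: "d > 0" "\<And>\<zeta>. \<zeta> \<noteq> 0 \<Longrightarrow> dist \<zeta> 0 < d \<Longrightarrow> dist (E \<zeta>) (E 0) < 1"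
    unfolding eventually_at by auto
  define r where "r = min (min c d) (1/2) / 2"
  have r: "0 < r" "r < c" "r < d" "r < 1/2" using c d(1) by (auto simp: r_def)
  show ?thesis
  proof (rule that[OF r(1,4), of "norm (E 0) + 1"])
    fix u assume u: "u \<in> {0<..r}"
    have "dist (E (of_real u)) (E 0) < 1" by (rule d(2)) (use u r in auto)
    then have "norm (E (of_real u)) \<le> norm (E 0) + 1"
      using norm_triangle_sub[of "E (of_real u)" "E 0"] by (simp add: dist_norm)
    moreover have "norm (D u) = norm (E (of_real u)) * (1 / sqrt u)"
      using DE[of u] u r by (simp add: norm_divide)
    ultimately show "norm (D u) \<le> (norm (E 0) + 1) * (1 / sqrt u)"
      using u by (simp add: divide_right_mono)
  qed simp
qed

text \<open>Holomorphy of \<open>h\<close> around \<open>\<Delta>\<close>, and not only on it, lets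
  the numerator of the density be continued off the straightened arcs, as the kernel comparison
  requires. In the end \<open>h\<close> is \<open>1 / p\<close>.\<close>

locale tripod_density = tripod_chart a \<Delta> w g N \<kappa> W
  for a :: "nat \<Rightarrow> complex" and \<Delta> :: "complex set" and w :: "complex \<Rightarrow> complex"
    and g :: "nat \<Rightarrow> complex \<Rightarrow> complex" and N :: "nat \<Rightarrow> complex set"
    and \<kappa> :: "nat \<Rightarrow> real" and W :: "nat \<Rightarrow> complex \<Rightarrow> complex" +
  fixes h :: "complex \<Rightarrow> complex" and H :: "complex set"
  assumes open_H: "open H" and \<Delta>_H: "\<Delta> \<subseteq> H" and holo_h: "h holomorphic_on H"
begin

definition numer :: "nat \<Rightarrow> complex \<Rightarrow> complex" where
  "numer k \<zeta> = h (g k \<zeta>) * deriv (g k) \<zeta>"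

text \<open>The differential \<open>h(t) dt / w(t)\<close> pulled back to the parameter interval,
  with the left trace of \<open>w\<close> represented by \<open>W k\<close>.\<close>

definition dens :: "nat \<Rightarrow> real \<Rightarrow> complex" where
  "dens k u = numer k (of_real u) / W k (of_real u)"

definition arc_transform :: "nat \<Rightarrow> complex \<Rightarrow> complex" where
  "arc_transform k z = integral {0..1} (\<lambda>u. dens k u / (g k (of_real u) - z))"

definition NH :: "nat \<Rightarrow> complex set" where "NH k = N k \<inter> g k -` H"

lemma NH: assumes k: "k \<in> {1..3}"
  shows "open (NH k)" "complex_of_real ` {0..1} \<subseteq> NH k" "numer k holomorphic_on NH k" "NH k \<subseteq> N k"
proof -
  show "open (NH k)" unfolding NH_def
    by (rule continuous_open_preimage[OF holomorphic_on_imp_continuous_on[OF holo_g[OF k]] open_N[OF k] open_H])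
  show "complex_of_real ` {0..1} \<subseteq> NH k"
    using segment_N[OF k] arc_mem[OF k] \<Delta>_H unfolding NH_def by blast
  show sub: "NH k \<subseteq> N k" unfolding NH_def by blast
  have "(h \<circ> g k) holomorphic_on NH k"
    by (rule holomorphic_on_compose_gen[OF holomorphic_on_subset[OF holo_g[OF k] sub] holo_h]) (auto simp: NH_def)
  moreover have "deriv (g k) holomorphic_on NH k"
    by (rule holomorphic_on_subset[OF holomorphic_deriv[OF holo_g[OF k] open_N[OF k]] sub])
  ultimately have "(\<lambda>\<zeta>. (h \<circ> g k) \<zeta> * deriv (g k) \<zeta>) holomorphic_on NH k" by (rule holomorphic_on_mult)
  then show "numer k holomorphic_on NH k" by (simp add: numer_def[abs_def] o_def)
qed

lemma cont_W: "k \<in> {1..3} \<Longrightarrow> continuous_on {0<..<1} (\<lambda>u. W k (complex_of_real u))"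
  by (rule continuous_on_chart_interval[OF holo_W]) (use of_real_sector[of k] in auto)

lemma W_sq_real: "k \<in> {1..3} \<Longrightarrow> u \<in> {0<..<1} \<Longrightarrow> (W k (complex_of_real u))\<^sup>2 = branch_poly a (g k (of_real u))"
  using W_sq[OF _ of_real_sector] by simp

lemma unit_ends: "k \<in> {1..3} \<Longrightarrow> 0 \<in> NH k" "k \<in> {1..3} \<Longrightarrow> 1 \<in> NH k"
  using NH(2)[of k] by (force intro: image_eqI[of _ _ 0], force intro: image_eqI[of _ _ 1])

lemma dens_start:
  assumes k: "k \<in> {1..3}"
  obtains c E M where "0 < c" "c \<le> 1" "open M" "0 \<in> M" "E holomorphic_on M"
    "\<And>u. u \<in> {0<..<c} \<Longrightarrow> dens k u = E (of_real u) / of_real (sqrt u)"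
proof (rule sqrt_density[OF inj_a _ open_N[OF k] holo_g[OF k] inj_g[OF k] _ g_0[OF k] _ cont_W[OF k] W_sq_real[OF k]
     NH(1)[OF k] NH(3)[OF k] unit_ends(1)[OF k]])
  show "0 \<in> N k" using unit_ends(1)[OF k] NH(4)[OF k] by blast
qed (use that in \<open>auto simp: dens_def\<close>)

text \<open>Reversing the parameter moves the tip from \<open>1\<close> to \<open>0\<close>, so one
  endpoint estimate serves both ends of an arc.\<close>

definition N' :: "nat \<Rightarrow> complex set" where "N' k = (\<lambda>\<zeta>. 1 - \<zeta>) -` N k"

lemma reversed_chart:
  assumes k: "k \<in> {1..3}"
  shows "open (N' k)" "complex_of_real ` {0..1} \<subseteq> N' k" "(\<lambda>\<zeta>. g k (1 - \<zeta>)) holomorphic_on N' k"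
    "inj_on (\<lambda>\<zeta>. g k (1 - \<zeta>)) (N' k)" "0 \<in> N' k"
    "(\<lambda>\<zeta>. g k (1 - \<zeta>)) ` complex_of_real ` {0..1} = g k ` complex_of_real ` {0..1}"
proof -
  show "open (N' k)" unfolding N'_def by (intro open_vimage open_N[OF k] continuous_intros)
  have e: "(\<lambda>\<zeta>. 1 - \<zeta>) ` complex_of_real ` {0..1} = complex_of_real ` {0..1}"
  proof (intro equalityI subsetI)
    fix z assume "z \<in> complex_of_real ` {0..1}"
    then obtain u where "z = of_real u" "u \<in> {0..1}" by blast
    then have "z = 1 - complex_of_real (1 - u)" "1 - u \<in> {0..1}" by auto
    then show "z \<in> (\<lambda>\<zeta>. 1 - \<zeta>) ` complex_of_real ` {0..1}" by blast
  next
    fix z assume "z \<in> (\<lambda>\<zeta>. 1 - \<zeta>) ` complex_of_real ` {0..1}"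
    then obtain u where "z = 1 - of_real u" "u \<in> {0..1}" by blast
    then have "z = complex_of_real (1 - u)" "1 - u \<in> {0..1}" by auto
    then show "z \<in> complex_of_real ` {0..1}" by blast
  qed
  show "complex_of_real ` {0..1} \<subseteq> N' k" unfolding N'_def image_subset_iff_subset_vimage[symmetric] e by (rule segment_N[OF k])
  then show "0 \<in> N' k" by (force intro: image_eqI[of _ _ 0])
  have "(g k \<circ> (\<lambda>\<zeta>. 1 - \<zeta>)) holomorphic_on N' k"
    by (rule holomorphic_on_compose_gen[OF _ holo_g[OF k]]) (auto simp: N'_def intro!: holomorphic_intros)
  then show "(\<lambda>\<zeta>. g k (1 - \<zeta>)) holomorphic_on N' k" by (simp add: o_def)
  show "inj_on (\<lambda>\<zeta>. g k (1 - \<zeta>)) (N' k)"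
    using inj_g[OF k] unfolding inj_on_def N'_def by (metis vimageE diff_left_imp_eq)
  show "(\<lambda>\<zeta>. g k (1 - \<zeta>)) ` complex_of_real ` {0..1} = g k ` complex_of_real ` {0..1}"
    using e by (metis image_image)
qed

lemma dens_finish:
  assumes k: "k \<in> {1..3}"
  obtains c E M where "0 < c" "c \<le> 1" "open M" "0 \<in> M" "E holomorphic_on M"
    "\<And>u. u \<in> {0<..<c} \<Longrightarrow> dens k (1 - u) = E (of_real u) / of_real (sqrt u)"
proof (rule sqrt_density[OF inj_a _ reversed_chart(1,3,4,5)[OF k]])
  show "k \<le> 3" using k by simp
  show "g k (1 - 0) = a k" using g_1[OF k] by simp
  show "continuous_on {0<..<1} (\<lambda>u. W k (complex_of_real (1 - u)))"
    by (rule continuous_on_compose2[OF cont_W[OF k]]) (auto intro!: continuous_intros)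
  show "(W k (complex_of_real (1 - u)))\<^sup>2 = branch_poly a (g k (1 - complex_of_real u))" if "u \<in> {0<..<1}" for u
    using W_sq_real[OF k, of "1 - u"] that by simp
  show "open ((\<lambda>\<zeta>. 1 - \<zeta>) -` NH k)" by (intro open_vimage NH(1)[OF k] continuous_intros)
  have "(numer k \<circ> (\<lambda>\<zeta>. 1 - \<zeta>)) holomorphic_on ((\<lambda>\<zeta>. 1 - \<zeta>) -` NH k)"
    by (rule holomorphic_on_compose_gen[OF _ NH(3)[OF k]]) (auto intro!: holomorphic_intros)
  then show "(\<lambda>\<zeta>. numer k (1 - \<zeta>)) holomorphic_on ((\<lambda>\<zeta>. 1 - \<zeta>) -` NH k)" by (simp add: o_def)
  show "0 \<in> (\<lambda>\<zeta>. 1 - \<zeta>) -` NH k" using unit_ends(2)[OF k] by simp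
  fix c E M assume "0 < c" "c \<le> 1" "open M" "0 \<in> M" "E holomorphic_on M"
    "\<And>u. u \<in> {0<..<c} \<Longrightarrow> numer k (1 - complex_of_real u) / W k (complex_of_real (1 - u)) = E (of_real u) / of_real (sqrt u)"
  then show ?thesis using that[of c M E] by (simp add: dens_def)
qed simp

lemma cont_dens: "k \<in> {1..3} \<Longrightarrow> continuous_on {0<..<1} (dens k)"
proof -
  assume k: "k \<in> {1..3}"
  have "continuous_on {0<..<1} (\<lambda>u. numer k (complex_of_real u))"
    by (rule continuous_on_chart_interval[OF NH(3)[OF k]]) (use NH(2)[OF k] in auto)
  then show ?thesis unfolding dens_def[abs_def]
    using cont_W[OF k] W_nonzero[OF k] by (intro continuous_intros) auto
qed

text \<open>The density is continuous inside the interval and grows at both ends at most like the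
  inverse square root of the distance to the end; a sum of two such functions dominates it.\<close>

lemma dens_integrable:
  assumes k: "k \<in> {1..3}" shows "dens k absolutely_integrable_on {0..1}"
proof -
  obtain c0 E0 M0 where 0: "0 < c0" "c0 \<le> 1" "open M0" "0 \<in> M0" "E0 holomorphic_on M0"
    "\<And>u. u \<in> {0<..<c0} \<Longrightarrow> dens k u = E0 (of_real u) / of_real (sqrt u)" using dens_start[OF k] by metis
  obtain r0 A0 where A0: "0 < r0" "r0 < 1/2" "0 \<le> A0" "\<And>u. u \<in> {0<..r0} \<Longrightarrow> norm (dens k u) \<le> A0 * (1 / sqrt u)"
    using inverse_sqrt_density_bound[OF 0(3,5,4,1,6)] by metis
  obtain c1 E1 M1 where 1: "0 < c1" "c1 \<le> 1" "open M1" "0 \<in> M1" "E1 holomorphic_on M1"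
    "\<And>u. u \<in> {0<..<c1} \<Longrightarrow> dens k (1 - u) = E1 (of_real u) / of_real (sqrt u)" using dens_finish[OF k] by metis
  obtain r1 A1 where A1: "0 < r1" "r1 < 1/2" "0 \<le> A1" "\<And>u. u \<in> {0<..r1} \<Longrightarrow> norm (dens k (1 - u)) \<le> A1 * (1 / sqrt u)"
    using inverse_sqrt_density_bound[of M1 E1 c1 "\<lambda>u. dens k (1 - u)", OF 1(3,5,4,1,6)] by metis
  have "bounded (dens k ` {r0..1 - r1})"
    using A0 A1 by (intro compact_imp_bounded compact_continuous_image continuous_on_subset[OF cont_dens[OF k]]) auto
  then obtain A2 where A2: "0 < A2" "\<And>u. u \<in> {r0..1 - r1} \<Longrightarrow> norm (dens k u) \<le> A2" unfolding bounded_pos by auto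
  define A where "A = A0 + A1 + A2"
  have A: "0 \<le> A" "A0 \<le> A" "A1 \<le> A" "A2 \<le> A" using A0 A1 A2 by (auto simp: A_def)
  have bound: "norm (dens k u) \<le> A * (1 / sqrt u) + A * (1 / sqrt (1 - u))" if u: "u \<in> {0<..<1}" for u
  proof -
    have p: "0 \<le> A * (1 / sqrt u)" "0 \<le> A * (1 / sqrt (1 - u))" using u A by auto
    consider "u \<le> r0" | "1 - u \<le> r1" | "u \<in> {r0..1 - r1}" by fastforce
    then show ?thesis
    proof cases
      case 1
      then have "norm (dens k u) \<le> A0 * (1 / sqrt u)" using A0(4) u by simp
      also have "\<dots> \<le> A * (1 / sqrt u)" using A u by (intro mult_right_mono) auto
      finally show ?thesis using p by linarith
    next
      case 2
      then have "norm (dens k (1 - (1 - u))) \<le> A1 * (1 / sqrt (1 - u))" using A1(4)[of "1 - u"] u by simp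
      also have "\<dots> \<le> A * (1 / sqrt (1 - u))" using A u by (intro mult_right_mono) auto
      finally show ?thesis using p by simp
    next
      case 3
      have "norm (dens k u) \<le> A * 1" using A2(2)[OF 3] A by simp
      also have "\<dots> \<le> A * (1 / sqrt u)" using A u by (intro mult_left_mono) auto
      finally show ?thesis using p by linarith
    qed
  qed
  have s: "((\<lambda>u. 1 / sqrt u) has_integral 2) {0..1}" using has_integral_inverse_sqrt[of 1] by simp
  have "(\<lambda>u. A * (1 / sqrt u) + A * (1 / sqrt (1 - u))) integrable_on {0..1}"
    by (intro integrable_add integrable_on_mult_right has_integral_integrable[OF s]
        has_integral_integrable[OF has_integral_reflect_unit[OF s]])
  then have "(\<lambda>u. A * (1 / sqrt u) + A * (1 / sqrt (1 - u))) integrable_on {0<..<1}"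
    by (simp only: integrable_on_open_interval_real)
  then have "dens k absolutely_integrable_on {0<..<1}"
    by (rule measurable_bounded_by_integrable_imp_absolutely_integrable[rotated 2])
       (use bound continuous_imp_measurable_on_sets_lebesgue[OF cont_dens[OF k]] in auto)
  then show ?thesis using absolutely_integrable_on_open_interval[where f = "dens k" and a = 0 and b = 1] by simp
qed

section \<open>The transforms of the single arcs and their sum\<close>

lemma cont_arc: "k \<in> {1..3} \<Longrightarrow> continuous_on {0..1} (\<lambda>u. g k (complex_of_real u))"
  by (rule continuous_on_chart_interval[OF holo_g segment_N])

lemma arc_transform_holomorphic:
  "k \<in> {1..3} \<Longrightarrow> arc_transform k holomorphic_on - (g k ` complex_of_real ` {0..1})"
  using cauchy_integral_holomorphic[OF dens_integrable cont_arc, of k]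
  unfolding arc_transform_def[abs_def] image_image .

lemma arc_transform_at_infinity:
  "k \<in> {1..3} \<Longrightarrow> arc_transform k \<in> O[at_infinity](\<lambda>z. 1 / z)"
  using cauchy_integral_at_infinity[OF dens_integrable cont_arc, of k]
  unfolding arc_transform_def[abs_def] .

lemma arc_transform_isCont:
  assumes "k \<in> {1..3}" "z \<notin> g k ` complex_of_real ` {0..1}"
  shows "isCont (arc_transform k) z"
proof -
  have "open (- (g k ` complex_of_real ` {0..1}))"
    using compact_imp_closed[OF compact_arc[OF assms(1)]] by auto
  then show ?thesis
    by (intro continuous_on_interior[OF holomorphic_on_imp_continuous_on[OF arc_transform_holomorphic[OF assms(1)]]])
       (use assms(2) in \<open>simp add: interior_open\<close>)
qed

lemma arc_subset_\<Delta>: "k \<in> {1..3} \<Longrightarrow> - \<Delta> \<subseteq> - (g k ` complex_of_real ` {0..1})"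
  unfolding \<Delta>_eq by blast

lemma arc_transform_start:
  assumes k: "k \<in> {1..3}"
  shows "((\<lambda>z. (z - a 0) * arc_transform k z) \<longlongrightarrow> 0) (at (a 0) within - \<Delta>)"
proof -
  obtain c E M where 0: "0 < c" "c \<le> 1" "open M" "0 \<in> M" "E holomorphic_on M"
    "\<And>u. u \<in> {0<..<c} \<Longrightarrow> dens k u = E (of_real u) / of_real (sqrt u)" using dens_start[OF k] by metis
  from endpoint_transform[OF open_N[OF k] segment_N[OF k] holo_g[OF k] inj_g[OF k] dens_integrable[OF k] 0(3,5,4,1,6)]
  have "((\<lambda>z. (z - a 0) * arc_transform k z) \<longlongrightarrow> 0) (at (a 0) within - (g k ` complex_of_real ` {0..1}))"
    unfolding g_0[OF k] arc_transform_def .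
  then show ?thesis by (rule tendsto_within_subset) (rule arc_subset_\<Delta>[OF k])
qed

lemma arc_transform_finish:
  assumes k: "k \<in> {1..3}"
  shows "((\<lambda>z. (z - a k) * arc_transform k z) \<longlongrightarrow> 0) (at (a k) within - \<Delta>)"
proof -
  obtain c E M where 1: "0 < c" "c \<le> 1" "open M" "0 \<in> M" "E holomorphic_on M"
    "\<And>u. u \<in> {0<..<c} \<Longrightarrow> dens k (1 - u) = E (of_real u) / of_real (sqrt u)" using dens_finish[OF k] by metis
  have "((\<lambda>z. (z - g k (1 - 0)) * integral {0..1} (\<lambda>u. dens k (1 - u) / (g k (1 - of_real u) - z))) \<longlongrightarrow> 0)
      (at (g k (1 - 0)) within - ((\<lambda>\<zeta>. g k (1 - \<zeta>)) ` complex_of_real ` {0..1}))"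
    by (rule endpoint_transform[OF reversed_chart(1-4)[OF k] absolutely_integrable_reflect_unit[OF dens_integrable[OF k]] 1(3,5,4,1,6)])
  then have "((\<lambda>z. (z - a k) * integral {0..1} (\<lambda>u. dens k (1 - u) / (g k (of_real (1 - u)) - z))) \<longlongrightarrow> 0)
      (at (a k) within - (g k ` complex_of_real ` {0..1}))"
    unfolding reversed_chart(6)[OF k] using g_1[OF k] by simp
  then have "((\<lambda>z. (z - a k) * integral {0..1} (\<lambda>u. dens k (1 - u) / (g k (of_real (1 - u)) - z))) \<longlongrightarrow> 0)
      (at (a k) within - \<Delta>)"
    by (rule tendsto_within_subset) (rule arc_subset_\<Delta>[OF k])
  then show ?thesis
  proof (rule Lim_transform_eventually)
    have "integral {0..1} (\<lambda>u. dens k (1 - u) / (g k (of_real (1 - u)) - z)) = arc_transform k z" if "z \<in> - \<Delta>" for z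
    proof -
      have "z \<notin> (\<lambda>u. g k (complex_of_real u)) ` {0..1}" using that arc_subset_\<Delta>[OF k] by (auto simp: image_image)
      then have "(\<lambda>u. dens k u / (g k (of_real u) - z)) integrable_on {0..1}"
        using cauchy_kernel_integrable[OF dens_integrable[OF k] cont_arc[OF k]]
        by (intro set_lebesgue_integral_eq_integral(1)) auto
      from integral_reflect_unit[OF this] show ?thesis unfolding arc_transform_def .
    qed
    then show "\<forall>\<^sub>F z in at (a k) within - \<Delta>. (z - a k) * integral {0..1} (\<lambda>u. dens k (1 - u) / (g k (of_real (1 - u)) - z))
        = (z - a k) * arc_transform k z"
      by (simp add: eventually_at_filter)
  qed
qed

lemma arc_transform_side:
  assumes k: "k \<in> {1..3}" and s: "s \<in> {0<..<1}"
  shows "\<exists>l. \<forall>\<sigma>\<in>{1, -1}. ((\<lambda>\<zeta>. arc_transform k (g k \<zeta>)) \<longlongrightarrow>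
           l + \<i> * of_real (\<sigma> * pi) * (h (g k (of_real s)) / W k (of_real s))) (at (complex_of_real s) within half \<sigma>)"
proof -
  let ?M = "NH k \<inter> (sector (\<kappa> k) \<inter> {\<zeta>. Re \<zeta> < 1})" and ?s = "complex_of_real s"
  have nz: "W k \<zeta> \<noteq> 0" if "\<zeta> \<in> ?M" for \<zeta>
  proof
    assume "W k \<zeta> = 0"
    then have "branch_poly a (g k \<zeta>) = 0" using W_sq[OF k, of \<zeta>] that by simp
    then show False using arc_point_neq_branch_point[OF k, of \<zeta>] that unfolding branch_poly_eq_0_iff by blast
  qed
  have opM: "open ?M" by (intro open_Int NH(1)[OF k] open_sector open_halfspace_Re_lt)
  have E: "(\<lambda>\<zeta>. numer k \<zeta> / W k \<zeta>) holomorphic_on ?M"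
    using nz by (intro holomorphic_on_divide holomorphic_on_subset[OF NH(3)[OF k]] holomorphic_on_subset[OF holo_W[OF k]]) auto
  have sM: "?s \<in> ?M" using NH(2)[OF k] of_real_sector[OF k, of s] s by auto
  have "deriv (g k) ?s \<noteq> 0"
    by (rule holomorphic_injective_imp_regular[OF holo_g[OF k] open_N[OF k] inj_g[OF k]]) (use segment_N[OF k] s in auto)
  \<comment> \<open>The derivative of the chart, brought in by the pullback, cancels against the one
    in the residue: the jump does not depend on the chart.\<close>
  then have e: "numer k ?s / W k ?s / deriv (g k) ?s = h (g k ?s) / W k ?s" by (simp add: numer_def)
  show ?thesis
    using interior_transform[OF open_N[OF k] segment_N[OF k] holo_g[OF k] inj_g[OF k] dens_integrable[OF k] s opM E sM, of 1]
    unfolding e arc_transform_def by (simp add: dens_def)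
qed

definition transform :: "complex \<Rightarrow> complex" where
  "transform z = 1 / (of_real pi * \<i>) * (\<Sum>k\<in>{1..3}. arc_transform k z)"

lemma transform_holomorphic: "transform holomorphic_on - \<Delta>"
  unfolding transform_def[abs_def]
  by (intro holomorphic_on_mult holomorphic_on_const holomorphic_on_sum
      holomorphic_on_subset[OF arc_transform_holomorphic] arc_subset_\<Delta>)

lemma transform_at_infinity: "transform \<in> O[at_infinity](\<lambda>z. 1 / z)"
  unfolding transform_def[abs_def]
  by (intro landau_o.big.cmult_in_iff[THEN iffD2] big_sum_in_bigo arc_transform_at_infinity) auto

lemma transform_end:
  assumes j: "j \<le> 3" shows "((\<lambda>z. (z - a j) * transform z) \<longlongrightarrow> 0) (at (a j) within - \<Delta>)"
proof -
  have "((\<lambda>z. (z - a j) * arc_transform k z) \<longlongrightarrow> 0) (at (a j) within - \<Delta>)" if k: "k \<in> {1..3}" for k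
  proof (cases "j = 0")
    case True then show ?thesis using arc_transform_start[OF k] by simp
  next
    case False
    then have j1: "j \<in> {1..3}" using j by auto
    show ?thesis
    proof (cases "j = k")
      case True then show ?thesis using arc_transform_finish[OF k] by simp
    next
      case False
      have "a j \<notin> g k ` complex_of_real ` {0..1}"
        using disjoint_arcs[OF j1 k _ of_real_sector[OF j1, of 1]] False g_1[OF j1] by simp
      then have "((\<lambda>z. arc_transform k z) \<longlongrightarrow> arc_transform k (a j)) (at (a j) within - \<Delta>)"
        using arc_transform_isCont[OF k] unfolding isCont_def by (blast intro: tendsto_within_subset)
      then have "((\<lambda>z. (z - a j) * arc_transform k z) \<longlongrightarrow> (a j - a j) * arc_transform k (a j)) (at (a j) within - \<Delta>)"
        by (intro tendsto_intros)
      then show ?thesis by simp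
    qed
  qed
  then have "((\<lambda>z. 1 / (of_real pi * \<i>) * (\<Sum>k\<in>{1..3}. (z - a j) * arc_transform k z)) \<longlongrightarrow>
      1 / (of_real pi * \<i>) * (\<Sum>k\<in>{1..3::nat}. 0)) (at (a j) within - \<Delta>)"
    by (intro tendsto_mult tendsto_const tendsto_sum)
  moreover have "1 / (of_real pi * \<i>) * (\<Sum>k\<in>{1..3}. (z - a j) * arc_transform k z) = (z - a j) * transform z" for z
    unfolding transform_def sum_distrib_left[symmetric] by (rule mult.left_commute)
  ultimately show ?thesis by simp
qed

text \<open>Only the \<open>k\<close>-th arc jumps at this point, the other two being at positive
  distance. The normalisation \<open>1 / (pi * \<i>)\<close> turns the jump term into
  \<open>\<sigma> * h / W\<close>, which is \<open>h\<close> over the trace of \<open>w\<close> from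
  the same side.\<close>

lemma transform_side:
  assumes k: "k \<in> {1..3}" and s: "s \<in> {0<..<1}"
  shows "\<exists>l. \<forall>\<sigma>\<in>{1, -1}. ((\<lambda>\<zeta>. transform (g k \<zeta>)) \<longlongrightarrow>
           l + of_real \<sigma> * (h (g k (of_real s)) / W k (of_real s))) (at (complex_of_real s) within half \<sigma>)"
proof -
  let ?s = "complex_of_real s" and ?q = "h (g k (of_real s)) / W k (of_real s)"
  obtain l where l: "\<And>\<sigma>. \<sigma> \<in> {1, -1} \<Longrightarrow> ((\<lambda>\<zeta>. arc_transform k (g k \<zeta>)) \<longlongrightarrow>
           l + \<i> * of_real (\<sigma> * pi) * ?q) (at ?s within half \<sigma>)"
    using arc_transform_side[OF k s] by blast
  have others: "((\<lambda>\<zeta>. arc_transform j (g k \<zeta>)) \<longlongrightarrow> arc_transform j (g k ?s)) (at ?s within half \<sigma>)"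
    if j: "j \<in> {1..3} - {k}" for j \<sigma>
  proof -
    have "g k ?s \<notin> g j ` complex_of_real ` {0..1}"
      using disjoint_arcs[OF k _ _ of_real_sector[OF k], of j s] j s by auto
    then have "isCont (arc_transform j) (g k ?s)" using j by (intro arc_transform_isCont) auto
    moreover have "isCont (g k) ?s" by (rule isCont_g[OF k]) (use segment_N[OF k] s in auto)
    ultimately have "isCont (\<lambda>\<zeta>. arc_transform j (g k \<zeta>)) ?s" by (rule isCont_o2[rotated])
    then show ?thesis unfolding isCont_def by (rule tendsto_within_subset) simp
  qed
  define l' where "l' = 1 / (of_real pi * \<i>) * (l + (\<Sum>j\<in>{1..3} - {k}. arc_transform j (g k ?s)))"
  have "((\<lambda>\<zeta>. transform (g k \<zeta>)) \<longlongrightarrow> l' + of_real \<sigma> * ?q) (at ?s within half \<sigma>)" if \<sigma>: "\<sigma> \<in> {1, -1}" for \<sigma>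
  proof -
    have "((\<lambda>\<zeta>. 1 / (of_real pi * \<i>) * (arc_transform k (g k \<zeta>) + (\<Sum>j\<in>{1..3} - {k}. arc_transform j (g k \<zeta>)))) \<longlongrightarrow>
      1 / (of_real pi * \<i>) * ((l + \<i> * of_real (\<sigma> * pi) * ?q) + (\<Sum>j\<in>{1..3} - {k}. arc_transform j (g k ?s)))) (at ?s within half \<sigma>)"
      by (intro tendsto_mult tendsto_const tendsto_add tendsto_sum l[OF \<sigma>] others)
    moreover have "1 / (of_real pi * \<i>) * (arc_transform k z + (\<Sum>j\<in>{1..3} - {k}. arc_transform j z)) = transform z" for z
      unfolding transform_def using k by (subst sum.remove[of _ k]) auto
    moreover have "1 / (of_real pi * \<i>) * ((l + \<i> * of_real (\<sigma> * pi) * ?q) + (\<Sum>j\<in>{1..3} - {k}. arc_transform j (g k ?s)))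
        = l' + of_real \<sigma> * ?q"
    proof -
      have "1 / (of_real pi * \<i>) * (\<i> * of_real (\<sigma> * pi) * ?q) = of_real \<sigma> * ?q" by simp
      then show ?thesis unfolding l'_def by (simp only: distrib_left add_ac)
    qed
    ultimately show ?thesis by simp
  qed
  then show ?thesis by blast
qed

section \<open>Identification with the Cauchy transform\<close>

text \<open>The left normal is carried by the inverse chart to a curve \<open>\<psi>\<close> with
  \<open>\<psi> 0 = s\<close> and derivative \<open>\<i>\<close> at \<open>0\<close>. It therefore
  approaches \<open>s\<close> through the upper half-plane, where \<open>w\<close> is represented by
  \<open>W k\<close>.\<close>

lemma left_trace_w:
  assumes k: "k \<in> {1..3}" and \<gamma>: "\<And>u. u \<in> {0..1} \<Longrightarrow> g k (complex_of_real u) = \<gamma> u" and s: "s \<in> {0<..<1}"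
  shows "left_trace \<gamma> w (\<gamma> s) = W k (of_real s)"
proof -
  let ?s = "complex_of_real s"
  have sN: "?s \<in> N k" using segment_N[OF k] s by auto
  have "inj_on \<gamma> {0..1}"
  proof (rule inj_onI)
    fix u v assume uv: "u \<in> {0..1}" "v \<in> {0..1}" "\<gamma> u = \<gamma> v"
    have "complex_of_real u = complex_of_real v"
      by (rule inj_onD[OF inj_g[OF k]]) (use uv \<gamma> segment_N[OF k] in auto)
    then show "u = v" by simp
  qed
  then have inv: "inv_into {0..1} \<gamma> (\<gamma> s) = s" by (rule inv_into_f_f) (use s in auto)
  have tan: "tangent \<gamma> s = deriv (g k) ?s"
    by (rule tangent_chart[OF open_N[OF k] segment_N[OF k] holo_g[OF k] \<gamma>]) (use s in auto)
  obtain Hi where Hi: "Hi holomorphic_on (g k ` N k)" "\<And>z. z \<in> N k \<Longrightarrow> deriv (g k) z * deriv Hi (g k z) = 1"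
    "\<And>z. z \<in> N k \<Longrightarrow> Hi (g k z) = z"
    using holomorphic_has_inverse[OF holo_g[OF k] open_N[OF k] inj_g[OF k]] by metis
  have op: "open (g k ` N k)" by (rule open_g_image[OF k open_N[OF k]]) simp
  have gs: "g k ?s \<in> g k ` N k" using sN by blast
  define \<psi> where "\<psi> t = Hi (g k ?s + \<i> * t * deriv (g k) ?s)" for t
  have "(Hi has_field_derivative deriv Hi (g k ?s)) (at (g k ?s + \<i> * 0 * deriv (g k) ?s))"
    using holomorphic_derivI[OF Hi(1) op gs] by simp
  moreover have "((\<lambda>t. g k ?s + \<i> * t * deriv (g k) ?s) has_field_derivative \<i> * deriv (g k) ?s) (at 0)"
    by (auto intro!: derivative_eq_intros)
  ultimately have "(\<psi> has_field_derivative deriv Hi (g k ?s) * (\<i> * deriv (g k) ?s)) (at 0)"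
    unfolding \<psi>_def by (rule DERIV_chain2)
  moreover have "deriv Hi (g k ?s) * (\<i> * deriv (g k) ?s) = \<i>"
    using Hi(2)[OF sN] by (metis mult.commute mult.left_commute mult.right_neutral)
  ultimately have d: "(\<psi> has_field_derivative \<i>) (at 0)" by simp
  have \<psi>0: "\<psi> 0 = ?s" using Hi(3)[OF sN] by (simp add: \<psi>_def)
  have f0: "filterlim complex_of_real (at 0) (at_right 0)"
    using tendsto_of_real[OF tendsto_ident_at, of 0 "{0<..}"]
    unfolding filterlim_at by (auto simp: eventually_at_filter)
  have "((\<lambda>t. (\<psi> t - ?s) / t) \<longlongrightarrow> \<i>) (at 0)" using d unfolding has_field_derivative_iff \<psi>0 by simp
  from filterlim_compose[OF this f0] have "((\<lambda>\<epsilon>. Im ((\<psi> (of_real \<epsilon>) - ?s) / of_real \<epsilon>)) \<longlongrightarrow> Im \<i>) (at_right 0)"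
    by (rule tendsto_Im)
  then have "eventually (\<lambda>\<epsilon>. Im ((\<psi> (of_real \<epsilon>) - ?s) / of_real \<epsilon>) > 0) (at_right 0)"
    by (rule order_tendstoD(1)) simp
  moreover have "eventually (\<lambda>\<epsilon>::real. \<epsilon> > 0) (at_right 0)" by (simp add: eventually_at_filter)
  ultimately have up: "eventually (\<lambda>\<epsilon>. \<psi> (of_real \<epsilon>) \<in> half 1) (at_right 0)"
  proof eventually_elim
    fix \<epsilon> :: real assume "0 < Im ((\<psi> (of_real \<epsilon>) - ?s) / of_real \<epsilon>)" "0 < \<epsilon>"
    then show "\<psi> (of_real \<epsilon>) \<in> half 1" by (simp add: half_def zero_less_divide_iff)
  qed
  have "isCont \<psi> 0" using d by (rule DERIV_isCont)
  then have "(\<psi> \<longlongrightarrow> ?s) (at 0)" unfolding isCont_def \<psi>0 .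
  from filterlim_compose[OF this f0] have "((\<lambda>\<epsilon>. \<psi> (of_real \<epsilon>)) \<longlongrightarrow> ?s) (at_right 0)" .
  then have "filterlim (\<lambda>\<epsilon>. \<psi> (of_real \<epsilon>)) (at ?s within half 1) (at_right 0)"
    unfolding filterlim_at using up by (auto elim!: eventually_mono simp: half_def)
  from filterlim_compose[OF w_trace[OF k s, of 1] this]
  have t: "((\<lambda>\<epsilon>. w (g k (\<psi> (of_real \<epsilon>)))) \<longlongrightarrow> W k ?s) (at_right 0)" by simp
  have "((\<lambda>\<epsilon>. g k ?s + \<i> * of_real \<epsilon> * deriv (g k) ?s) \<longlongrightarrow> g k ?s + \<i> * of_real 0 * deriv (g k) ?s) (at_right (0::real))"
    by (intro tendsto_intros)
  then have "((\<lambda>\<epsilon>. g k ?s + \<i> * of_real \<epsilon> * deriv (g k) ?s) \<longlongrightarrow> g k ?s) (at_right (0::real))" by simp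
  from topological_tendstoD[OF this op gs]
  have "eventually (\<lambda>\<epsilon>. w (g k (\<psi> (of_real \<epsilon>))) = w (\<gamma> s + \<i> * of_real \<epsilon> * tangent \<gamma> s)) (at_right 0)"
  proof eventually_elim
    fix \<epsilon> assume "g k ?s + \<i> * complex_of_real \<epsilon> * deriv (g k) ?s \<in> g k ` N k"
    then have "g k (\<psi> (of_real \<epsilon>)) = g k ?s + \<i> * complex_of_real \<epsilon> * deriv (g k) ?s"
      unfolding \<psi>_def using Hi(3) by auto
    then show "w (g k (\<psi> (of_real \<epsilon>))) = w (\<gamma> s + \<i> * of_real \<epsilon> * tangent \<gamma> s)" using \<gamma>[of s] s tan by simp
  qed
  from Lim_transform_eventually[OF t this] show ?thesis
    unfolding left_trace_def inv by (intro tendsto_Lim) auto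
qed

lemma cauchy_transform_eq:
  assumes \<gamma>: "\<And>k u. k \<in> {1..3} \<Longrightarrow> u \<in> {0..1} \<Longrightarrow> g k (complex_of_real u) = \<gamma> k u"
  shows "cauchy_transform \<gamma> w h z = transform z"
proof -
  \<comment> \<open>The comparison of integrands is made on the open interval: at the ends the left
    trace and the two-sided derivative of the path may be default values.\<close>
  have "contour_integral (\<gamma> k) (\<lambda>t. h t * (1 / (t - z)) * (1 / left_trace (\<gamma> k) w t)) = arc_transform k z"
    if k: "k \<in> {1..3}" for k
    unfolding contour_integral_integral arc_transform_def integral_open_interval_real
  proof (rule Henstock_Kurzweil_Integration.integral_cong)
    fix u :: real assume u: "u \<in> {0<..<1}"
    have "at u = at u within {0..1}" using u by (simp add: at_within_Icc_at)
    then have "vector_derivative (\<gamma> k) (at u) = deriv (g k) (of_real u)"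
      using tangent_chart[OF open_N[OF k] segment_N[OF k] holo_g[OF k] \<gamma>[OF k], of u] u unfolding tangent_def by simp
    then show "h (\<gamma> k u) * (1 / (\<gamma> k u - z)) * (1 / left_trace (\<gamma> k) w (\<gamma> k u)) * vector_derivative (\<gamma> k) (at u)
        = dens k u / (g k (of_real u) - z)"
      using left_trace_w[OF k \<gamma>[OF k] u] \<gamma>[OF k, of u] u by (simp add: dens_def numer_def)
  qed
  then show ?thesis unfolding cauchy_transform_def transform_def by simp
qed

end

section \<open>Polynomials and growth at infinity\<close>

lemma entire_bigo_power_imp_poly:
  assumes G: "G holomorphic_on UNIV" and O: "G \<in> O[at_infinity](\<lambda>z. z ^ m)"
  obtains q where "degree q \<le> m" "poly q = G"
proof -
  obtain c where "eventually (\<lambda>z. norm (G z) \<le> c * norm (z ^ m)) at_infinity"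
    using O by (elim landau_o.bigE)
  then obtain B where B: "\<And>z. norm z \<ge> B \<Longrightarrow> norm (G z) \<le> c * norm z ^ m"
    unfolding eventually_at_infinity norm_power by blast
  define q where "q = (\<Sum>k\<le>m. monom ((deriv ^^ k) G 0 / fact k) k)"
  show ?thesis
  proof (rule that)
    show "degree q \<le> m" unfolding q_def
      by (intro degree_sum_le) (auto intro: order_trans[OF degree_monom_le])
    have "poly q z = G z" for z
      unfolding q_def using Liouville_polynomial[OF G B, where \<xi> = z] by (simp add: poly_sum poly_monom)
    then show "poly q = G" by (rule ext)
  qed
qed

lemma inverse_tendsto_0_at_infinity: "((\<lambda>z::complex. 1 / z) \<longlongrightarrow> 0) at_infinity"
  using tendsto_inverse_0[where 'a = complex] by (simp add: divide_inverse)

lemma bigo_inverse_tendsto_0: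
  fixes F :: "complex \<Rightarrow> complex"
  assumes "F \<in> O[at_infinity](\<lambda>z. 1 / z)" shows "(F \<longlongrightarrow> 0) at_infinity"
proof -
  obtain c where c: "eventually (\<lambda>z. norm (F z) \<le> c * norm (1 / z)) at_infinity"
    using assms by (elim landau_o.bigE)
  have "((\<lambda>z::complex. c * norm (1 / z)) \<longlongrightarrow> c * norm (0::complex)) at_infinity"
    by (intro tendsto_mult tendsto_const tendsto_norm inverse_tendsto_0_at_infinity)
  then have "((\<lambda>z::complex. c * norm (1 / z)) \<longlongrightarrow> 0) at_infinity" by simp
  from Lim_null_comparison[OF c this] show ?thesis .
qed

lemma inverse_power_bigo_mono:
  assumes "i \<le> j" shows "(\<lambda>z::complex. 1 / z ^ j) \<in> O[at_infinity](\<lambda>z. 1 / z ^ i)"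
proof (rule bigoI[where c = 1])
  have "norm (1 / z ^ j) \<le> 1 * norm (1 / z ^ i)" if "norm z \<ge> 1" for z :: complex
  proof -
    have "norm z ^ i \<le> norm z ^ j" using assms that by (rule power_increasing)
    moreover have "0 < norm z ^ i" using that by (intro zero_less_power) linarith
    ultimately show ?thesis by (simp add: norm_divide norm_power frac_le)
  qed
  then show "\<forall>\<^sub>F z::complex in at_infinity. norm (1 / z ^ j) \<le> 1 * norm (1 / z ^ i)"
    unfolding eventually_at_infinity by blast
qed

lemma poly_over_power_tendsto:
  fixes q :: "complex poly"
  assumes "degree q \<le> k" shows "((\<lambda>z. poly q z / z ^ k) \<longlongrightarrow> coeff q k) at_infinity"
proof -
  have "((\<lambda>z. \<Sum>i\<le>k. coeff q i * (1 / z) ^ (k - i)) \<longlongrightarrow> (\<Sum>i\<le>k. coeff q i * 0 ^ (k - i))) at_infinity"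
    by (intro tendsto_intros inverse_tendsto_0_at_infinity)
  also have "(\<Sum>i\<le>k. coeff q i * 0 ^ (k - i)) = (\<Sum>i\<in>{k}. coeff q i * 0 ^ (k - i))"
    by (rule sum.mono_neutral_right) auto
  finally have "((\<lambda>z. \<Sum>i\<le>k. coeff q i * (1 / z) ^ (k - i)) \<longlongrightarrow> coeff q k) at_infinity" by simp
  then show ?thesis
  proof (rule Lim_transform_eventually)
    have "(\<Sum>i\<le>k. coeff q i * (1 / z) ^ (k - i)) = poly q z / z ^ k" if "z \<noteq> 0" for z
    proof -
      have "poly q z = (\<Sum>i\<le>k. coeff q i * z ^ i)"
        unfolding poly_altdef by (rule sum.mono_neutral_left) (use assms in \<open>auto simp: coeff_eq_0\<close>)
      moreover have "z ^ i / z ^ k = (1 / z) ^ (k - i)" if "i \<le> k" for i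
        using \<open>z \<noteq> 0\<close> that by (simp add: power_diff power_divide)
      ultimately show ?thesis by (auto simp: sum_divide_distrib simp flip: times_divide_eq_right intro!: sum.cong)
    qed
    then show "\<forall>\<^sub>F z in at_infinity. (\<Sum>i\<le>k. coeff q i * (1 / z) ^ (k - i)) = poly q z / z ^ k"
      unfolding eventually_at_infinity by (metis norm_zero not_one_le_zero)
  qed
qed

lemma poly_bigo_power:
  fixes q :: "complex poly"
  assumes "degree q \<le> k" shows "poly q \<in> O[at_infinity](\<lambda>z. z ^ k)"
proof (rule bigoI_tendsto[OF poly_over_power_tendsto[OF assms]])
  show "eventually (\<lambda>z::complex. z ^ k \<noteq> 0) at_infinity"
    unfolding eventually_at_infinity by (intro exI[of _ 1]) auto
qed

lemma poly_bigo_inverse_imp_0: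
  fixes q :: "complex poly"
  assumes "poly q \<in> O[at_infinity](\<lambda>z. 1 / z)" shows "q = 0"
proof -
  have t0: "(poly q \<longlongrightarrow> 0) at_infinity" by (rule bigo_inverse_tendsto_0[OF assms])
  have "((\<lambda>z. poly q z * (1 / z) ^ degree q) \<longlongrightarrow> 0 * 0 ^ degree q) at_infinity"
    by (intro tendsto_intros t0 inverse_tendsto_0_at_infinity)
  then have "((\<lambda>z. poly q z / z ^ degree q) \<longlongrightarrow> 0) at_infinity" by (simp add: power_divide)
  from tendsto_unique[OF trivial_limit_at_infinity this poly_over_power_tendsto[OF order_refl]] have "lead_coeff q = 0"
    by simp
  then show ?thesis by simp
qed

text \<open>Each root of \<open>Q\<close> is a root of \<open>P * q\<close> and not of
  \<open>P\<close>, hence one of \<open>q\<close>. Cancelling a linear factor from both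
  \<open>Q\<close> and \<open>q\<close> reproduces the hypotheses in lower degree, so multiplicities
  are taken care of.\<close>

lemma dvd_of_no_common_root:
  fixes P Q r q :: "complex poly"
  assumes "Q * r = P * q" "Q \<noteq> 0" "\<And>t. poly P t = 0 \<Longrightarrow> poly Q t = 0 \<Longrightarrow> False"
  shows "Q dvd q"
  using assms
proof (induction "degree Q" arbitrary: Q q)
  case 0
  then have "is_unit Q" by (simp add: is_unit_iff_degree)
  then show ?case by (rule unit_imp_dvd)
next
  case (Suc n)
  then have "\<not> constant (poly Q)" by (simp add: constant_degree)
  then obtain t where t: "poly Q t = 0" using fundamental_theorem_of_algebra by blast
  then obtain Q' where Q': "Q = [:- t, 1:] * Q'" unfolding poly_eq_0_iff_dvd by (rule dvdE)
  have "poly (P * q) t = 0" using t Suc.prems(1) by (metis mult_zero_left poly_mult)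
  then have "poly q t = 0" using Suc.prems(3)[OF _ t] by auto
  then obtain q' where q': "q = [:- t, 1:] * q'" unfolding poly_eq_0_iff_dvd by (rule dvdE)
  have Q'0: "Q' \<noteq> 0" using Q' Suc.prems(2) by auto
  have "[:- t, 1:] * (Q' * r) = [:- t, 1:] * (P * q')" using Suc.prems(1) unfolding Q' q' by (simp only: mult_ac)
  then have e: "Q' * r = P * q'" by (subst (asm) mult_cancel_left) simp
  have "degree Q = Suc (degree Q')" unfolding Q' using Q'0 by (subst degree_mult_eq) auto
  then have "n = degree Q'" using Suc.hyps(2) by simp
  then have "Q' dvd q'" by (rule Suc.hyps(1)[OF _ e Q'0]) (use Suc.prems(3) Q' in auto)
  then show ?case unfolding Q' q' by (rule mult_dvd_mono[OF dvd_refl])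
qed

lemma has_order_imp_analytic:
  assumes "F nicely_meromorphic_on A" "z \<in> A" "has_order F z m" "0 \<le> m"
  shows "F analytic_on {z}"
proof (rule nicely_meromorphic_on_imp_analytic_at[OF assms(1,2)])
  show "\<not> is_pole F z"
  proof
    assume p: "is_pole F z"
    have "F meromorphic_on {z}"
      using assms(1,2) unfolding nicely_meromorphic_on_def by (auto intro: meromorphic_on_subset)
    then have "isolated_singularity_at F z" by (rule meromorphic_on_isolated_singularity)
    from isolated_pole_imp_neg_zorder[OF this p] show False using assms(3,4) by (simp add: has_order_def)
  qed
qed

text \<open>In the coordinate \<open>u = 1 / z\<close> the function is a bounded factor times
  \<open>u\<close> to the power \<open>d\<close>. For \<open>norm z \<ge> 1\<close> the exponent may
  be lowered to any \<open>m\<close> not above \<open>d\<close>.\<close>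

lemma has_order_at_infinity_bigo:
  assumes mero: "(\<lambda>u. F (inverse u)) meromorphic_on {0}" and ord: "has_order (\<lambda>u. F (inverse u)) 0 d" and m: "int m \<le> d"
  shows "F \<in> O[at_infinity](\<lambda>z. 1 / z ^ m)"
proof -
  let ?f = "\<lambda>u. F (inverse u)"
  obtain G r where G: "r > 0" "G holomorphic_on cball 0 r" "\<And>u. u \<in> cball 0 r - {0} \<Longrightarrow> ?f u = G u * (u - 0) powi d"
    using zorder_exist[OF meromorphic_on_isolated_singularity[OF mero] meromorphic_on_not_essential[OF mero]] ord
    unfolding has_order_def by metis
  have "bounded (G ` cball 0 r)"
    by (intro compact_imp_bounded compact_continuous_image holomorphic_on_imp_continuous_on G(2)) simp
  then obtain B where B: "B > 0" "\<And>u. u \<in> cball 0 r \<Longrightarrow> norm (G u) \<le> B" unfolding bounded_pos by auto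
  show ?thesis
  proof (rule bigoI[where c = B])
    have "norm (F z) \<le> B * norm (1 / z ^ m)" if z: "norm z \<ge> max 1 (1 / r)" for z
    proof -
      have z0: "z \<noteq> 0" "norm z \<ge> 1" using z by auto
      have "1 / r \<le> norm z" using z by simp
      then have zr: "inverse z \<in> cball 0 r - {0}" using z0 G(1) by (simp add: norm_inverse norm_divide field_simps)
      have inv1: "norm (inverse z) \<le> 1" unfolding norm_inverse using z0(2) by (rule inverse_le_1_iff[THEN iffD2, OF disjI2])
      have d0: "d = int (nat d)" "m \<le> nat d" using m by auto
      have "F z = G (inverse z) * inverse z ^ nat d"
        using G(3)[OF zr] d0(1) by (metis diff_zero inverse_inverse_eq power_int_of_nat)
      then have "norm (F z) = norm (G (inverse z)) * norm (inverse z) ^ nat d" by (simp add: norm_mult norm_power)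
      also have "\<dots> \<le> B * norm (inverse z) ^ m"
        using B zr d0(2) inv1 by (intro mult_mono power_decreasing) auto
      finally show ?thesis by (simp add: norm_inverse norm_divide norm_power power_inverse divide_inverse)
    qed
    then show "\<forall>\<^sub>F z in at_infinity. norm (F z) \<le> B * norm (1 / z ^ m)"
      unfolding eventually_at_infinity by blast
  qed
qed

context tripod_chart
begin

section \<open>Growth of \<open>w\<close> and traces on the surface\<close>

lemma w_nonzero: "z \<notin> \<Delta> \<Longrightarrow> w z \<noteq> 0"
proof
  assume z: "z \<notin> \<Delta>" "w z = 0"
  then have "branch_poly a z = 0" using branch_root unfolding branch_root_def by force
  then show False using z(1) a_mem unfolding branch_poly_eq_0_iff by auto
qed

lemma w_sq: "z \<notin> \<Delta> \<Longrightarrow> (w z)\<^sup>2 = branch_poly a z"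
  using branch_root unfolding branch_root_def by auto

lemma holo_w: "w holomorphic_on - \<Delta>"
  using branch_root unfolding branch_root_def by auto

lemma bounded_\<Delta>: "bounded \<Delta>"
  unfolding \<Delta>_eq using compact_arc by (intro compact_imp_bounded compact_UN) auto

lemma eventually_off_\<Delta>: "eventually (\<lambda>z. z \<notin> \<Delta> \<and> z \<noteq> 0) at_infinity"
proof -
  obtain B where B: "B > 0" "\<And>z. z \<in> \<Delta> \<Longrightarrow> norm z \<le> B" using bounded_\<Delta> unfolding bounded_pos by auto
  show ?thesis unfolding eventually_at_infinity using B by (intro exI[of _ "B + 1"]) fastforce
qed

lemma inverse_w_bigo: "(\<lambda>z. 1 / w z) \<in> O[at_infinity](\<lambda>z. 1 / z ^ 2)"
proof -
  have "((\<lambda>z. w z / z\<^sup>2) \<longlongrightarrow> 1) at_infinity" using branch_root unfolding branch_root_def by auto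
  from tendsto_inverse[OF this] have "((\<lambda>z. (1 / w z) / (1 / z ^ 2)) \<longlongrightarrow> 1) at_infinity" by (simp add: field_simps)
  then show ?thesis by (rule bigoI_tendsto) (use eventually_off_\<Delta> in \<open>auto elim: eventually_mono\<close>)
qed

lemma bounded_near_branch_point:
  assumes F: "continuous_traces \<Delta> F" and j: "j \<le> 3"
  shows "\<exists>B. eventually (\<lambda>z. norm (F z) \<le> B) (at (a j) within - \<Delta>)"
proof -
  have "\<exists>B \<rho>. 0 < \<rho> \<and> (\<forall>z\<in>ball (a j) \<rho> - \<Delta>. norm (F z) \<le> B)"
  proof (cases "j = 0")
    case True then show ?thesis using bounded_near_center[OF F] by metis
  next
    case False then show ?thesis using bounded_near_tip[OF F, of j] j by (metis One_nat_def Suc_leI atLeastAtMost_iff gr0I)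
  qed
  then obtain B \<rho> where B: "0 < \<rho>" "\<And>z. z \<in> ball (a j) \<rho> - \<Delta> \<Longrightarrow> norm (F z) \<le> B" by blast
  show ?thesis
    unfolding eventually_at using B by (intro exI[of _ B] exI[of _ \<rho>]) (auto simp: dist_commute)
qed

lemma bounded_times_tendsto_0:
  assumes F: "continuous_traces \<Delta> F" and j: "j \<le> 3" and Z: "(Z \<longlongrightarrow> 0) (at (a j) within - \<Delta>)"
  shows "((\<lambda>z. Z z * F z) \<longlongrightarrow> 0) (at (a j) within - \<Delta>)"
proof -
  obtain B where B: "eventually (\<lambda>z. norm (F z) \<le> B) (at (a j) within - \<Delta>)"
    using bounded_near_branch_point[OF F j] by blast
  show ?thesis
  proof (rule Lim_null_comparison)
    show "eventually (\<lambda>z. norm (Z z * F z) \<le> norm (Z z) * B) (at (a j) within - \<Delta>)"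
      using B by eventually_elim (simp add: norm_mult mult_left_mono)
    have "((\<lambda>z. norm (Z z) * B) \<longlongrightarrow> norm (0::complex) * B) (at (a j) within - \<Delta>)" by (intro tendsto_intros Z)
    then show "((\<lambda>z. norm (Z z) * B) \<longlongrightarrow> 0) (at (a j) within - \<Delta>)" by simp
  qed
qed

lemma linear_tendsto_0: "((\<lambda>z. z - a j) \<longlongrightarrow> 0) (at (a j) within - \<Delta>)"
proof -
  have "((\<lambda>z. z - a j) \<longlongrightarrow> a j - a j) (at (a j) within - \<Delta>)" by (intro tendsto_intros)
  then show ?thesis by simp
qed

text \<open>The square of the quotient is \<open>z - a j\<close> over a product that does not vanish
  at \<open>a j\<close>. Squaring avoids a choice of branch, and the norm of the quotient is
  recovered by a real root.\<close>

lemma linear_over_w_tendsto_0: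
  assumes j: "j \<le> 3" shows "((\<lambda>z. (z - a j) / w z) \<longlongrightarrow> 0) (at (a j) within - \<Delta>)"
proof -
  have nz: "(\<Prod>i\<in>{..3}-{j}. a j - a i) \<noteq> 0" using inj_onD[OF inj_a, of j] j by auto
  have "((\<lambda>z. (z - a j) / (\<Prod>i\<in>{..3}-{j}. z - a i)) \<longlongrightarrow> 0 / (\<Prod>i\<in>{..3}-{j}. a j - a i)) (at (a j) within - \<Delta>)"
    by (intro tendsto_intros linear_tendsto_0 nz)
  then have "((\<lambda>z. (z - a j) / (\<Prod>i\<in>{..3}-{j}. z - a i)) \<longlongrightarrow> 0) (at (a j) within - \<Delta>)" by simp
  then have "((\<lambda>z. ((z - a j) / w z)\<^sup>2) \<longlongrightarrow> 0) (at (a j) within - \<Delta>)"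
  proof (rule Lim_transform_eventually)
    have "(z - a j) / (\<Prod>i\<in>{..3}-{j}. z - a i) = ((z - a j) / w z)\<^sup>2" if "z \<in> - \<Delta>" for z
    proof -
      have "z \<noteq> a j" using that a_mem[OF j] by auto
      then show ?thesis using w_sq[of z] that branch_poly_split[OF j, of a z]
        by (simp add: power_divide power2_eq_square)
    qed
    then show "\<forall>\<^sub>F z in at (a j) within - \<Delta>. (z - a j) / (\<Prod>i\<in>{..3}-{j}. z - a i) = ((z - a j) / w z)\<^sup>2"
      by (simp add: eventually_at_filter)
  qed
  then have "((\<lambda>z. sqrt (norm (((z - a j) / w z)\<^sup>2))) \<longlongrightarrow> sqrt (norm (0::complex))) (at (a j) within - \<Delta>)"
    by (intro tendsto_intros)
  then have "((\<lambda>z. norm ((z - a j) / w z)) \<longlongrightarrow> 0) (at (a j) within - \<Delta>)" by (simp add: norm_power)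
  then show ?thesis by (simp only: tendsto_norm_zero_iff)
qed

text \<open>The crosswise gluing in coordinates: \<open>- w\<close> from the side
  \<open>\<sigma>\<close> has the same limit as \<open>w\<close> from the side
  \<open>- \<sigma>\<close>. Both approaches thus end at the same surface point, and the jump
  relation there ties the second sheet on one side to the first sheet on the other.\<close>

lemma surface_traces:
  assumes S: "continuous_traces \<Delta> (\<lambda>z. r (sheet1 w z))" and T: "continuous_traces \<Delta> (\<lambda>z. r (sheet2 w z))"
    and jump: "jump_relation a \<Delta> w h r" and k: "k \<in> {1..3}" and s: "s \<in> {0<..<1}"
  obtains l where "\<And>\<sigma>. \<sigma> \<in> {1, -1} \<Longrightarrow> ((\<lambda>\<zeta>. r (sheet1 w (g k \<zeta>))) \<longlongrightarrow> l \<sigma>) (at (complex_of_real s) within half \<sigma>)"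
    "\<And>\<sigma>. \<sigma> \<in> {1, -1} \<Longrightarrow> ((\<lambda>\<zeta>. r (sheet2 w (g k \<zeta>))) \<longlongrightarrow> l (- \<sigma>) * h (g k (complex_of_real s))) (at (complex_of_real s) within half \<sigma>)"
proof -
  let ?s = "complex_of_real s" and ?t = "g k (complex_of_real s)"
  have "\<exists>l. ((\<lambda>\<zeta>. r (sheet1 w (g k \<zeta>))) \<longlongrightarrow> l) (at ?s within half \<sigma>)" if "\<sigma> \<in> {1, -1}" for \<sigma>
    by (rule side_trace[OF S k s that]) blast
  then obtain l where l: "\<And>\<sigma>. \<sigma> \<in> {1, -1} \<Longrightarrow> ((\<lambda>\<zeta>. r (sheet1 w (g k \<zeta>))) \<longlongrightarrow> l \<sigma>) (at ?s within half \<sigma>)" by metis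
  have "((\<lambda>\<zeta>. r (sheet2 w (g k \<zeta>))) \<longlongrightarrow> l (- \<sigma>) * h ?t) (at ?s within half \<sigma>)" if \<sigma>: "\<sigma> \<in> {1, -1}" for \<sigma>
  proof -
    have \<sigma>': "- \<sigma> \<in> {1, -1}" using \<sigma> by auto
    obtain m where m: "((\<lambda>\<zeta>. r (sheet2 w (g k \<zeta>))) \<longlongrightarrow> m) (at ?s within half \<sigma>)"
      by (rule side_trace[OF T k s \<sigma>])
    obtain V where V: "boundary_copy \<Delta> ?t V" "copy_nhds V = filtermap (g k) (at ?s within half \<sigma>)"
      by (rule side_copy[OF k s \<sigma>])
    obtain U where U: "boundary_copy \<Delta> ?t U" "copy_nhds U = filtermap (g k) (at ?s within half (- \<sigma>))"
      by (rule side_copy[OF k s \<sigma>'])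
    define y where "y = of_real (- \<sigma>) * W k ?s"
    have "plus_copy \<Delta> w ?t y U"
      unfolding plus_copy_def U(2) filterlim_filtermap y_def using U(1) w_trace[OF k s \<sigma>'] by blast
    moreover have "minus_copy \<Delta> w ?t y V"
      unfolding minus_copy_def V(2) filterlim_filtermap y_def using V(1) tendsto_minus[OF w_trace[OF k s \<sigma>]] by simp
    moreover have "((\<lambda>z. r (sheet1 w z)) \<longlongrightarrow> l (- \<sigma>)) (copy_nhds U)"
      unfolding U(2) filterlim_filtermap by (rule l[OF \<sigma>'])
    moreover have "((\<lambda>z. r (sheet2 w z)) \<longlongrightarrow> m) (copy_nhds V)"
      unfolding V(2) filterlim_filtermap by (rule m)
    moreover have "?t \<in> \<Delta> - {a 0}"
      using arc_mem[OF k, of s] s arc_point_neq_branch_point[OF k of_real_sector[OF k], of s 0] by auto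
    moreover have "y\<^sup>2 = branch_poly a ?t"
    proof -
      have "y\<^sup>2 = (W k ?s)\<^sup>2" unfolding y_def using \<sigma> by auto
      then show ?thesis using W_sq[OF k of_real_sector[OF k], of s] s by simp
    qed
    then have "Affine ?t y \<in> riemann_surface a" unfolding riemann_surface_def by blast
    ultimately have "m = l (- \<sigma>) * h ?t"
      using jump unfolding jump_relation_def by blast
    then show ?thesis using m by simp
  qed
  then show ?thesis using that l by blast
qed

end

section \<open>The Pade approximants\<close>

text \<open>Multiplying the two remainders by the opposite denominators and subtracting eliminates
  \<open>f\<close>. What is left is a polynomial of order \<open>z ^ n\<close> times
  \<open>1 / z ^ (n + 1)\<close>, so it vanishes identically.\<close>

lemma pade_solution_unique_ratio:
  assumes "pade_solution f n P Q" "pade_solution f n P' Q'"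
  shows "Q * P' = P * Q'"
proof -
  have d: "degree Q \<le> n" "degree Q' \<le> n"
    and r: "(\<lambda>z. poly Q z * f z - poly P z) \<in> O[at_infinity](\<lambda>z. 1 / z ^ (n + 1))"
      "(\<lambda>z. poly Q' z * f z - poly P' z) \<in> O[at_infinity](\<lambda>z. 1 / z ^ (n + 1))"
    using assms unfolding pade_solution_def by blast+
  have ev: "eventually (\<lambda>z::complex. z ^ n * (1 / z ^ (n + 1)) = 1 / z) at_infinity"
    unfolding eventually_at_infinity
    by (intro exI[of _ 1] allI impI) (metis (no_types, opaque_lifting) divide_eq_0_iff mult_cancel_left2 nonzero_divide_mult_cancel_left norm_zero not_one_le_zero power_add power_eq_0_iff power_one_right times_divide_eq_right mult.right_neutral)
  have "(\<lambda>z. poly Q' z * (poly Q z * f z - poly P z)) \<in> O[at_infinity](\<lambda>z. z ^ n * (1 / z ^ (n + 1)))"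
    "(\<lambda>z. poly Q z * (poly Q' z * f z - poly P' z)) \<in> O[at_infinity](\<lambda>z. z ^ n * (1 / z ^ (n + 1)))"
    by (intro landau_o.big.mult poly_bigo_power d r)+
  from sum_in_bigo(2)[OF this]
  have "(\<lambda>z. poly Q' z * (poly Q z * f z - poly P z) - poly Q z * (poly Q' z * f z - poly P' z)) \<in> O[at_infinity](\<lambda>z. z ^ n * (1 / z ^ (n + 1)))" .
  also have "O[at_infinity](\<lambda>z::complex. z ^ n * (1 / z ^ (n + 1))) = O[at_infinity](\<lambda>z. 1 / z)"
    by (rule landau_o.big.cong[OF ev])
  also have "(\<lambda>z. poly Q' z * (poly Q z * f z - poly P z) - poly Q z * (poly Q' z * f z - poly P' z)) = poly (Q * P' - P * Q')"
    by (simp add: fun_eq_iff algebra_simps)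
  finally have "Q * P' - P * Q' = 0" by (rule poly_bigo_inverse_imp_0)
  then show ?thesis by simp
qed

text \<open>Cross-multiplication and coprimality make \<open>Q\<close> a divisor of
  \<open>qn\<close>; minimality of the degree leaves a constant factor, and monicity makes it
  \<open>1\<close>.\<close>

lemma pade_pair_eqI:
  assumes sol: "pade_solution f n P Q" and monic: "lead_coeff Q = 1"
    and no_common_root: "\<And>t. poly P t = 0 \<Longrightarrow> poly Q t = 0 \<Longrightarrow> False"
    and pair: "pade_pair f n pn qn"
  shows "qn = Q" "pn = P"
proof -
  have pq: "pade_solution f n pn qn" "lead_coeff qn = 1" "degree qn \<le> degree Q"
    using pair sol unfolding pade_pair_def by blast+
  have Q0: "Q \<noteq> 0" "qn \<noteq> 0" using monic pq(2) by auto
  have e: "Q * pn = P * qn" by (rule pade_solution_unique_ratio[OF sol pq(1)])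
  have "Q dvd qn" by (rule dvd_of_no_common_root[OF e Q0(1)]) (rule no_common_root)
  then obtain r where r: "qn = Q * r" by (rule dvdE)
  have "r \<noteq> 0" using r Q0 by auto
  then have "degree r = 0" using pq(3) r Q0 by (simp add: degree_mult_eq)
  then obtain c where c: "r = [:c:]" by (rule degree_eq_zeroE)
  moreover have "lead_coeff r = 1" using r monic pq(2) by (simp add: lead_coeff_mult)
  ultimately have "r = 1" by (simp add: one_pCons)
  then show "qn = Q" using r by simp
  then have "Q * pn = Q * P" using e by (simp add: mult.commute)
  then show "pn = P" using Q0(1) by simp
qed

lemma degree_1_double_root:
  fixes r :: "complex poly"
  assumes "degree r \<le> 1" "poly r t = 0" "poly (pderiv r) t = 0" shows "r = 0"
proof -
  have r: "r = [:coeff r 0, coeff r 1:]"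
  proof (rule poly_eqI)
    fix i show "coeff r i = coeff [:coeff r 0, coeff r 1:] i"
      using assms(1) by (cases i; cases "i - 1") (auto simp: coeff_pCons coeff_eq_0 split: nat.split)
  qed
  show ?thesis using assms(2,3) by (subst (asm) (1 2) r, subst r) (simp add: pderiv_pCons)
qed

section \<open>The polynomials built from \<open>Sn\<close>\<close>

locale pade_setting = tripod_density a \<Delta> w g N \<kappa> W "\<lambda>t. 1 / poly p t" "{t. poly p t \<noteq> 0}"
  for a :: "nat \<Rightarrow> complex" and \<Delta> :: "complex set" and w :: "complex \<Rightarrow> complex"
    and g :: "nat \<Rightarrow> complex \<Rightarrow> complex" and N :: "nat \<Rightarrow> complex set"
    and \<kappa> :: "nat \<Rightarrow> real" and W :: "nat \<Rightarrow> complex \<Rightarrow> complex" and p :: "complex poly" +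
  fixes n :: nat and zn :: surface_point and Sn :: "surface_point \<Rightarrow> complex"
  assumes large_n: "degree p + 2 < 2 * n"
    and pair: "Sn_pair a \<Delta> w (\<lambda>t. 1 / poly p t) n zn Sn"
begin

definition S :: "complex \<Rightarrow> complex" where "S z = Sn (sheet1 w z)"
text \<open>This is the conjugate function \<open>S*\<close> on the second sheet.\<close>

definition T :: "complex \<Rightarrow> complex" where "T z = Sn (sheet2 w z)"
definition f :: "complex \<Rightarrow> complex" where "f = transform"

lemma n_ge_2: "n \<ge> 2" using large_n by simp

lemma p_nonzero: "t \<in> \<Delta> \<Longrightarrow> poly p t \<noteq> 0" using \<Delta>_H by blast

lemma mero: "S nicely_meromorphic_on - \<Delta>" "T nicely_meromorphic_on - \<Delta>"
    "(\<lambda>u. S (inverse u)) meromorphic_on {0}" "(\<lambda>u. T (inverse u)) meromorphic_on {0}"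
  using pair unfolding Sn_pair_def meromorphic_off_cut_def S_def[abs_def] T_def[abs_def] by blast+

lemma traces: "continuous_traces \<Delta> S" "continuous_traces \<Delta> T"
  using pair unfolding Sn_pair_def S_def[abs_def] T_def[abs_def] by blast+

lemma orders:
  "z \<notin> \<Delta> \<Longrightarrow> has_order S z (Sn_divisor n zn (sheet1 w z))"
  "z \<notin> \<Delta> \<Longrightarrow> has_order T z (Sn_divisor n zn (sheet2 w z))"
  "has_order (\<lambda>u. T (inverse u)) 0 (Sn_divisor n zn Infty2)"
  using pair unfolding Sn_pair_def has_principal_divisor_def S_def[abs_def] T_def[abs_def] by blast+

lemma divisor_sheets: "Sn_divisor n zn (sheet1 w z) = of_bool (sheet1 w z = zn)"
    "Sn_divisor n zn (sheet2 w z) = of_bool (sheet2 w z = zn)"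
  by (simp_all add: Sn_divisor_def sheet1_def sheet2_def)

text \<open>Over finite points off \<open>\<Delta>\<close> the divisor has only the possible zero
  \<open>zn\<close>; both poles and the other zeros sit at infinity.\<close>

lemma analytic_ST: "z \<notin> \<Delta> \<Longrightarrow> S analytic_on {z}" "z \<notin> \<Delta> \<Longrightarrow> T analytic_on {z}"
  using has_order_imp_analytic[OF mero(1) _ orders(1)] has_order_imp_analytic[OF mero(2) _ orders(2)]
  unfolding divisor_sheets by simp_all

lemma holo_S: "S holomorphic_on - \<Delta>" and holo_T: "T holomorphic_on - \<Delta>"
proof -
  have "S analytic_on - \<Delta>" "T analytic_on - \<Delta>"
    using analytic_ST by (subst analytic_on_analytic_at; blast)+
  then show "S holomorphic_on - \<Delta>" "T holomorphic_on - \<Delta>" by (simp_all add: analytic_imp_holomorphic)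
qed

lemma S_nonzero: "z \<notin> \<Delta> \<Longrightarrow> sheet1 w z \<noteq> zn \<Longrightarrow> S z \<noteq> 0"
  using zorder_eq_0_iff[OF analytic_ST(1)[of z]] orders(1)[of z] unfolding divisor_sheets has_order_def by simp

lemma T_nonzero: "z \<notin> \<Delta> \<Longrightarrow> sheet2 w z \<noteq> zn \<Longrightarrow> T z \<noteq> 0"
  using zorder_eq_0_iff[OF analytic_ST(2)[of z]] orders(2)[of z] unfolding divisor_sheets has_order_def by simp

lemma ST_traces:
  assumes k: "k \<in> {1..3}" and s: "s \<in> {0<..<1}"
  obtains l where "\<And>\<sigma>. \<sigma> \<in> {1, -1} \<Longrightarrow> ((\<lambda>\<zeta>. S (g k \<zeta>)) \<longlongrightarrow> l \<sigma>) (at (complex_of_real s) within half \<sigma>)"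
    "\<And>\<sigma>. \<sigma> \<in> {1, -1} \<Longrightarrow> ((\<lambda>\<zeta>. T (g k \<zeta>)) \<longlongrightarrow> l (- \<sigma>) * (1 / poly p (g k (complex_of_real s)))) (at (complex_of_real s) within half \<sigma>)"
proof -
  have "jump_relation a \<Delta> w (\<lambda>t. 1 / poly p t) Sn" using pair unfolding Sn_pair_def by blast
  from surface_traces[OF traces[unfolded S_def[abs_def] T_def[abs_def]] this k s] that
  show ?thesis unfolding S_def[abs_def] T_def[abs_def] by blast
qed

lemma poly_chart_tendsto:
  assumes k: "k \<in> {1..3}" and s: "s \<in> {0<..<1}"
  shows "((\<lambda>\<zeta>. poly q (g k \<zeta>)) \<longlongrightarrow> poly q (g k (complex_of_real s))) (at (complex_of_real s) within A)"
proof -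
  have "isCont (g k) (complex_of_real s)" by (rule isCont_g[OF k]) (use segment_N[OF k] s in auto)
  then have "(g k \<longlongrightarrow> g k (complex_of_real s)) (at (complex_of_real s) within A)"
    unfolding isCont_def by (rule tendsto_within_subset) simp
  then show ?thesis by (rule tendsto_poly)
qed

text \<open>The exponent is \<open>n\<close>, or \<open>n - 1\<close> when the free zero
  \<open>zn\<close> falls on \<open>Infty1\<close> and cancels one pole there.\<close>

lemma sheet_powers: obtains k where "k \<le> n" "n \<le> Suc k" "((\<lambda>z. S z / z ^ k) \<longlongrightarrow> 1) at_infinity"
proof -
  have l: "((\<lambda>z. S z * z powi (- (if zn = Infty1 then int n - 1 else int n))) \<longlongrightarrow> 1) at_infinity"
    using pair unfolding Sn_pair_def S_def by blast
  define k where "k = (if zn = Infty1 then n - 1 else n)"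
  have "(if zn = Infty1 then int n - 1 else int n) = int k" using n_ge_2 by (simp add: k_def)
  with l have "((\<lambda>z. S z / z ^ k) \<longlongrightarrow> 1) at_infinity"
    by (simp add: power_int_minus divide_inverse)
  then show ?thesis using that[of k] by (simp add: k_def split: if_splits)
qed

lemma T_bigo: "T \<in> O[at_infinity](\<lambda>z. 1 / z ^ (n - 1))"
  by (rule has_order_at_infinity_bigo[OF mero(4) orders(3)]) (use n_ge_2 in \<open>simp add: Sn_divisor_def\<close>)

lemma power_bigo: "i \<le> j \<Longrightarrow> (\<lambda>z::complex. z ^ i) \<in> O[at_infinity](\<lambda>z. z ^ j)"
  using poly_bigo_power[of "monom 1 i" j] by (simp add: degree_monom_eq poly_monom[abs_def])

lemma one_over_power_bigo: "(\<lambda>z::complex. 1 / z ^ i) \<in> O[at_infinity](\<lambda>z. 1)"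
  using inverse_power_bigo_mono[of 0 i] by simp

lemma S_bigo: "S \<in> O[at_infinity](\<lambda>z. z ^ n)"
proof -
  obtain k where k: "k \<le> n" "((\<lambda>z. S z / z ^ k) \<longlongrightarrow> 1) at_infinity" by (rule sheet_powers)
  have "S \<in> O[at_infinity](\<lambda>z. z ^ k)"
  proof (rule bigoI_tendsto[OF k(2)])
    show "eventually (\<lambda>z::complex. z ^ k \<noteq> 0) at_infinity"
      using eventually_off_\<Delta> by eventually_elim simp
  qed
  then show ?thesis using power_bigo[OF k(1)] by (rule landau_o.big_trans)
qed

text \<open>From either side the product of the traces is \<open>l 1 * l (- 1) / p\<close>. The pole
  of order at most \<open>n\<close> on the first sheet and the zero of order at least
  \<open>n - 1\<close> on the second leave at most linear growth.\<close>

lemma product_poly: obtains R where "degree R \<le> 1" "R \<noteq> 0" "\<And>z. z \<notin> \<Delta> \<Longrightarrow> poly R z = S z * T z"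
proof -
  have "(\<lambda>z. S z * T z) holomorphic_on - \<Delta>" by (intro holomorphic_intros holo_S holo_T)
  moreover have "\<exists>l. \<forall>\<sigma>\<in>{1, -1}. ((\<lambda>\<zeta>. S (g k \<zeta>) * T (g k \<zeta>)) \<longlongrightarrow> l) (at (complex_of_real s) within half \<sigma>)"
    if ks: "k \<in> {1..3}" "s \<in> {0<..<1}" for k s
  proof (rule ST_traces[OF ks])
    fix l assume l: "\<And>\<sigma>. \<sigma> \<in> {1, -1} \<Longrightarrow> ((\<lambda>\<zeta>. S (g k \<zeta>)) \<longlongrightarrow> l \<sigma>) (at (complex_of_real s) within half \<sigma>)"
      "\<And>\<sigma>. \<sigma> \<in> {1, -1} \<Longrightarrow> ((\<lambda>\<zeta>. T (g k \<zeta>)) \<longlongrightarrow> l (- \<sigma>) * (1 / poly p (g k (complex_of_real s)))) (at (complex_of_real s) within half \<sigma>)"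
    show ?thesis
    proof (intro exI[of _ "l 1 * (l (-1) * (1 / poly p (g k (complex_of_real s))))"] ballI)
      fix \<sigma> :: real assume \<sigma>: "\<sigma> \<in> {1, -1}"
      from tendsto_mult[OF l(1)[OF \<sigma>] l(2)[OF \<sigma>]]
      show "((\<lambda>\<zeta>. S (g k \<zeta>) * T (g k \<zeta>)) \<longlongrightarrow> l 1 * (l (-1) * (1 / poly p (g k (complex_of_real s))))) (at (complex_of_real s) within half \<sigma>)"
        using \<sigma> by (auto simp: mult_ac)
    qed
  qed
  moreover have "((\<lambda>z. (z - a j) * (S z * T z)) \<longlongrightarrow> 0) (at (a j) within - \<Delta>)" if j: "j \<le> 3" for j
    using bounded_times_tendsto_0[OF traces(2) j bounded_times_tendsto_0[OF traces(1) j linear_tendsto_0]]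
    by (simp add: mult.assoc)
  ultimately have "\<exists>G. G holomorphic_on UNIV \<and> (\<forall>z. z \<notin> \<Delta> \<longrightarrow> G z = S z * T z)"
    by (rule removable_tripod)
  then obtain G where G: "G holomorphic_on UNIV" "\<And>z. z \<notin> \<Delta> \<Longrightarrow> G z = S z * T z" by auto
  have "(\<lambda>z. S z * T z) \<in> O[at_infinity](\<lambda>z. z ^ n * (1 / z ^ (n - 1)))"
    by (rule landau_o.big.mult[OF S_bigo T_bigo])
  also have "O[at_infinity](\<lambda>z::complex. z ^ n * (1 / z ^ (n - 1))) = O[at_infinity](\<lambda>z. z ^ 1)"
  proof (rule landau_o.big.cong)
    show "\<forall>\<^sub>F z::complex in at_infinity. z ^ n * (1 / z ^ (n - 1)) = z ^ 1"
      using eventually_off_\<Delta>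
    proof eventually_elim
      fix z :: complex assume "z \<notin> \<Delta> \<and> z \<noteq> 0"
      moreover have "z ^ n = z * z ^ (n - 1)" using n_ge_2 by (cases n) auto
      ultimately show "z ^ n * (1 / z ^ (n - 1)) = z ^ 1" by simp
    qed
  qed
  also have "(\<lambda>z. S z * T z) \<in> O[at_infinity](\<lambda>z. z ^ 1) \<longleftrightarrow> G \<in> O[at_infinity](\<lambda>z. z ^ 1)"
    by (rule landau_o.big.in_cong) (use eventually_off_\<Delta> G(2) in \<open>auto elim: eventually_mono\<close>)
  finally have "G \<in> O[at_infinity](\<lambda>z. z ^ 1)" .
  then obtain R where R: "degree R \<le> 1" "poly R = G" by (rule entire_bigo_power_imp_poly[OF G(1)])
  have "R \<noteq> 0"
  proof
    assume R0: "R = 0"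
    obtain b where b: "b > 0" "\<And>z. z \<in> \<Delta> \<Longrightarrow> norm z \<le> b" using bounded_\<Delta> unfolding bounded_pos by auto
    \<comment> \<open>A point beyond \<open>\<Delta>\<close> and beyond the projection of
      \<open>zn\<close>: the divisor is zero there on both sheets, so neither factor
      vanishes.\<close>
    define z where "z = complex_of_real (b + 1 + (case zn of Affine x y \<Rightarrow> norm x | _ \<Rightarrow> 0))"
    have "norm z = b + 1 + (case zn of Affine x y \<Rightarrow> norm x | _ \<Rightarrow> 0)"
      unfolding z_def norm_of_real using b(1) by (simp split: surface_point.split)
    then have nz: "norm z > b" "\<And>x y. zn = Affine x y \<Longrightarrow> norm z > norm x"
      using b(1) by (auto split: surface_point.split intro: add_pos_nonneg)
    have zD: "z \<notin> \<Delta>" using nz(1) b(2) by force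
    have "sheet1 w z \<noteq> zn" "sheet2 w z \<noteq> zn" using nz(2) unfolding sheet1_def sheet2_def by force+
    then have "S z * T z \<noteq> 0" using S_nonzero[OF zD] T_nonzero[OF zD] by simp
    then show False using G(2)[OF zD] fun_cong[OF R(2), of z] R0 by simp
  qed
  then show ?thesis using that[OF R(1)] R(2) G(2) by simp
qed

lemma f_side:
  assumes "k \<in> {1..3}" "s \<in> {0<..<1}"
  obtains l where "\<And>\<sigma>. \<sigma> \<in> {1, -1} \<Longrightarrow> ((\<lambda>\<zeta>. f (g k \<zeta>)) \<longlongrightarrow>
           l + of_real \<sigma> * ((1 / poly p (g k (of_real s))) / W k (of_real s))) (at (complex_of_real s) within half \<sigma>)"
proof -
  obtain l where "\<forall>\<sigma>\<in>{1, -1}. ((\<lambda>\<zeta>. transform (g k \<zeta>)) \<longlongrightarrow>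
           l + of_real \<sigma> * ((1 / poly p (g k (of_real s))) / W k (of_real s))) (at (complex_of_real s) within half \<sigma>)"
    using transform_side[OF assms] by (rule exE)
  from bspec[OF this] show ?thesis by (rule that[unfolded f_def])
qed

lemma f_end: "j \<le> 3 \<Longrightarrow> ((\<lambda>z. (z - a j) * f z) \<longlongrightarrow> 0) (at (a j) within - \<Delta>)"
  unfolding f_def by (rule transform_end)

lemma f_bigo_1: "f \<in> O[at_infinity](\<lambda>z. 1)"
  using landau_o.big_trans[OF transform_at_infinity, of "\<lambda>z. 1"] one_over_power_bigo[of 1] by (simp add: f_def)

text \<open>This will be the Pade remainder: \<open>n - 1\<close> powers of \<open>1 / z\<close>
  come from the zero of \<open>S*\<close> at infinity and two from \<open>1 / w\<close>, together
  the required \<open>n + 1\<close>.\<close>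

lemma T_over_w_bigo: "(\<lambda>z. 2 * (T z * (1 / w z))) \<in> O[at_infinity](\<lambda>z. 1 / z ^ (n + 1))"
proof -
  have "(\<lambda>z. 2 * (T z * (1 / w z))) \<in> O[at_infinity](\<lambda>z. 1 / z ^ (n - 1) * (1 / z ^ 2))"
    using landau_o.big.mult[OF T_bigo inverse_w_bigo] by (subst landau_o.big.cmult_in_iff) auto
  also have "(\<lambda>z::complex. 1 / z ^ (n - 1) * (1 / z ^ 2)) = (\<lambda>z. 1 / z ^ (n + 1))"
  proof -
    have "n + 1 = (n - 1) + 2" using n_ge_2 by simp
    then show ?thesis by (simp only: power_add) simp
  qed
  finally show ?thesis .
qed

lemma poly_tendsto_0:
  fixes F :: "complex \<Rightarrow> complex"
  assumes "(F \<longlongrightarrow> 0) (at x within A)" shows "((\<lambda>z. poly q z * F z) \<longlongrightarrow> 0) (at x within A)"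
proof -
  have "((\<lambda>z. poly q z * F z) \<longlongrightarrow> poly q x * 0) (at x within A)"
    by (intro tendsto_mult assms tendsto_poly tendsto_ident_at)
  then show ?thesis by simp
qed

lemma w_quotient_side:
  assumes k: "k \<in> {1..3}" and s: "s \<in> {0<..<1}" and \<sigma>: "\<sigma> \<in> {1, -1}"
  shows "((\<lambda>\<zeta>. 1 / w (g k \<zeta>)) \<longlongrightarrow> of_real \<sigma> / W k (of_real s)) (at (complex_of_real s) within half \<sigma>)"
proof -
  have "of_real \<sigma> * W k (of_real s) \<noteq> 0" using W_nonzero[OF k s] \<sigma> by auto
  then have "((\<lambda>\<zeta>. 1 / w (g k \<zeta>)) \<longlongrightarrow> 1 / (of_real \<sigma> * W k (of_real s))) (at (complex_of_real s) within half \<sigma>)"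
    by (intro tendsto_divide tendsto_const w_trace[OF k s \<sigma>])
  moreover have "1 / (of_real \<sigma> * W k (of_real s)) = of_real \<sigma> / W k (of_real s)" using \<sigma> by auto
  ultimately show ?thesis by simp
qed

text \<open>The factor \<open>p\<close> cancels the \<open>1 / p\<close> of the jump, so the trace
  from either side is \<open>l 1 + l (- 1)\<close>. Degree and leading coefficient are those of
  \<open>S\<close>, because \<open>p S*\<close> is of lower order at infinity.\<close>

lemma denominator_poly:
  obtains Q where "degree Q \<le> n" "lead_coeff Q = 1" "\<And>z. z \<notin> \<Delta> \<Longrightarrow> poly Q z = S z + poly p z * T z"
proof -
  let ?F = "\<lambda>z. S z + poly p z * T z"
  have "?F holomorphic_on - \<Delta>" by (intro holomorphic_intros holo_S holo_T)
  moreover have "\<exists>l. \<forall>\<sigma>\<in>{1, -1}. ((\<lambda>\<zeta>. ?F (g k \<zeta>)) \<longlongrightarrow> l) (at (complex_of_real s) within half \<sigma>)"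
    if ks: "k \<in> {1..3}" "s \<in> {0<..<1}" for k s
  proof (rule ST_traces[OF ks])
    let ?t = "g k (complex_of_real s)"
    fix l assume l: "\<And>\<sigma>. \<sigma> \<in> {1, -1} \<Longrightarrow> ((\<lambda>\<zeta>. S (g k \<zeta>)) \<longlongrightarrow> l \<sigma>) (at (complex_of_real s) within half \<sigma>)"
      "\<And>\<sigma>. \<sigma> \<in> {1, -1} \<Longrightarrow> ((\<lambda>\<zeta>. T (g k \<zeta>)) \<longlongrightarrow> l (- \<sigma>) * (1 / poly p ?t)) (at (complex_of_real s) within half \<sigma>)"
    have pt: "poly p ?t \<noteq> 0" by (rule p_nonzero[OF arc_mem[OF ks(1)]]) (use ks(2) in auto)
    show ?thesis
    proof (intro exI[of _ "l 1 + l (-1)"] ballI)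
      fix \<sigma> :: real assume \<sigma>: "\<sigma> \<in> {1, -1}"
      from tendsto_add[OF l(1)[OF \<sigma>] tendsto_mult[OF poly_chart_tendsto[OF ks, of p] l(2)[OF \<sigma>]]]
      show "((\<lambda>\<zeta>. ?F (g k \<zeta>)) \<longlongrightarrow> l 1 + l (-1)) (at (complex_of_real s) within half \<sigma>)"
        using \<sigma> pt by (auto simp: add.commute)
    qed
  qed
  moreover have "((\<lambda>z. (z - a j) * ?F z) \<longlongrightarrow> 0) (at (a j) within - \<Delta>)" if j: "j \<le> 3" for j
    using tendsto_add[OF bounded_times_tendsto_0[OF traces(1) j linear_tendsto_0]
        poly_tendsto_0[OF bounded_times_tendsto_0[OF traces(2) j linear_tendsto_0], of p]]
    by (simp add: algebra_simps)
  ultimately have "\<exists>G. G holomorphic_on UNIV \<and> (\<forall>z. z \<notin> \<Delta> \<longrightarrow> G z = ?F z)"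
    by (rule removable_tripod)
  then obtain G where G: "G holomorphic_on UNIV" "\<And>z. z \<notin> \<Delta> \<Longrightarrow> G z = ?F z" by auto
  obtain k where k: "k \<le> n" "n \<le> Suc k" "((\<lambda>z. S z / z ^ k) \<longlongrightarrow> 1) at_infinity" by (rule sheet_powers)
  have "(\<lambda>z. poly p z * T z * (1 / z ^ k)) \<in> O[at_infinity](\<lambda>z. z ^ degree p * (1 / z ^ (n - 1)) * (1 / z ^ k))"
    by (intro landau_o.big.mult poly_bigo_power T_bigo order_refl landau_o.big_refl)
  also have "O[at_infinity](\<lambda>z::complex. z ^ degree p * (1 / z ^ (n - 1)) * (1 / z ^ k)) = O[at_infinity](\<lambda>z. 1 / z ^ (n - 1 + k - degree p))"
  proof (rule landau_o.big.cong)
    show "\<forall>\<^sub>F z::complex in at_infinity. z ^ degree p * (1 / z ^ (n - 1)) * (1 / z ^ k) = 1 / z ^ (n - 1 + k - degree p)"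
      using eventually_off_\<Delta>
    proof eventually_elim
      fix z :: complex assume z: "z \<notin> \<Delta> \<and> z \<noteq> 0"
      have "n - 1 + k = degree p + (n - 1 + k - degree p)" using large_n k(2) by simp
      then have "z ^ (n - 1) * z ^ k = z ^ degree p * z ^ (n - 1 + k - degree p)" by (metis power_add)
      then have "z ^ degree p * (1 / z ^ (n - 1)) * (1 / z ^ k) = z ^ degree p / (z ^ degree p * z ^ (n - 1 + k - degree p))" by simp
      then show "z ^ degree p * (1 / z ^ (n - 1)) * (1 / z ^ k) = 1 / z ^ (n - 1 + k - degree p)" using z by simp
    qed
  qed
  finally have "(\<lambda>z. poly p z * T z * (1 / z ^ k)) \<in> O[at_infinity](\<lambda>z. 1 / z ^ (n - 1 + k - degree p))" .
  \<comment> \<open>In the worst case \<open>k = n - 1\<close> the exponent is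
    \<open>2 n - 2 - degree p\<close>, which is at least one exactly by the assumed bound on
    \<open>n\<close>.\<close>
  moreover have "(\<lambda>z::complex. 1 / z ^ (n - 1 + k - degree p)) \<in> O[at_infinity](\<lambda>z. 1 / z ^ 1)"
    by (rule inverse_power_bigo_mono) (use large_n k(2) in simp)
  ultimately have "(\<lambda>z. poly p z * T z * (1 / z ^ k)) \<in> O[at_infinity](\<lambda>z. 1 / z ^ 1)" by (rule landau_o.big_trans)
  then have "((\<lambda>z. poly p z * T z * (1 / z ^ k)) \<longlongrightarrow> 0) at_infinity"
    by (intro bigo_inverse_tendsto_0) simp
  from tendsto_add[OF k(3) this] have "((\<lambda>z. ?F z / z ^ k) \<longlongrightarrow> 1) at_infinity" by (simp add: add_divide_distrib)
  then have Gk: "((\<lambda>z. G z / z ^ k) \<longlongrightarrow> 1) at_infinity"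
  proof (rule Lim_transform_eventually)
    show "\<forall>\<^sub>F z in at_infinity. ?F z / z ^ k = G z / z ^ k"
      using eventually_off_\<Delta> by eventually_elim (simp add: G(2))
  qed
  have "G \<in> O[at_infinity](\<lambda>z. z ^ k)"
  proof (rule bigoI_tendsto[OF Gk])
    show "eventually (\<lambda>z::complex. z ^ k \<noteq> 0) at_infinity"
      using eventually_off_\<Delta> by eventually_elim simp
  qed
  then obtain Q where Q: "degree Q \<le> k" "poly Q = G" by (rule entire_bigo_power_imp_poly[OF G(1)])
  have c: "coeff Q k = 1"
    using tendsto_unique[OF trivial_limit_at_infinity poly_over_power_tendsto[OF Q(1)]] Gk unfolding Q(2) by blast
  then have "degree Q = k" using Q(1) le_degree[of Q k] by simp
  then show ?thesis using that[of Q] c k(1) Q(2) G(2) by simp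
qed

text \<open>With \<open>q = 1 / (p W)\<close> the traces of \<open>f\<close> and
  \<open>1 / (p w)\<close> from the side \<open>\<sigma>\<close> are \<open>L + \<sigma> q\<close>
  and \<open>\<sigma> q\<close>. The combination becomes
  \<open>(l 1 + l (- 1)) L + \<sigma> (l \<sigma> - l (- \<sigma>)) q\<close>, which is unchanged
  when \<open>\<sigma>\<close> changes sign; the factor \<open>2\<close> is what makes this
  happen.\<close>

lemma numerator_poly:
  assumes Q: "degree Q \<le> n" "\<And>z. z \<notin> \<Delta> \<Longrightarrow> poly Q z = S z + poly p z * T z"
  obtains P where "degree P \<le> n" "\<And>z. z \<notin> \<Delta> \<Longrightarrow> poly P z = poly Q z * f z - 2 * (T z * (1 / w z))"
proof -
  let ?F = "\<lambda>z. poly Q z * f z - 2 * (T z * (1 / w z))"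
  let ?E = "\<lambda>z. (S z + poly p z * T z) * f z - 2 * (T z * (1 / w z))"
  have "?F holomorphic_on - \<Delta>"
    using w_nonzero by (intro holomorphic_intros holo_T holo_w transform_holomorphic[folded f_def]) auto
  moreover have "\<exists>l. \<forall>\<sigma>\<in>{1, -1}. ((\<lambda>\<zeta>. ?F (g k \<zeta>)) \<longlongrightarrow> l) (at (complex_of_real s) within half \<sigma>)"
    if ks: "k \<in> {1..3}" "s \<in> {0<..<1}" for k s
  proof (rule ST_traces[OF ks])
    let ?t = "g k (complex_of_real s)" and ?W = "W k (complex_of_real s)"
    fix l assume l: "\<And>\<sigma>. \<sigma> \<in> {1, -1} \<Longrightarrow> ((\<lambda>\<zeta>. S (g k \<zeta>)) \<longlongrightarrow> l \<sigma>) (at (complex_of_real s) within half \<sigma>)"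
      "\<And>\<sigma>. \<sigma> \<in> {1, -1} \<Longrightarrow> ((\<lambda>\<zeta>. T (g k \<zeta>)) \<longlongrightarrow> l (- \<sigma>) * (1 / poly p ?t)) (at (complex_of_real s) within half \<sigma>)"
    have pt: "poly p ?t \<noteq> 0" by (rule p_nonzero[OF arc_mem[OF ks(1)]]) (use ks(2) in auto)
    obtain L where L: "\<And>\<sigma>. \<sigma> \<in> {1, -1} \<Longrightarrow> ((\<lambda>\<zeta>. f (g k \<zeta>)) \<longlongrightarrow>
           L + of_real \<sigma> * ((1 / poly p ?t) / ?W)) (at (complex_of_real s) within half \<sigma>)"
      using f_side[OF ks] by blast
    obtain c where c: "0 < c" "ball (complex_of_real s) c \<subseteq> sector (\<kappa> k)" "ball (complex_of_real s) c \<subseteq> N k"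
      "\<And>\<zeta>. \<zeta> \<in> ball (complex_of_real s) c \<Longrightarrow> Re \<zeta> < 1"
      "\<And>\<zeta>. \<zeta> \<in> ball (complex_of_real s) c \<Longrightarrow> g k \<zeta> \<in> \<Delta> \<longleftrightarrow> Im \<zeta> = 0"
      using interior_ball[OF ks] by metis
    show ?thesis
    proof (intro exI[of _ "(l 1 + l (-1)) * L + (l 1 - l (-1)) * ((1 / poly p ?t) / ?W)"] ballI)
      fix \<sigma> :: real assume \<sigma>: "\<sigma> \<in> {1, -1}"
      let ?at = "at (complex_of_real s) within half \<sigma>"
      have "((\<lambda>\<zeta>. ?E (g k \<zeta>)) \<longlongrightarrow>
          (l \<sigma> + poly p ?t * (l (- \<sigma>) * (1 / poly p ?t))) * (L + of_real \<sigma> * ((1 / poly p ?t) / ?W))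
          - 2 * (l (- \<sigma>) * (1 / poly p ?t) * (of_real \<sigma> / ?W))) ?at"
        by (intro tendsto_diff tendsto_mult tendsto_add tendsto_const l L w_quotient_side poly_chart_tendsto ks \<sigma>)
      also have "(l \<sigma> + poly p ?t * (l (- \<sigma>) * (1 / poly p ?t))) * (L + of_real \<sigma> * ((1 / poly p ?t) / ?W))
          - 2 * (l (- \<sigma>) * (1 / poly p ?t) * (of_real \<sigma> / ?W))
         = (l 1 + l (-1)) * L + (l 1 - l (-1)) * ((1 / poly p ?t) / ?W)"
      proof -
        have "poly p ?t * (l (- \<sigma>) * (1 / poly p ?t)) = l (- \<sigma>)" using pt by simp
        moreover have "l (- \<sigma>) * (1 / poly p ?t) * (of_real \<sigma> / ?W) = of_real \<sigma> * l (- \<sigma>) * ((1 / poly p ?t) / ?W)" by simp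
        moreover have "(l \<sigma> + l (- \<sigma>)) * (L + of_real \<sigma> * q) - 2 * (of_real \<sigma> * l (- \<sigma>) * q)
            = (l 1 + l (-1)) * L + (l 1 - l (-1)) * q" for q
          using \<sigma> by (auto simp: algebra_simps)
        ultimately show ?thesis by metis
      qed
      finally show "((\<lambda>\<zeta>. ?F (g k \<zeta>)) \<longlongrightarrow> (l 1 + l (-1)) * L + (l 1 - l (-1)) * ((1 / poly p ?t) / ?W)) ?at"
      proof (rule Lim_transform_eventually)
        have "eventually (\<lambda>\<zeta>. \<zeta> \<in> ball (complex_of_real s) c) ?at"
          by (rule filter_leD[OF at_le[OF subset_UNIV]], rule eventually_at_in_open') (use c(1) in auto)
        moreover have "eventually (\<lambda>\<zeta>. \<zeta> \<in> half \<sigma>) ?at" by (simp add: eventually_at_filter)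
        ultimately show "\<forall>\<^sub>F \<zeta> in ?at. ?E (g k \<zeta>) = ?F (g k \<zeta>)"
        proof eventually_elim
          fix \<zeta> assume "\<zeta> \<in> ball (complex_of_real s) c" "\<zeta> \<in> half \<sigma>"
          then have "g k \<zeta> \<notin> \<Delta>" using c(5)[of \<zeta>] by (auto simp: half_def)
          then show "?E (g k \<zeta>) = ?F (g k \<zeta>)" using Q(2) by simp
        qed
      qed
    qed
  qed
  moreover have "((\<lambda>z. (z - a j) * ?F z) \<longlongrightarrow> 0) (at (a j) within - \<Delta>)" if j: "j \<le> 3" for j
  proof -
    have "((\<lambda>z. poly Q z * ((z - a j) * f z) - 2 * ((z - a j) / w z * T z)) \<longlongrightarrow> 0 - 2 * 0) (at (a j) within - \<Delta>)"
      by (intro tendsto_diff tendsto_mult[OF tendsto_const] poly_tendsto_0 f_end[OF j]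
          bounded_times_tendsto_0[OF traces(2) j linear_over_w_tendsto_0[OF j]])
    then show ?thesis by (simp add: algebra_simps)
  qed
  ultimately have "\<exists>G. G holomorphic_on UNIV \<and> (\<forall>z. z \<notin> \<Delta> \<longrightarrow> G z = ?F z)"
    by (rule removable_tripod)
  then obtain G where G: "G holomorphic_on UNIV" "\<And>z. z \<notin> \<Delta> \<Longrightarrow> G z = ?F z" by auto
  have "(\<lambda>z. poly Q z * f z) \<in> O[at_infinity](\<lambda>z. z ^ n * 1)"
    by (intro landau_o.big.mult poly_bigo_power Q(1) f_bigo_1)
  moreover have "(\<lambda>z. 2 * (T z * (1 / w z))) \<in> O[at_infinity](\<lambda>z. z ^ n * 1)"
  proof -
    have "(\<lambda>z::complex. 1) \<in> O[at_infinity](\<lambda>z. z ^ n * 1)" using power_bigo[of 0 n] by simp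
    with landau_o.big_trans[OF T_over_w_bigo one_over_power_bigo] show ?thesis by (rule landau_o.big_trans)
  qed
  ultimately have "?F \<in> O[at_infinity](\<lambda>z. z ^ n * 1)" by (rule sum_in_bigo)
  also have "?F \<in> O[at_infinity](\<lambda>z. z ^ n * 1) \<longleftrightarrow> G \<in> O[at_infinity](\<lambda>z. z ^ n * 1)"
    by (rule landau_o.big.in_cong) (use eventually_off_\<Delta> in eventually_elim, simp add: G(2))
  finally have "G \<in> O[at_infinity](\<lambda>z. z ^ n)" by simp
  then obtain P where P: "degree P \<le> n" "poly P = G" by (rule entire_bigo_power_imp_poly[OF G(1)])
  then show ?thesis using that[of P] G(2) by simp
qed

lemma auxiliary_poly:
  obtains A where "\<And>z. z \<notin> \<Delta> \<Longrightarrow> poly A z = poly p z * f z - 1 / w z"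
proof -
  let ?F = "\<lambda>z. poly p z * f z - 1 / w z"
  have "?F holomorphic_on - \<Delta>"
    using w_nonzero by (intro holomorphic_intros holo_w transform_holomorphic[folded f_def]) auto
  moreover have "\<exists>l. \<forall>\<sigma>\<in>{1, -1}. ((\<lambda>\<zeta>. ?F (g k \<zeta>)) \<longlongrightarrow> l) (at (complex_of_real s) within half \<sigma>)"
    if ks: "k \<in> {1..3}" "s \<in> {0<..<1}" for k s
  proof -
    let ?t = "g k (complex_of_real s)" and ?W = "W k (complex_of_real s)"
    have pt: "poly p ?t \<noteq> 0" by (rule p_nonzero[OF arc_mem[OF ks(1)]]) (use ks(2) in auto)
    obtain L where L: "\<And>\<sigma>. \<sigma> \<in> {1, -1} \<Longrightarrow> ((\<lambda>\<zeta>. f (g k \<zeta>)) \<longlongrightarrow>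
           L + of_real \<sigma> * ((1 / poly p ?t) / ?W)) (at (complex_of_real s) within half \<sigma>)"
      using f_side[OF ks] by blast
    show ?thesis
    proof (intro exI[of _ "poly p ?t * L"] ballI)
      fix \<sigma> :: real assume \<sigma>: "\<sigma> \<in> {1, -1}"
      have "((\<lambda>\<zeta>. ?F (g k \<zeta>)) \<longlongrightarrow> poly p ?t * (L + of_real \<sigma> * ((1 / poly p ?t) / ?W)) - of_real \<sigma> / ?W)
          (at (complex_of_real s) within half \<sigma>)"
        by (intro tendsto_diff tendsto_mult L w_quotient_side poly_chart_tendsto ks \<sigma>)
      moreover have "poly p ?t * (L + of_real \<sigma> * ((1 / poly p ?t) / ?W)) - of_real \<sigma> / ?W = poly p ?t * L"
        using pt by (simp add: distrib_left)
      ultimately show "((\<lambda>\<zeta>. ?F (g k \<zeta>)) \<longlongrightarrow> poly p ?t * L) (at (complex_of_real s) within half \<sigma>)" by simp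
    qed
  qed
  moreover have "((\<lambda>z. (z - a j) * ?F z) \<longlongrightarrow> 0) (at (a j) within - \<Delta>)" if j: "j \<le> 3" for j
  proof -
    have "((\<lambda>z. poly p z * ((z - a j) * f z) - (z - a j) / w z) \<longlongrightarrow> 0 - 0) (at (a j) within - \<Delta>)"
      by (intro tendsto_diff poly_tendsto_0 f_end[OF j] linear_over_w_tendsto_0[OF j])
    then show ?thesis by (simp add: algebra_simps)
  qed
  ultimately have "\<exists>G. G holomorphic_on UNIV \<and> (\<forall>z. z \<notin> \<Delta> \<longrightarrow> G z = ?F z)"
    by (rule removable_tripod)
  then obtain G where G: "G holomorphic_on UNIV" "\<And>z. z \<notin> \<Delta> \<Longrightarrow> G z = ?F z" by auto
  have "(\<lambda>z. poly p z * f z) \<in> O[at_infinity](\<lambda>z. z ^ degree p * 1)"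
    by (intro landau_o.big.mult poly_bigo_power order_refl f_bigo_1)
  moreover have "(\<lambda>z. 1 / w z) \<in> O[at_infinity](\<lambda>z. z ^ degree p * 1)"
  proof -
    have "(\<lambda>z::complex. 1) \<in> O[at_infinity](\<lambda>z. z ^ degree p * 1)" using power_bigo[of 0 "degree p"] by simp
    with landau_o.big_trans[OF inverse_w_bigo one_over_power_bigo] show ?thesis by (rule landau_o.big_trans)
  qed
  ultimately have "?F \<in> O[at_infinity](\<lambda>z. z ^ degree p * 1)" by (rule sum_in_bigo)
  also have "?F \<in> O[at_infinity](\<lambda>z. z ^ degree p * 1) \<longleftrightarrow> G \<in> O[at_infinity](\<lambda>z. z ^ degree p * 1)"
    by (rule landau_o.big.in_cong) (use eventually_off_\<Delta> in eventually_elim, simp add: G(2))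
  finally have "G \<in> O[at_infinity](\<lambda>z. z ^ degree p)" by simp
  then obtain A where "degree A \<le> degree p" "poly A = G" by (rule entire_bigo_power_imp_poly[OF G(1)])
  then show ?thesis using that[of A] G(2) by simp
qed

text \<open>
  With \<open>X = p P - A Q = (S - p T) / w\<close> off \<open>\<Delta>\<close>, the identity \<open>Q\<^sup>2 - w\<^sup>2 X\<^sup>2 = 4 p S T\<close> turns a common root
  of \<open>P\<close> and \<open>Q\<close> into a double root of \<open>S T\<close>, which has degree at most one.
\<close>

lemma no_common_root:
  assumes Q: "\<And>z. z \<notin> \<Delta> \<Longrightarrow> poly Q z = S z + poly p z * T z"
    and P: "\<And>z. z \<notin> \<Delta> \<Longrightarrow> poly P z = poly Q z * f z - 2 * (T z * (1 / w z))"
    and root: "poly P t = 0" "poly Q t = 0"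
  shows False
proof -
  obtain R where R: "degree R \<le> 1" "R \<noteq> 0" "\<And>z. z \<notin> \<Delta> \<Longrightarrow> poly R z = S z * T z"
    using product_poly by metis
  have "poly R t = 0 \<and> poly (pderiv R) t = 0"
  \<comment> \<open>Off \<open>\<Delta>\<close> the polynomial \<open>p\<close> may vanish at
    \<open>t\<close>, but there \<open>S\<close> and \<open>S*\<close> are holomorphic and both
    vanish at a common root. On \<open>\<Delta>\<close> they have only traces, but \<open>p\<close>
    does not vanish, so the polynomial identity can be divided by it.\<close>
  proof (cases "t \<in> \<Delta>")
    case False
    have T0: "T t = 0" using P[OF False] root w_nonzero[OF False] by simp
    then have S0: "S t = 0" using Q[OF False] root by simp
    have op: "open (- \<Delta>)" using closed_\<Delta> by auto
    have "(S has_field_derivative deriv S t) (at t)" "(T has_field_derivative deriv T t) (at t)"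
      using holomorphic_derivI[OF holo_S op, of t] holomorphic_derivI[OF holo_T op, of t] False by auto
    from DERIV_mult[OF this] have "((\<lambda>z. S z * T z) has_field_derivative 0) (at t)" using S0 T0 by simp
    then have "(poly R has_field_derivative 0) (at t)"
      by (rule has_field_derivative_transform_within_open[OF _ op]) (use False R(3) in auto)
    then have "poly (pderiv R) t = 0" by (rule DERIV_unique[OF poly_DERIV])
    then show ?thesis using R(3)[OF False] S0 by simp
  next
    case True
    obtain A where A: "\<And>z. z \<notin> \<Delta> \<Longrightarrow> poly A z = poly p z * f z - 1 / w z" using auxiliary_poly by metis
    define X where "X = p * P - A * Q"
    define B where "B = (\<Prod>k\<le>3. [:- a k, 1:])"
    define Z where "Z = Q * Q - B * X * X - [:4:] * p * R"
    have "poly Z z = 0" if z: "z \<in> - \<Delta>" for z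
    proof -
      have z': "z \<notin> \<Delta>" using z by simp
      have X: "poly X z = (S z - poly p z * T z) / w z"
      proof -
        have "poly X z = poly p z * ((S z + poly p z * T z) * f z - 2 * (T z * (1 / w z)))
            - (poly p z * f z - 1 / w z) * (S z + poly p z * T z)"
          unfolding X_def by (simp only: poly_diff poly_mult P[OF z'] A[OF z'] Q[OF z'])
        also have "\<dots> = (S z - poly p z * T z) / w z"
          using w_nonzero[OF z'] by (simp add: field_simps)
        finally show ?thesis .
      qed
      have cancel: "v * v * (d / v) * (d / v) = d\<^sup>2" if "v \<noteq> 0" for v d :: complex
        using that by (simp add: power2_eq_square)
      have "poly B z = w z * w z"
        using w_sq[OF z'] unfolding B_def branch_poly_def by (simp add: poly_prod power2_eq_square)
      then have "poly B z * poly X z * poly X z = (S z - poly p z * T z)\<^sup>2"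
        unfolding X using cancel[OF w_nonzero[OF z']] by simp
      then show ?thesis unfolding Z_def using Q[OF z'] R(3)[OF z'] by (simp add: power2_eq_square algebra_simps)
    qed
    \<comment> \<open>The identity is known only off \<open>\<Delta>\<close>; being polynomial and
      valid on an infinite set, it extends to the points of \<open>\<Delta>\<close>.\<close>
    moreover have "infinite (- \<Delta>)" using cobounded_imp_unbounded[of "- \<Delta>"] bounded_\<Delta> finite_imp_bounded by auto
    ultimately have "Z = 0" using poly_roots_finite[of Z] by (metis (mono_tags, lifting) finite_subset mem_Collect_eq subsetI)
    obtain P1 Q1 where PQ: "P = [:- t, 1:] * P1" "Q = [:- t, 1:] * Q1"
      using root unfolding poly_eq_0_iff_dvd by (elim dvdE)
    define Y where "Y = Q1 * Q1 - B * (p * P1 - A * Q1) * (p * P1 - A * Q1)"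
    have "[:4:] * p * R = Q * Q - B * X * X" using \<open>Z = 0\<close> unfolding Z_def by simp
    also have "\<dots> = [:- t, 1:] * ([:- t, 1:] * Y)" unfolding X_def PQ Y_def by (simp only: algebra_simps)
    finally have e: "[:4:] * p * R = [:- t, 1:] * ([:- t, 1:] * Y)" .
    have lin: "poly [:- t, 1:] t = 0" by simp
    \<comment> \<open>The value and the derivative of \<open>4 p R\<close> vanish at
      \<open>t\<close>; since \<open>p\<close> does not vanish there, the same follows in turn for
      \<open>R\<close> and for its derivative.\<close>
    have "poly ([:4:] * p * R) t = 0" "poly (pderiv ([:4:] * p * R)) t = 0"
      unfolding e by (simp_all only: pderiv_mult poly_add poly_mult lin mult_zero_left mult_zero_right add_0)
    then show ?thesis using p_nonzero[OF True] by (auto simp: pderiv_mult pderiv_smult)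
  qed
  then show False using degree_1_double_root[OF R(1)] R(2) by blast
qed

lemma pade_formulas:
  assumes pp: "pade_pair f n pn qn"
  shows "(\<forall>z\<in>- \<Delta>. poly qn z \<noteq> 0 \<longrightarrow> f z - poly pn z / poly qn z = 2 / w z * (T z / (S z + poly p z * T z)))
       \<and> (\<forall>z\<in>- \<Delta>. poly qn z = S z + poly p z * T z)"
proof -
  obtain Q where Q: "degree Q \<le> n" "lead_coeff Q = 1" "\<And>z. z \<notin> \<Delta> \<Longrightarrow> poly Q z = S z + poly p z * T z"
    using denominator_poly by metis
  obtain P where P: "degree P \<le> n" "\<And>z. z \<notin> \<Delta> \<Longrightarrow> poly P z = poly Q z * f z - 2 * (T z * (1 / w z))"
    using numerator_poly[OF Q(1,3)] by metis
  have "(\<lambda>z. poly Q z * f z - poly P z) \<in> O[at_infinity](\<lambda>z. 1 / z ^ (n + 1))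
     \<longleftrightarrow> (\<lambda>z. 2 * (T z * (1 / w z))) \<in> O[at_infinity](\<lambda>z. 1 / z ^ (n + 1))"
    by (rule landau_o.big.in_cong) (use eventually_off_\<Delta> in eventually_elim, simp add: P(2))
  then have sol: "pade_solution f n P Q"
    unfolding pade_solution_def using P(1) Q(1,2) T_over_w_bigo by auto
  have coprime: False if "poly P t = 0" "poly Q t = 0" for t
    by (rule no_common_root[OF Q(3) P(2) that])
  have qn: "qn = Q" by (rule pade_pair_eqI(1)[OF sol Q(2) _ pp]) (rule coprime)
  have pn: "pn = P" by (rule pade_pair_eqI(2)[OF sol Q(2) _ pp]) (rule coprime)
  show ?thesis
  proof (intro conjI ballI impI)
    fix z assume z: "z \<in> - \<Delta>"
    then show q: "poly qn z = S z + poly p z * T z" using Q(3) qn by simp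
    assume nz: "poly qn z \<noteq> 0"
    have "poly pn z = poly qn z * f z - 2 * (T z * (1 / w z))" using z P(2)[of z] qn pn by simp
    then have "f z - poly pn z / poly qn z = 2 / w z * (T z / poly qn z)"
      using nz by (simp add: diff_divide_distrib)
    then show "f z - poly pn z / poly qn z = 2 / w z * (T z / (S z + poly p z * T z))" unfolding q .
  qed
qed

end

theorem theorem4:
  fixes a :: "nat \<Rightarrow> complex" and \<Delta> :: "complex set" and \<gamma> :: "nat \<Rightarrow> real \<Rightarrow> complex"
    and w :: "complex \<Rightarrow> complex" and p :: "complex poly" and n :: nat
    and zn :: surface_point and Sn :: "surface_point \<Rightarrow> complex"
    and pn qn :: "complex poly"
  defines "S \<equiv> (\<lambda>z. Sn (sheet1 w z))"
    and "S_conj \<equiv> (\<lambda>z. Sn (sheet2 w z))"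
    and "f \<equiv> cauchy_transform \<gamma> w (\<lambda>t. 1 / poly p t)"
  assumes "\<not> collinear {a 1, a 2, a 3}"
    and "chebotarev_continuum {a 1, a 2, a 3} \<Delta>"
    and "tripod a \<gamma> \<Delta>"
    and "branch_root a \<Delta> w"
    and "\<forall>t\<in>\<Delta>. poly p t \<noteq> 0"
    and "Sn_pair a \<Delta> w (\<lambda>t. 1 / poly p t) n zn Sn"
    and "pade_pair f n pn qn"
    and "2 * n > degree p + 2"
  shows "(\<forall>z\<in>- \<Delta>. poly qn z \<noteq> 0 \<longrightarrow>
            f z - poly pn z / poly qn z = 2 / w z * (S_conj z / (S z + poly p z * S_conj z)))
       \<and> (\<forall>z\<in>- \<Delta>. poly qn z = S z + poly p z * S_conj z)"
proof (rule ex_tripod_chart[OF \<open>tripod a \<gamma> \<Delta>\<close> \<open>branch_root a \<Delta> w\<close>])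
  fix g N \<kappa> W
  assume chart: "tripod_chart a \<Delta> w g N \<kappa> W"
    and \<gamma>: "\<And>k u. k \<in> {1..3} \<Longrightarrow> u \<in> {0..1} \<Longrightarrow> g k (complex_of_real u) = \<gamma> k u"
  interpret tripod_chart a \<Delta> w g N \<kappa> W by (rule chart)
  interpret M: pade_setting a \<Delta> w g N \<kappa> W p n zn Sn
  proof unfold_locales
    show "open {t. poly p t \<noteq> 0}" by (intro open_Collect_neq continuous_intros)
    show "(\<lambda>t. 1 / poly p t) holomorphic_on {t. poly p t \<noteq> 0}" by (intro holomorphic_intros) auto
  qed (use assms in auto)
  have f: "f = M.f"
    unfolding f_def M.f_def using M.cauchy_transform_eq[OF \<gamma>] by (simp add: fun_eq_iff)
  show ?thesis
    using M.pade_formulas[of pn qn] \<open>pade_pair f n pn qn\<close>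
    unfolding f S_def S_conj_def M.S_def M.T_def by blast
qed

end
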